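(* Let $T$ be a nondegenerate Lie triple system over a field $\mathbf{F}$, let $\mathcal{F}$ be the power filter of $T$ consisting of all ideals of $T$ with zero centralizer, and let $L(\mathcal{F})=\{I\oplus\mathcal{L}(I,T)\mid I\in\mathcal{F}\}$ be the corresponding power filter on the standard embedding $L(T)$. Let the $\mathbb{Z}_2$-graded Lie algebra $Q=Q_0\oplus Q_1$ be the maximal Lie algebra of quotients of $L(T)$ with respect to $L(\mathcal{F})$, and regard $Q_1\supseteq T$ as a Lie triple system by $[q,q',q'']=[[q,q'],q'']$ for $q,q',q''\in Q_1$. Then $Q_1$ is a system of quotients of $T$. Moreover, $Q_1$ is the maximal system of quotients of $T$ in the following sense: if $S$ is any system of quotients of $T$, then there exists a monomorphism $\phi:S\to Q_1$ of Lie triple systems which is the identity on $T$.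
   Context: $\mathbf{F}$ is a field of arbitrary characteristic. A Lie triple system (LTS) over $\mathbf{F}$ is a vector space $T$ with a trilinear map $(x,y,z)\mapsto[x,y,z]$ such that $[x,x,z]=0$, $[x,y,z]+[y,z,x]+[z,x,y]=0$, and $[u,v,[x,y,z]]=[[u,v,x],y,z]+[x,[u,v,y],z]+[x,y,[u,v,z]]$ for all $x,y,z,u,v\in T$. A subsystem of $T$ is a subspace $I$ with $[I,I,I]\subseteq I$; an ideal of $T$ is a subspace $I$ with $[I,T,T]\subseteq I$. Brackets of subspaces denote the linear span of the corresponding brackets of elements; an element in such a bracket stands for itself. $T$ is nondegenerate if $[T,x,x]\neq0$ for every nonzero $x\in T$. The centralizer of a nonempty subset $I\subseteq T$ is $C_T(I)=\{x\in T\mid [x,I,T]=[T,I,x]=0\}$; for a Lie algebra $L$, $C_L(I)=\{x\in L\mid[x,I]=0\}$. Let $T$ be a subsystem of an LTS $S$. Define $R(x,y)(z)=[z,x,y]$ for $x,y,z\in S$. For $s\in S$, let ${}_T(s)$ be the linear span in $S$ of $s$ and all elements $R(x_1,y_1)\cdots R(x_n,y_n)(s)$ with $n\in\mathbb{N}$ and $x_i,y_i\in T$, and let $(T:s)=\{x\in T\mid [x,T,{}_T(s)]+[x,{}_T(s),T]\subseteq T\}$. $S$ is a system of quotients of $T$ if for all $s,s'\in S$ with $s\neq 0$ there exist $x,y\in T$ such that $[s,x,y]\neq 0$ and ($x\in (T:s')$ or $y\in (T:s')$). Standard embedding: for an LTS $T$, let $\mathcal{L}(x,y)(z)=[x,y,z]$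 and let $\mathcal{L}(A,B)$ be the $\mathbf{F}$-span of the operators $\mathcal{L}(a,b)$, $a\in A$, $b\in B$. The standard embedding is the $\mathbb{Z}_2$-graded Lie algebra $L(T)=L(T)_0\oplus L(T)_1$ with $L(T)_0=\mathcal{L}(T,T)$, $L(T)_1=T$ and product $$[(\mathcal{L}(x,y),z),(\mathcal{L}(u,v),w)]=(\mathcal{L}([u,v,y],x)-\mathcal{L}([u,v,x],y)+\mathcal{L}(z,w),\ [x,y,w]-[u,v,z]).$$ Filters: a filter on an LTS $T$ (resp. Lie algebra $L$) is a nonempty family $\mathcal{F}$ of nonzero ideals such that for $I_1,I_2\in\mathcal{F}$ there is $I\in\mathcal{F}$ with $I\subseteq I_1\cap I_2$; it is a power filter if for every $I\in\mathcal{F}$ there is $K\in\mathcal{F}$ with $K\subseteq[I,T,I]$ (resp. $K\subseteq[I,I]$). It is known that for nondegenerate $T$ the Lie algebra $L(T)$ is nondegenerate (i.e. $[[L(T),x],x]\neq0$ for $0\neq x\in L(T)$) and that $L(\mathcal{F})$ is a power filter of ideals with zero centralizer on $L(T)$. Lie algebras of quotients: let $\mathcal{G}$ be a power filter of ideals with zero centralizer on a Lie algebra $L$. A Lie algebra of (Martindale-like) quotients of $L$ with respect to $\mathcal{G}$ is a Lie algebra $Q\supseteq L$ such that for every nonzero $q\in Q$ there is $I_q\in\mathcal{G}$ with $0\neq[q,I_q]\subseteq L$. The maximal Lie algebra of quotients of $L$ with respect to $\mathcal{G}$ is a Lie algebra $Q$ of quotients of $L$ with respect to $\mathcal{G}$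 such that every Lie algebra of quotients $Q'$ of $L$ with respect to $\mathcal{G}$ admits a Lie monomorphism $Q'\to Q$ which is the identity on $L$. It is known (García–Gómez Lozano–Neher) that $Q$ exists, and for $L=L(T)$, $\mathcal{G}=L(\mathcal{F})$ as in the claim that it carries a $\mathbb{Z}_2$-grading $Q=Q_0\oplus Q_1$ with $L(T)_0\subseteq Q_0$ and $T=L(T)_1\subseteq Q_1$. *)

theory Defs
  imports Complex_Main "HOL-Library.Function_Algebras" "HOL-Library.Product_Plus"
begin

(* All structures live on subspaces of ambient vector spaces over the field 'f; brackets are
   only constrained on the respective subspace. *)

section \<open>Lie triple systems\<close>

locale lie_triple_system = vector_space scale
  for scale :: "'f::field \<Rightarrow> 'a::ab_group_add \<Rightarrow> 'a" (infixr \<open>*s\<close> 75) +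
  fixes T :: "'a set" and br :: "'a \<Rightarrow> 'a \<Rightarrow> 'a \<Rightarrow> 'a"
  assumes subspace_T: "subspace T"
    and closed: "\<lbrakk>x \<in> T; y \<in> T; z \<in> T\<rbrakk> \<Longrightarrow> br x y z \<in> T"
    and add1: "\<lbrakk>x \<in> T; x' \<in> T; y \<in> T; z \<in> T\<rbrakk> \<Longrightarrow> br (x + x') y z = br x y z + br x' y z"
    and add2: "\<lbrakk>x \<in> T; y \<in> T; y' \<in> T; z \<in> T\<rbrakk> \<Longrightarrow> br x (y + y') z = br x y z + br x y' z"
    and add3: "\<lbrakk>x \<in> T; y \<in> T; z \<in> T; z' \<in> T\<rbrakk> \<Longrightarrow> br x y (z + z') = br x y z + br x y z'"
    and scale1: "\<lbrakk>x \<in> T; y \<in> T; z \<in> T\<rbrakk> \<Longrightarrow> br (c *s x) y z = c *s br x y z"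
    and scale2: "\<lbrakk>x \<in> T; y \<in> T; z \<in> T\<rbrakk> \<Longrightarrow> br x (c *s y) z = c *s br x y z"
    and scale3: "\<lbrakk>x \<in> T; y \<in> T; z \<in> T\<rbrakk> \<Longrightarrow> br x y (c *s z) = c *s br x y z"
    and alt: "\<lbrakk>x \<in> T; z \<in> T\<rbrakk> \<Longrightarrow> br x x z = 0"
    and cyclic: "\<lbrakk>x \<in> T; y \<in> T; z \<in> T\<rbrakk> \<Longrightarrow> br x y z + br y z x + br z x y = 0"
    and derivation: "\<lbrakk>u \<in> T; v \<in> T; x \<in> T; y \<in> T; z \<in> T\<rbrakk> \<Longrightarrow>
      br u v (br x y z) = br (br u v x) y z + br x (br u v y) z + br x y (br u v z)"

definition lts_bracket ::
  "('f::field \<Rightarrow> 'a::ab_group_add \<Rightarrow> 'a) \<Rightarrow> ('a \<Rightarrow> 'a \<Rightarrow> 'a \<Rightarrow> 'a) \<Rightarrow> 'a set \<Rightarrow> 'a set \<Rightarrow> 'a set \<Rightarrow> 'a set"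
  where "lts_bracket sc br A B C = module.span sc {br a b c | a b c. a \<in> A \<and> b \<in> B \<and> c \<in> C}"

definition lts_subsystem ::
  "('f::field \<Rightarrow> 'a::ab_group_add \<Rightarrow> 'a) \<Rightarrow> 'a set \<Rightarrow> ('a \<Rightarrow> 'a \<Rightarrow> 'a \<Rightarrow> 'a) \<Rightarrow> 'a set \<Rightarrow> bool"
  where "lts_subsystem sc T br I \<longleftrightarrow>
    module.subspace sc I \<and> I \<subseteq> T \<and> lts_bracket sc br I I I \<subseteq> I"

definition lts_ideal ::
  "('f::field \<Rightarrow> 'a::ab_group_add \<Rightarrow> 'a) \<Rightarrow> 'a set \<Rightarrow> ('a \<Rightarrow> 'a \<Rightarrow> 'a \<Rightarrow> 'a) \<Rightarrow> 'a set \<Rightarrow> bool"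
  where "lts_ideal sc T br I \<longleftrightarrow>
    module.subspace sc I \<and> I \<subseteq> T \<and> lts_bracket sc br I T T \<subseteq> I"

definition lts_nondegenerate ::
  "('f::field \<Rightarrow> 'a::ab_group_add \<Rightarrow> 'a) \<Rightarrow> 'a set \<Rightarrow> ('a \<Rightarrow> 'a \<Rightarrow> 'a \<Rightarrow> 'a) \<Rightarrow> bool"
  where "lts_nondegenerate sc T br \<longleftrightarrow>
    (\<forall>x\<in>T. x \<noteq> 0 \<longrightarrow> lts_bracket sc br T {x} {x} \<noteq> {0})"

definition lts_centralizer ::
  "('f::field \<Rightarrow> 'a::ab_group_add \<Rightarrow> 'a) \<Rightarrow> 'a set \<Rightarrow> ('a \<Rightarrow> 'a \<Rightarrow> 'a \<Rightarrow> 'a) \<Rightarrow> 'a set \<Rightarrow> 'a set"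
  where "lts_centralizer sc T br I =
    {x \<in> T. lts_bracket sc br {x} I T = {0} \<and> lts_bracket sc br T I {x} = {0}}"

definition lts_power_filter ::
  "('f::field \<Rightarrow> 'a::ab_group_add \<Rightarrow> 'a) \<Rightarrow> 'a set \<Rightarrow> ('a \<Rightarrow> 'a \<Rightarrow> 'a \<Rightarrow> 'a) \<Rightarrow> 'a set set \<Rightarrow> bool"
  where "lts_power_filter sc T br F \<longleftrightarrow>
    F \<noteq> {} \<and> (\<forall>I\<in>F. lts_ideal sc T br I \<and> I \<noteq> {0}) \<and>
    (\<forall>I\<in>F. \<forall>J\<in>F. \<exists>K\<in>F. K \<subseteq> I \<inter> J) \<and>
    (\<forall>I\<in>F. \<exists>K\<in>F. K \<subseteq> lts_bracket sc br I T I)"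

definition zero_centralizer_ideals ::
  "('f::field \<Rightarrow> 'a::ab_group_add \<Rightarrow> 'a) \<Rightarrow> 'a set \<Rightarrow> ('a \<Rightarrow> 'a \<Rightarrow> 'a \<Rightarrow> 'a) \<Rightarrow> 'a set set"
  where "zero_centralizer_ideals sc T br =
    {I. lts_ideal sc T br I \<and> lts_centralizer sc T br I = {0}}"

definition linear_map_on ::
  "('f::field \<Rightarrow> 'a::ab_group_add \<Rightarrow> 'a) \<Rightarrow> 'a set \<Rightarrow> ('f \<Rightarrow> 'b::ab_group_add \<Rightarrow> 'b) \<Rightarrow> 'b set \<Rightarrow>
   ('a \<Rightarrow> 'b) \<Rightarrow> bool"
  where "linear_map_on sV V sW W f \<longleftrightarrow> f ` V \<subseteq> W \<and>
    (\<forall>x\<in>V. \<forall>y\<in>V. f (x + y) = f x + f y) \<and> (\<forall>c. \<forall>x\<in>V. f (sV c x) = sW c (f x))"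

definition lts_mono ::
  "('f::field \<Rightarrow> 'a::ab_group_add \<Rightarrow> 'a) \<Rightarrow> 'a set \<Rightarrow> ('a \<Rightarrow> 'a \<Rightarrow> 'a \<Rightarrow> 'a) \<Rightarrow>
   ('f \<Rightarrow> 'b::ab_group_add \<Rightarrow> 'b) \<Rightarrow> 'b set \<Rightarrow> ('b \<Rightarrow> 'b \<Rightarrow> 'b \<Rightarrow> 'b) \<Rightarrow> ('a \<Rightarrow> 'b) \<Rightarrow> bool"
  where "lts_mono sT T brT sS S brS f \<longleftrightarrow> linear_map_on sT T sS S f \<and> inj_on f T \<and>
    (\<forall>x\<in>T. \<forall>y\<in>T. \<forall>z\<in>T. f (brT x y z) = brS (f x) (f y) (f z))"


section \<open>Systems of quotients\<close>

(* The list [(x1,y1),...,(xn,yn)] gives R(x1,y1) ... R(xn,yn)(s); the empty list gives s. *)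
definition R_span ::
  "('f::field \<Rightarrow> 'a::ab_group_add \<Rightarrow> 'a) \<Rightarrow> ('a \<Rightarrow> 'a \<Rightarrow> 'a \<Rightarrow> 'a) \<Rightarrow> 'a set \<Rightarrow> 'a \<Rightarrow> 'a set"
  where "R_span sc br T s =
    module.span sc {foldr (\<lambda>(x, y) z. br z x y) ps s | ps. set ps \<subseteq> T \<times> T}"

definition transporter ::
  "('f::field \<Rightarrow> 'a::ab_group_add \<Rightarrow> 'a) \<Rightarrow> ('a \<Rightarrow> 'a \<Rightarrow> 'a \<Rightarrow> 'a) \<Rightarrow> 'a set \<Rightarrow> 'a \<Rightarrow> 'a set"
  where "transporter sc br T s =
    {x \<in> T. lts_bracket sc br {x} T (R_span sc br T s) \<subseteq> T \<and>
            lts_bracket sc br {x} (R_span sc br T s) T \<subseteq> T}"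

definition system_of_quotients ::
  "('f::field \<Rightarrow> 'a::ab_group_add \<Rightarrow> 'a) \<Rightarrow> 'a set \<Rightarrow> ('a \<Rightarrow> 'a \<Rightarrow> 'a \<Rightarrow> 'a) \<Rightarrow> 'a set \<Rightarrow> bool"
  where "system_of_quotients sc S br T \<longleftrightarrow>
    lie_triple_system sc S br \<and> lts_subsystem sc S br T \<and>
    (\<forall>s\<in>S. \<forall>s'\<in>S. s \<noteq> 0 \<longrightarrow> (\<exists>x\<in>T. \<exists>y\<in>T. br s x y \<noteq> 0 \<and>
      (x \<in> transporter sc br T s' \<or> y \<in> transporter sc br T s')))"


section \<open>Lie algebras\<close>

locale lie_algebra = vector_space scale
  for scale :: "'f::field \<Rightarrow> 'a::ab_group_add \<Rightarrow> 'a" (infixr \<open>*s\<close> 75) +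
  fixes L :: "'a set" and br :: "'a \<Rightarrow> 'a \<Rightarrow> 'a"
  assumes subspace_L: "subspace L"
    and closed: "\<lbrakk>x \<in> L; y \<in> L\<rbrakk> \<Longrightarrow> br x y \<in> L"
    and add1: "\<lbrakk>x \<in> L; x' \<in> L; y \<in> L\<rbrakk> \<Longrightarrow> br (x + x') y = br x y + br x' y"
    and add2: "\<lbrakk>x \<in> L; y \<in> L; y' \<in> L\<rbrakk> \<Longrightarrow> br x (y + y') = br x y + br x y'"
    and scale1: "\<lbrakk>x \<in> L; y \<in> L\<rbrakk> \<Longrightarrow> br (c *s x) y = c *s br x y"
    and scale2: "\<lbrakk>x \<in> L; y \<in> L\<rbrakk> \<Longrightarrow> br x (c *s y) = c *s br x y"
    and alt: "x \<in> L \<Longrightarrow> br x x = 0"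
    and jacobi: "\<lbrakk>x \<in> L; y \<in> L; z \<in> L\<rbrakk> \<Longrightarrow> br x (br y z) + br y (br z x) + br z (br x y) = 0"

definition lie_bracket ::
  "('f::field \<Rightarrow> 'a::ab_group_add \<Rightarrow> 'a) \<Rightarrow> ('a \<Rightarrow> 'a \<Rightarrow> 'a) \<Rightarrow> 'a set \<Rightarrow> 'a set \<Rightarrow> 'a set"
  where "lie_bracket sc br A B = module.span sc {br a b | a b. a \<in> A \<and> b \<in> B}"

definition lie_ideal ::
  "('f::field \<Rightarrow> 'a::ab_group_add \<Rightarrow> 'a) \<Rightarrow> 'a set \<Rightarrow> ('a \<Rightarrow> 'a \<Rightarrow> 'a) \<Rightarrow> 'a set \<Rightarrow> bool"
  where "lie_ideal sc L br I \<longleftrightarrow>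
    module.subspace sc I \<and> I \<subseteq> L \<and> lie_bracket sc br I L \<subseteq> I"

definition lie_centralizer :: "'a::ab_group_add set \<Rightarrow> ('a \<Rightarrow> 'a \<Rightarrow> 'a) \<Rightarrow> 'a set \<Rightarrow> 'a set"
  where "lie_centralizer L br I = {x \<in> L. \<forall>y\<in>I. br x y = 0}"

definition lie_power_filter ::
  "('f::field \<Rightarrow> 'a::ab_group_add \<Rightarrow> 'a) \<Rightarrow> 'a set \<Rightarrow> ('a \<Rightarrow> 'a \<Rightarrow> 'a) \<Rightarrow> 'a set set \<Rightarrow> bool"
  where "lie_power_filter sc L br G \<longleftrightarrow>
    G \<noteq> {} \<and> (\<forall>I\<in>G. lie_ideal sc L br I \<and> I \<noteq> {0}) \<and>
    (\<forall>I\<in>G. \<forall>J\<in>G. \<exists>K\<in>G. K \<subseteq> I \<inter> J) \<and>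
    (\<forall>I\<in>G. \<exists>K\<in>G. K \<subseteq> lie_bracket sc br I I)"

definition lie_mono ::
  "('f::field \<Rightarrow> 'a::ab_group_add \<Rightarrow> 'a) \<Rightarrow> 'a set \<Rightarrow> ('a \<Rightarrow> 'a \<Rightarrow> 'a) \<Rightarrow>
   ('f \<Rightarrow> 'b::ab_group_add \<Rightarrow> 'b) \<Rightarrow> 'b set \<Rightarrow> ('b \<Rightarrow> 'b \<Rightarrow> 'b) \<Rightarrow> ('a \<Rightarrow> 'b) \<Rightarrow> bool"
  where "lie_mono sL L brL sM M brM f \<longleftrightarrow> linear_map_on sL L sM M f \<and> inj_on f L \<and>
    (\<forall>x\<in>L. \<forall>y\<in>L. f (brL x y) = brM (f x) (f y))"

definition z2_grading ::
  "('f::field \<Rightarrow> 'a::ab_group_add \<Rightarrow> 'a) \<Rightarrow> 'a set \<Rightarrow> ('a \<Rightarrow> 'a \<Rightarrow> 'a) \<Rightarrow> 'a set \<Rightarrow> 'a set \<Rightarrow> bool"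
  where "z2_grading sc L br L0 L1 \<longleftrightarrow>
    module.subspace sc L0 \<and> module.subspace sc L1 \<and>
    L = {x + y | x y. x \<in> L0 \<and> y \<in> L1} \<and> L0 \<inter> L1 = {0} \<and>
    lie_bracket sc br L0 L0 \<subseteq> L0 \<and> lie_bracket sc br L0 L1 \<subseteq> L1 \<and>
    lie_bracket sc br L1 L0 \<subseteq> L1 \<and> lie_bracket sc br L1 L1 \<subseteq> L0"


section \<open>Standard embedding\<close>

(* Operators on T are represented by functions on the ambient space that vanish outside T, so
   that equality of representatives is equality of operators on T. *)
definition lmult :: "'a::ab_group_add set \<Rightarrow> ('a \<Rightarrow> 'a \<Rightarrow> 'a \<Rightarrow> 'a) \<Rightarrow> 'a \<Rightarrow> 'a \<Rightarrow> 'a \<Rightarrow> 'a"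
  where "lmult T br x y = (\<lambda>z. if z \<in> T then br x y z else 0)"

definition op_scale :: "('f::field \<Rightarrow> 'a::ab_group_add \<Rightarrow> 'a) \<Rightarrow> 'f \<Rightarrow> ('a \<Rightarrow> 'a) \<Rightarrow> 'a \<Rightarrow> 'a"
  where "op_scale sc c D = (\<lambda>z. sc c (D z))"

definition lmult_span ::
  "('f::field \<Rightarrow> 'a::ab_group_add \<Rightarrow> 'a) \<Rightarrow> 'a set \<Rightarrow> ('a \<Rightarrow> 'a \<Rightarrow> 'a \<Rightarrow> 'a) \<Rightarrow> 'a set \<Rightarrow> 'a set \<Rightarrow> ('a \<Rightarrow> 'a) set"
  where "lmult_span sc T br A B =
    module.span (op_scale sc) {lmult T br a b | a b. a \<in> A \<and> b \<in> B}"

definition stdemb ::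
  "('f::field \<Rightarrow> 'a::ab_group_add \<Rightarrow> 'a) \<Rightarrow> 'a set \<Rightarrow> ('a \<Rightarrow> 'a \<Rightarrow> 'a \<Rightarrow> 'a) \<Rightarrow> (('a \<Rightarrow> 'a) \<times> 'a) set"
  where "stdemb sc T br = lmult_span sc T br T T \<times> T"

definition stdemb_scale ::
  "('f::field \<Rightarrow> 'a::ab_group_add \<Rightarrow> 'a) \<Rightarrow> 'f \<Rightarrow> ('a \<Rightarrow> 'a) \<times> 'a \<Rightarrow> ('a \<Rightarrow> 'a) \<times> 'a"
  where "stdemb_scale sc c p = (op_scale sc c (fst p), sc c (snd p))"

(* Closed form of the bilinear product; stdemb_bracket_lmult below gives its values on
   generators, which determine it. *)
definition stdemb_bracket ::
  "'a::ab_group_add set \<Rightarrow> ('a \<Rightarrow> 'a \<Rightarrow> 'a \<Rightarrow> 'a) \<Rightarrow> ('a \<Rightarrow> 'a) \<times> 'a \<Rightarrow> ('a \<Rightarrow> 'a) \<times> 'a \<Rightarrow> ('a \<Rightarrow> 'a) \<times> 'a"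
  where "stdemb_bracket T br p q =
    ((fst p \<circ> fst q) - (fst q \<circ> fst p) + lmult T br (snd p) (snd q), fst p (snd q) - fst q (snd p))"

definition stdemb_ideal ::
  "('f::field \<Rightarrow> 'a::ab_group_add \<Rightarrow> 'a) \<Rightarrow> 'a set \<Rightarrow> ('a \<Rightarrow> 'a \<Rightarrow> 'a \<Rightarrow> 'a) \<Rightarrow> 'a set \<Rightarrow> (('a \<Rightarrow> 'a) \<times> 'a) set"
  where "stdemb_ideal sc T br I = lmult_span sc T br I T \<times> I"


section \<open>Lie algebras of quotients\<close>

(* The inclusion of L in Q is an arbitrary embedding e, so that Q may live on another type. G is
   intended to be a power filter of ideals with zero centralizer on L; for the filter of the main
   theorem this is lie_power_filter_stdemb_ideals below. *)
definition lie_algebra_of_quotients ::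
  "('f::field \<Rightarrow> 'l::ab_group_add \<Rightarrow> 'l) \<Rightarrow> 'l set \<Rightarrow> ('l \<Rightarrow> 'l \<Rightarrow> 'l) \<Rightarrow> 'l set set \<Rightarrow>
   ('f \<Rightarrow> 'q::ab_group_add \<Rightarrow> 'q) \<Rightarrow> 'q set \<Rightarrow> ('q \<Rightarrow> 'q \<Rightarrow> 'q) \<Rightarrow> ('l \<Rightarrow> 'q) \<Rightarrow> bool"
  where "lie_algebra_of_quotients sL L brL G sQ Q brQ e \<longleftrightarrow>
    lie_algebra sQ Q brQ \<and> lie_mono sL L brL sQ Q brQ e \<and>
    (\<forall>q\<in>Q. q \<noteq> 0 \<longrightarrow> (\<exists>I\<in>G. lie_bracket sQ brQ {q} (e ` I) \<noteq> {0} \<and>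
                            lie_bracket sQ brQ {q} (e ` I) \<subseteq> e ` L))"

(* Maximality tests all Lie algebras of quotients whose vector space is a subspace of
   ('l set \<times> ('l \<Rightarrow> 'l)) \<Rightarrow> 'f. Up to isomorphism these are all of them: for a power filter G of
   ideals with zero centralizer an element q of a Lie algebra of quotients is determined by any
   I in G with [q, I] \<subseteq> L together with ad q : I \<rightarrow> L, so its dimension is at most the
   cardinality of 'l set \<times> ('l \<Rightarrow> 'l). *)
definition maximal_lie_algebra_of_quotients ::
  "('f::field \<Rightarrow> 'l::ab_group_add \<Rightarrow> 'l) \<Rightarrow> 'l set \<Rightarrow> ('l \<Rightarrow> 'l \<Rightarrow> 'l) \<Rightarrow> 'l set set \<Rightarrow>
   ('f \<Rightarrow> 'q::ab_group_add \<Rightarrow> 'q) \<Rightarrow> 'q set \<Rightarrow> ('q \<Rightarrow> 'q \<Rightarrow> 'q) \<Rightarrow> ('l \<Rightarrow> 'q) \<Rightarrow> bool"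
  where "maximal_lie_algebra_of_quotients sL L brL G sQ Q brQ e \<longleftrightarrow>
    lie_algebra_of_quotients sL L brL G sQ Q brQ e \<and>
    (\<forall>(Q' :: ('l set \<times> ('l \<Rightarrow> 'l) \<Rightarrow> 'f) set) brQ' e'.
      lie_algebra_of_quotients sL L brL G (\<lambda>c v i. c * v i) Q' brQ' e' \<longrightarrow>
      (\<exists>\<psi>. lie_mono (\<lambda>c v i. c * v i) Q' brQ' sQ Q brQ \<psi> \<and> (\<forall>x\<in>L. \<psi> (e' x) = e x)))"

section \<open>Consistency of the definitions\<close>

(* The standard embedding is a Lie algebra with the stated product on generators, and for nonzero
   nondegenerate T the two families of ideals are power filters, as is presupposed when forming
   algebras of quotients. *)
lemma (in vector_space) span_subset_iff: "subspace I \<Longrightarrow> span A \<subseteq> I \<longleftrightarrow> A \<subseteq> I"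
  using span_minimal span_superset by (meson order_trans)

context lie_triple_system
begin

lemma zero_T: "0 \<in> T"
  using subspace_T subspace_0 by blast

lemma uminus_T: "x \<in> T \<Longrightarrow> - x \<in> T"
  using subspace_T subspace_neg by blast

lemma add_T: "x \<in> T \<Longrightarrow> y \<in> T \<Longrightarrow> x + y \<in> T"
  using subspace_T subspace_add by blast

lemma zero1: "y \<in> T \<Longrightarrow> z \<in> T \<Longrightarrow> br 0 y z = 0"
  using add1[of 0 0 y z] zero_T by simp

lemma zero2: "x \<in> T \<Longrightarrow> z \<in> T \<Longrightarrow> br x 0 z = 0"
  using add2[of x 0 0 z] zero_T by simp

lemma zero3: "x \<in> T \<Longrightarrow> y \<in> T \<Longrightarrow> br x y 0 = 0"
  using add3[of x y 0 0] zero_T by simp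

lemma antisymm: "x \<in> T \<Longrightarrow> y \<in> T \<Longrightarrow> z \<in> T \<Longrightarrow> br y x z = - br x y z"
  using alt[of "x + y" z] alt[of x z] alt[of y z]
  by (simp add: add1 add2 add_T eq_neg_iff_add_eq_0 add.commute)

lemma neg3: "x \<in> T \<Longrightarrow> y \<in> T \<Longrightarrow> z \<in> T \<Longrightarrow> br x y (- z) = - br x y z"
  using add3[of x y z "- z"] zero3[of x y] uminus_T[of z]
  by (simp add: eq_neg_iff_add_eq_0 add.commute)

lemma stdemb_bracket_lmult:
  assumes "x \<in> T" "y \<in> T" "z \<in> T" "u \<in> T" "v \<in> T" "w \<in> T"
  shows "stdemb_bracket T br (lmult T br x y, z) (lmult T br u v, w) =
    (lmult T br (br u v y) x - lmult T br (br u v x) y + lmult T br z w, br x y w - br u v z)"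
proof -
  have "br x y (br u v a) - br u v (br x y a) = br (br u v y) x a - br (br u v x) y a"
    if a: "a \<in> T" for a
    using derivation[OF assms(4,5,1,2) a] antisymm[of "br u v y" x a] assms a
    by (simp add: closed algebra_simps)
  moreover have "br x y 0 = 0" "br u v 0 = 0"
    using assms by (auto simp: zero3)
  ultimately have "(lmult T br x y \<circ> lmult T br u v) - (lmult T br u v \<circ> lmult T br x y) =
      lmult T br (br u v y) x - lmult T br (br u v x) y"
    using assms by (intro ext) (simp add: lmult_def closed)
  then show ?thesis
    using assms by (simp add: stdemb_bracket_def) (simp add: lmult_def)
qed

lemma lts_bracket_subset_iff:
  "subspace I \<Longrightarrow> lts_bracket scale b A B C \<subseteq> I \<longleftrightarrow> (\<forall>x\<in>A. \<forall>y\<in>B. \<forall>z\<in>C. b x y z \<in> I)"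
  unfolding lts_bracket_def by (subst span_subset_iff, assumption) blast

lemma lts_bracket_zero_iff:
  "lts_bracket scale b A B C = {0} \<longleftrightarrow> (\<forall>x\<in>A. \<forall>y\<in>B. \<forall>z\<in>C. b x y z = 0)"
proof -
  have "lts_bracket scale b A B C = {0} \<longleftrightarrow> lts_bracket scale b A B C \<subseteq> {0}"
    unfolding lts_bracket_def using span_zero by blast
  then show ?thesis by (simp add: lts_bracket_subset_iff)
qed

lemma lts_ideal_iff:
  "lts_ideal scale T br I \<longleftrightarrow> subspace I \<and> I \<subseteq> T \<and> (\<forall>x\<in>I. \<forall>y\<in>T. \<forall>z\<in>T. br x y z \<in> I)"
  unfolding lts_ideal_def using lts_bracket_subset_iff by metis

lemma ideal_closed:
  assumes "lts_ideal scale T br I" "x \<in> I" "y \<in> T" "z \<in> T"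
  shows "x \<in> T" "br x y z \<in> I" "br y x z \<in> I" "br y z x \<in> I"
proof -
  have I: "subspace I" "I \<subseteq> T" "\<And>x y z. x \<in> I \<Longrightarrow> y \<in> T \<Longrightarrow> z \<in> T \<Longrightarrow> br x y z \<in> I"
    using assms(1) by (auto simp: lts_ideal_iff)
  show xT: "x \<in> T" using I assms by blast
  show 1: "br x y z \<in> I" using I assms by blast
  have 3: "br x z y \<in> I" using I assms by blast
  show 2: "br y x z \<in> I"
    using antisymm[OF xT assms(3,4)] 1 subspace_neg[OF I(1)] by simp
  have "br y z x = br x z y - br x y z"
    using cyclic[OF xT assms(3,4)] antisymm[OF xT assms(4,3)] by (simp add: algebra_simps eq_neg_iff_add_eq_0)
  then show "br y z x \<in> I" using 1 3 subspace_diff[OF I(1)] by simp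
qed

lemma centralizer_iff:
  "x \<in> lts_centralizer scale T br I \<longleftrightarrow>
    x \<in> T \<and> (\<forall>i\<in>I. \<forall>t\<in>T. br x i t = 0) \<and> (\<forall>i\<in>I. \<forall>t\<in>T. br t i x = 0)"
  by (auto simp: lts_centralizer_def lts_bracket_zero_iff)

lemma centralizer_zero:
  assumes "I \<subseteq> T" "x \<in> lts_centralizer scale T br I" "i \<in> I" "t \<in> T"
  shows "br x i t = 0" "br i x t = 0" "br t i x = 0" "br i t x = 0" "br x t i = 0" "br t x i = 0"
proof -
  have T: "x \<in> T" "i \<in> T" using assms by (auto simp: centralizer_iff)
  show 1: "br x i t = 0" and 2: "br t i x = 0" using assms by (auto simp: centralizer_iff)
  show "br i x t = 0" using antisymm[of x i t] T assms 1 by simp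
  show "br i t x = 0" using antisymm[of t i x] T assms 2 by simp
  have "br x t i = 0" using cyclic[of x t i] antisymm[of x i t] T assms 1 2 by simp
  then show "br x t i = 0" "br t x i = 0" using antisymm[of x t i] T assms by auto
qed

lemma ideal_centralizer:
  assumes I: "lts_ideal scale T br I"
  shows "lts_ideal scale T br (lts_centralizer scale T br I)"
proof -
  let ?C = "lts_centralizer scale T br I"
  have IT: "I \<subseteq> T" using I by (simp add: lts_ideal_iff)
  have sub: "subspace ?C"
    unfolding subspace_def
    using IT subspace_scale[OF subspace_T]
    by (simp add: centralizer_iff zero_T zero1 zero3 add1 add3 add_T scale1 scale3 subset_eq)
  have "br x a b \<in> ?C" if x: "x \<in> ?C" and ab: "a \<in> T" "b \<in> T" for x a b
  proof -
    note cz = centralizer_zero[OF IT x]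
    have xT: "x \<in> T" using x by (simp add: centralizer_iff)
    have key: "br t i (br x a c) = 0" if "i \<in> I" "t \<in> T" "c \<in> T" for i t c
    proof -
      have T: "i \<in> T" using IT that by blast
      have "br t i a \<in> I" "br t i c \<in> I" using ideal_closed[OF I that(1)] that ab by auto
      then have "br x (br t i a) c = 0" "br x a (br t i c) = 0" "br t i x = 0"
        using cz that ab by auto
      then show ?thesis
        using derivation[OF that(2) T xT ab(1) that(3)] ab that by (simp add: zero1)
    qed
    have "br (br x a b) i t = 0" if it: "i \<in> I" "t \<in> T" for i t
    proof -
      have T: "i \<in> T" using IT it by blast
      have "br b i t \<in> I" using ideal_closed[OF I it(1)] it ab by auto
      then have "br x a (br b i t) = 0" "br x a i = 0" using cz it ab by auto
      moreover have "br b i (br x a t) = 0" using key it ab by auto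
      ultimately show ?thesis
        using derivation[OF xT ab(1) ab(2) T it(2)] ab it by (simp add: zero2)
    qed
    then show ?thesis using key xT ab by (simp add: centralizer_iff closed)
  qed
  then show ?thesis using sub by (auto simp: lts_ideal_iff centralizer_iff)
qed

lemma ideal_Int:
  "lts_ideal scale T br I \<Longrightarrow> lts_ideal scale T br J \<Longrightarrow> lts_ideal scale T br (I \<inter> J)"
  by (auto simp: lts_ideal_iff intro: subspace_inter)

lemma nondegD:
  assumes "lts_nondegenerate scale T br" "x \<in> T" "\<And>t. t \<in> T \<Longrightarrow> br t x x = 0"
  shows "x = 0"
  using assms unfolding lts_nondegenerate_def lts_bracket_zero_iff by blast


theorem power_filter_zero_centralizer_ideals:
  assumes nd: "lts_nondegenerate scale T br" and nz: "T \<noteq> {0}"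
  shows "lts_power_filter scale T br (zero_centralizer_ideals scale T br)"
proof -
  let ?C = "lts_centralizer scale T br" and ?F = "zero_centralizer_ideals scale T br"
  have C0: "0 \<in> ?C I" if "I \<subseteq> T" for I
    using that by (auto simp: centralizer_iff zero_T zero1 zero3 subset_iff)
  have TT: "T \<in> ?F"
  proof -
    have "x = 0" if "x \<in> ?C T" for x
      using nondegD[OF nd, of x] that by (auto simp: centralizer_iff)
    then show ?thesis
      using C0[of T] by (auto simp: zero_centralizer_ideals_def lts_ideal_iff subspace_T closed)
  qed
  have ne: "I \<noteq> {0}" if "I \<in> ?F" for I
  proof
    assume "I = {0}"
    then have "?C I = T" by (auto simp: centralizer_iff zero2 zero1)
    then show False using that nz by (simp add: zero_centralizer_ideals_def)
  qed
  have int: "I \<inter> J \<in> ?F" if "I \<in> ?F" "J \<in> ?F" for I J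
  proof -
    have I: "lts_ideal scale T br I" "?C I = {0}" and J: "lts_ideal scale T br J" "?C J = {0}"
      using that by (auto simp: zero_centralizer_ideals_def)
    have K: "lts_ideal scale T br (I \<inter> J)" using I J by (simp add: ideal_Int)
    then have IJT: "I \<inter> J \<subseteq> T" by (simp add: lts_ideal_iff)
    let ?A = "?C (I \<inter> J)"
    have A: "lts_ideal scale T br ?A" using ideal_centralizer[OF K] .
    have 1: "x = 0" if "x \<in> ?A" "x \<in> I" "x \<in> J" for x
      using nondegD[OF nd, of x] that by (auto simp: centralizer_iff)
    have 2: "x = 0" if x: "x \<in> ?A" "x \<in> I" for x
    proof -
      have xT: "x \<in> T" using x by (simp add: centralizer_iff)
      have "br x j t = 0 \<and> br t j x = 0" if "j \<in> J" "t \<in> T" for j t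
        using that ideal_closed[OF J(1) that(1), of x t] ideal_closed[OF J(1) that(1), of t x]
          ideal_closed[OF A x(1), of j t] ideal_closed[OF A x(1), of t j]
          ideal_closed[OF I(1) x(2), of j t] ideal_closed[OF I(1) x(2), of t j] xT
        by (auto intro!: 1)
      then have "x \<in> ?C J" using xT by (auto simp: centralizer_iff)
      then show ?thesis using J by auto
    qed
    have "x = 0" if x: "x \<in> ?A" for x
    proof -
      have xT: "x \<in> T" using x by (simp add: centralizer_iff)
      have "br x j t = 0 \<and> br t j x = 0" if "j \<in> I" "t \<in> T" for j t
        using that ideal_closed[OF I(1) that(1), of x t] ideal_closed[OF I(1) that(1), of t x]
          ideal_closed[OF A x(1), of j t] ideal_closed[OF A x(1), of t j] xT
        by (auto intro!: 2)
      then have "x \<in> ?C I" using xT by (auto simp: centralizer_iff)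
      then show ?thesis using I by auto
    qed
    then have "?A = {0}" using C0[OF IJT] by auto
    then show ?thesis using K by (simp add: zero_centralizer_ideals_def)
  qed
  have pow: "lts_bracket scale br I T I \<in> ?F" if "I \<in> ?F" for I
  proof -
    let ?K = "lts_bracket scale br I T I"
    have I: "lts_ideal scale T br I" "?C I = {0}" using that by (auto simp: zero_centralizer_ideals_def)
    then have IT: "I \<subseteq> T" and sI: "subspace I" by (auto simp: lts_ideal_iff)
    have sK: "subspace ?K" unfolding lts_bracket_def by simp
    have KI: "?K \<subseteq> I" using lts_bracket_subset_iff[OF sI] ideal_closed[OF I(1)] IT by blast
    have gen: "br i t j \<in> ?K" if "i \<in> I" "t \<in> T" "j \<in> I" for i t j
      unfolding lts_bracket_def by (rule span_base) (use that in blast)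
    have gen2: "br i j t \<in> ?K" if "i \<in> I" "t \<in> T" "j \<in> I" for i t j
    proof -
      have T: "i \<in> T" "j \<in> T" using that IT by auto
      have "br i j t = br i t j - br j t i"
        using cyclic[OF T(1) T(2) that(2)] antisymm[OF T(1) that(2) T(2)] by (simp add: eq_diff_eq)
      then show ?thesis using gen that subspace_diff[OF sK] by simp
    qed
    have gen3: "br (br i t j) x y \<in> ?K"
      if h: "i \<in> I" "t \<in> T" "j \<in> I" and xy: "x \<in> T" "y \<in> T" for i t j x y
    proof -
      have T: "i \<in> T" "j \<in> T" using h IT by auto
      have "br (br i t j) x y = br i t (br j x y) - br j (br i t x) y - br j x (br i t y)"
        using derivation[OF T(1) h(2) T(2) xy] by simp
      moreover have "br i t (br j x y) \<in> ?K"
        using gen[OF h(1,2)] ideal_closed(2)[OF I(1) h(3) xy] by blast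
      moreover have "br j (br i t x) y \<in> ?K"
        using gen2[OF h(3) xy(2)] ideal_closed(2)[OF I(1) h(1,2) xy(1)] by blast
      moreover have "br j x (br i t y) \<in> ?K"
        using gen[OF h(3) xy(1)] ideal_closed(2)[OF I(1) h(1,2) xy(2)] by blast
      ultimately show ?thesis using subspace_diff[OF sK] by simp
    qed
    have KT: "?K \<subseteq> T" using KI IT by blast
    have "br k x y \<in> ?K \<and> k \<in> T" if k: "k \<in> ?K" and xy: "x \<in> T" "y \<in> T" for k x y
      using k unfolding lts_bracket_def[of scale br I T I]
    proof (induction rule: span_induct_alt)
      case base
      then show ?case using xy zero_T by (simp add: zero1 span_zero)
    next
      case (step c z w)
      then obtain i t j where z: "z = br i t j" "i \<in> I" "t \<in> T" "j \<in> I" by blast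
      then have zT: "z \<in> T" using closed IT by blast
      moreover have "br z x y \<in> ?K" using gen3 z xy by simp
      moreover have "c *s z \<in> T" using zT subspace_T by (simp add: subspace_scale)
      ultimately show ?case using step.IH xy
        by (simp add: add1 scale1 add_T span_add span_scale lts_bracket_def)
    qed
    then have K: "lts_ideal scale T br ?K" using sK KT by (auto simp: lts_ideal_iff)
    let ?A = "?C ?K"
    have A: "lts_ideal scale T br ?A" using ideal_centralizer[OF K] .
    have 1: "x = 0" if "x \<in> ?A" "x \<in> ?K" for x
      using nondegD[OF nd, of x] that by (auto simp: centralizer_iff)
    have 2: "x = 0" if x: "x \<in> ?A" "x \<in> I" for x
    proof -
      have xT: "x \<in> T" using x IT by auto
      have "br t x x = 0" if t: "t \<in> T" for t
      proof (rule 1)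
        show "br t x x \<in> ?A" using ideal_closed[OF A x(1) t xT] by simp
        show "br t x x \<in> ?K"
          using gen[OF x(2) t x(2)] antisymm[OF xT t xT] subspace_neg[OF sK] by simp
      qed
      then show ?thesis using nondegD[OF nd xT] by blast
    qed
    have "x = 0" if x: "x \<in> ?A" for x
    proof -
      have xT: "x \<in> T" using x by (simp add: centralizer_iff)
      have "br x j t = 0 \<and> br t j x = 0" if "j \<in> I" "t \<in> T" for j t
        using that ideal_closed[OF I(1) that(1), of x t] ideal_closed[OF I(1) that(1), of t x]
          ideal_closed[OF A x(1), of j t] ideal_closed[OF A x(1), of t j] xT IT
        by (auto intro!: 2)
      then have "x \<in> ?C I" using xT by (auto simp: centralizer_iff)
      then show ?thesis using I by auto
    qed
    then have "?A = {0}" using C0[OF KT] by auto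
    then show ?thesis using K by (simp add: zero_centralizer_ideals_def)
  qed
  have "lts_ideal scale T br I \<and> I \<noteq> {0}" if "I \<in> ?F" for I
    using ne[OF that] that unfolding zero_centralizer_ideals_def by blast
  moreover have "?F \<noteq> {}" using TT by blast
  moreover have "\<exists>K\<in>?F. K \<subseteq> I \<inter> J" if "I \<in> ?F" "J \<in> ?F" for I J
    using int[OF that] by blast
  moreover have "\<exists>K\<in>?F. K \<subseteq> lts_bracket scale br I T I" if "I \<in> ?F" for I
    using pow[OF that] by blast
  ultimately show ?thesis unfolding lts_power_filter_def by simp
qed

lemma vector_space_op: "vector_space (op_scale scale)"
  by unfold_locales (simp_all add: op_scale_def fun_eq_iff scale_right_distrib scale_left_distrib)

lemma vector_space_stdemb: "vector_space (stdemb_scale scale)"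
proof -
  interpret op: vector_space "op_scale scale" by (rule vector_space_op)
  show ?thesis
    by unfold_locales (simp_all add: stdemb_scale_def prod_eq_iff op.scale_right_distrib
        op.scale_left_distrib scale_right_distrib scale_left_distrib)
qed

interpretation op: vector_space "op_scale scale" by (rule vector_space_op)
interpretation st: vector_space "stdemb_scale scale" by (rule vector_space_stdemb)

definition derivations :: "('a \<Rightarrow> 'a) set"
  where "derivations = {D. (\<forall>z\<in>T. D z \<in> T) \<and> (\<forall>z. z \<notin> T \<longrightarrow> D z = 0) \<and>
    (\<forall>y\<in>T. \<forall>z\<in>T. D (y + z) = D y + D z) \<and> (\<forall>c. \<forall>z\<in>T. D (c *s z) = c *s D z) \<and>
    (\<forall>x\<in>T. \<forall>y\<in>T. \<forall>z\<in>T. D (br x y z) = br (D x) y z + br x (D y) z + br x y (D z))}"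

lemma scale_T: "x \<in> T \<Longrightarrow> c *s x \<in> T"
  using subspace_T subspace_scale by blast

lemma derivationsD:
  assumes "D \<in> derivations"
  shows "z \<in> T \<Longrightarrow> D z \<in> T" "z \<notin> T \<Longrightarrow> D z = 0"
    "y \<in> T \<Longrightarrow> z \<in> T \<Longrightarrow> D (y + z) = D y + D z" "z \<in> T \<Longrightarrow> D (c *s z) = c *s D z"
    "x \<in> T \<Longrightarrow> y \<in> T \<Longrightarrow> z \<in> T \<Longrightarrow> D (br x y z) = br (D x) y z + br x (D y) z + br x y (D z)"
  using assms by (simp_all add: derivations_def)

lemma subspace_derivations: "op.subspace derivations"
proof (rule op.subspaceI)
  show "0 \<in> derivations"
    by (simp add: derivations_def zero_T zero1 zero2 zero3)
  show "D + E \<in> derivations" if "D \<in> derivations" "E \<in> derivations" for D E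
    unfolding derivations_def
    by (simp add: that derivationsD add_T closed add1 add2 add3 scale_right_distrib add_ac)
  show "op_scale scale c D \<in> derivations" if "D \<in> derivations" for c D
    unfolding derivations_def
    by (simp add: that derivationsD op_scale_def scale_T closed scale1 scale2 scale3
        scale_right_distrib mult.commute)
qed

lemma lmult_derivation: "x \<in> T \<Longrightarrow> y \<in> T \<Longrightarrow> lmult T br x y \<in> derivations"
  by (simp add: derivations_def lmult_def closed add_T scale_T add3 scale3 derivation[of x y])

lemma lmult_span_subset_iff:
  "op.subspace V \<Longrightarrow>
    lmult_span scale T br A B \<subseteq> V \<longleftrightarrow> (\<forall>a\<in>A. \<forall>b\<in>B. lmult T br a b \<in> V)"
  unfolding lmult_span_def by (subst op.span_subset_iff, assumption) blast

lemma lmult_span_derivations: "lmult_span scale T br T T \<subseteq> derivations"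
  unfolding lmult_span_subset_iff[OF subspace_derivations] by (simp add: lmult_derivation)

lemma lmult_add1: "x \<in> T \<Longrightarrow> x' \<in> T \<Longrightarrow> y \<in> T \<Longrightarrow> lmult T br (x + x') y = lmult T br x y + lmult T br x' y"
  by (simp add: lmult_def fun_eq_iff add1)

lemma lmult_add2: "x \<in> T \<Longrightarrow> y \<in> T \<Longrightarrow> y' \<in> T \<Longrightarrow> lmult T br x (y + y') = lmult T br x y + lmult T br x y'"
  by (simp add: lmult_def fun_eq_iff add2)

lemma lmult_scale1: "x \<in> T \<Longrightarrow> y \<in> T \<Longrightarrow> lmult T br (c *s x) y = op_scale scale c (lmult T br x y)"
  by (simp add: lmult_def fun_eq_iff scale1 op_scale_def)

lemma lmult_scale2: "x \<in> T \<Longrightarrow> y \<in> T \<Longrightarrow> lmult T br x (c *s y) = op_scale scale c (lmult T br x y)"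
  by (simp add: lmult_def fun_eq_iff scale2 op_scale_def)

lemma lmult_self: "x \<in> T \<Longrightarrow> lmult T br x x = 0"
  by (simp add: lmult_def fun_eq_iff alt)

lemma lmult_antisym: "x \<in> T \<Longrightarrow> y \<in> T \<Longrightarrow> lmult T br y x = - lmult T br x y"
  by (simp add: lmult_def fun_eq_iff antisymm[of x y])

lemma subspace_lmult_span: "op.subspace (lmult_span scale T br A B)"
  by (simp add: lmult_span_def)

lemma lmult_mem: "a \<in> A \<Longrightarrow> b \<in> B \<Longrightarrow> lmult T br a b \<in> lmult_span scale T br A B"
  unfolding lmult_span_def by (rule op.span_base) blast

lemma ideal_T: "lts_ideal scale T br T"
  by (simp add: lts_ideal_iff subspace_T closed)

lemma commutator_lmult:
  assumes D: "D \<in> derivations" and "z \<in> T" "w \<in> T"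
  shows "(D \<circ> lmult T br z w) - (lmult T br z w \<circ> D) = lmult T br (D z) w + lmult T br z (D w)"
proof
  fix a
  have "D 0 = 0" using derivationsD(3)[OF D zero_T zero_T] by simp
  then show "((D \<circ> lmult T br z w) - (lmult T br z w \<circ> D)) a = (lmult T br (D z) w + lmult T br z (D w)) a"
    using assms by (cases "a \<in> T") (simp_all add: lmult_def derivationsD zero_T zero3)
qed

lemma lmult_span_image_ideal:
  assumes I: "lts_ideal scale T br I" and D: "D \<in> lmult_span scale T br T T" and z: "z \<in> I"
  shows "D z \<in> I"
proof -
  have sI: "subspace I" and IT: "I \<subseteq> T" using I by (auto simp: lts_ideal_iff)
  have "op.subspace {D. D z \<in> I}"
    by (rule op.subspaceI)
      (use sI in \<open>simp_all add: op_scale_def subspace_0 subspace_add subspace_scale\<close>)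
  moreover have "lmult T br x y z \<in> I" if "x \<in> T" "y \<in> T" for x y
    using ideal_closed(3,4)[OF I z] that IT z ideal_closed(1)[OF I z]
    by (auto simp: lmult_def)
  ultimately have "lmult_span scale T br T T \<subseteq> {D. D z \<in> I}"
    by (simp add: lmult_span_subset_iff)
  then show ?thesis using D by blast
qed

lemma lmult_span_ideal_image:
  assumes I: "lts_ideal scale T br I" and D: "D \<in> lmult_span scale T br I T" and z: "z \<in> T"
  shows "D z \<in> I"
proof -
  have sI: "subspace I" and IT: "I \<subseteq> T" using I by (auto simp: lts_ideal_iff)
  have "op.subspace {D. D z \<in> I}"
    by (rule op.subspaceI)
      (use sI in \<open>simp_all add: op_scale_def subspace_0 subspace_add subspace_scale\<close>)
  moreover have "lmult T br x y z \<in> I" if "x \<in> I" "y \<in> T" for x y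
    using ideal_closed(2)[OF I that z] z by (simp add: lmult_def)
  ultimately have "lmult_span scale T br I T \<subseteq> {D. D z \<in> I}"
    by (simp add: lmult_span_subset_iff)
  then show ?thesis using D by blast
qed

lemma lmult_span_mono: "A \<subseteq> A' \<Longrightarrow> lmult_span scale T br A B \<subseteq> lmult_span scale T br A' B"
  unfolding lmult_span_def by (rule op.span_mono) blast

lemma commutator_mem:
  assumes I: "lts_ideal scale T br I" and D: "D \<in> lmult_span scale T br T T"
    and E: "E \<in> lmult_span scale T br I T"
  shows "(D \<circ> E) - (E \<circ> D) \<in> lmult_span scale T br I T"
proof -
  let ?O = "lmult_span scale T br I T"
  let ?V = "{E \<in> derivations. (D \<circ> E) - (E \<circ> D) \<in> ?O}"
  have IT: "I \<subseteq> T" using I by (simp add: lts_ideal_iff)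
  have Dd: "D \<in> derivations" using D lmult_span_derivations by blast
  have D0: "D 0 = 0" using derivationsD(3)[OF Dd zero_T zero_T] by simp
  have "op.subspace ?V"
  proof (rule op.subspaceI)
    have "(D \<circ> 0) - (0 \<circ> D) = 0" using D0 by (simp add: fun_eq_iff)
    then show "0 \<in> ?V"
      using op.subspace_0[OF subspace_derivations] op.subspace_0[OF subspace_lmult_span] by simp
    show "E + E' \<in> ?V" if "E \<in> ?V" "E' \<in> ?V" for E E'
    proof -
      have d: "E \<in> derivations" "E' \<in> derivations" using that by auto
      have "D (E z + E' z) = D (E z) + D (E' z)" for z
        by (cases "z \<in> T") (simp_all add: derivationsD[OF Dd] derivationsD[OF d(1)] derivationsD[OF d(2)] D0)
      then have "(D \<circ> (E + E')) - ((E + E') \<circ> D) = ((D \<circ> E) - (E \<circ> D)) + ((D \<circ> E') - (E' \<circ> D))"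
        by (simp add: fun_eq_iff)
      then show ?thesis
        using that op.subspace_add[OF subspace_derivations] op.subspace_add[OF subspace_lmult_span]
        by simp
    qed
    show "op_scale scale c E \<in> ?V" if "E \<in> ?V" for c E
    proof -
      have d: "E \<in> derivations" using that by auto
      have "D (c *s E z) = c *s D (E z)" for z
        by (cases "z \<in> T") (simp_all add: derivationsD[OF Dd] derivationsD[OF d] D0)
      then have "(D \<circ> op_scale scale c E) - (op_scale scale c E \<circ> D) = op_scale scale c ((D \<circ> E) - (E \<circ> D))"
        by (simp add: fun_eq_iff op_scale_def scale_right_diff_distrib)
      then show ?thesis
        using that op.subspace_scale[OF subspace_derivations] op.subspace_scale[OF subspace_lmult_span]
        by simp
    qed
  qed
  moreover have "lmult T br i t \<in> ?V" if "i \<in> I" "t \<in> T" for i t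
  proof -
    have T: "i \<in> T" using that IT by blast
    have "lmult T br (D i) t + lmult T br i (D t) \<in> ?O"
      using op.subspace_add[OF subspace_lmult_span] lmult_mem lmult_span_image_ideal[OF I D that(1)]
        that derivationsD(1)[OF Dd that(2)] by blast
    then show ?thesis
      using commutator_lmult[OF Dd T that(2)] lmult_derivation[OF T that(2)] by simp
  qed
  ultimately have "?O \<subseteq> ?V" by (simp add: lmult_span_subset_iff)
  then show ?thesis using E by blast
qed

lemma subspace_Times: "op.subspace A \<Longrightarrow> subspace B \<Longrightarrow> st.subspace (A \<times> B)"
  by (auto simp: st.subspace_def op.subspace_def subspace_def stdemb_scale_def zero_prod_def)

lemma derivation_zero: "D \<in> derivations \<Longrightarrow> D 0 = 0"
  using derivationsD(3)[of D 0 0] zero_T by simp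

lemma derivation_diff:
  assumes D: "D \<in> derivations" and T: "y \<in> T" "z \<in> T"
  shows "D (y - z) = D y - D z"
proof -
  have "D (y - z) + D z = D y"
    using derivationsD(3)[OF D subspace_diff[OF subspace_T T] T(2)] by simp
  then show ?thesis by (simp add: eq_diff_eq)
qed

lemma diff2:
  assumes "x \<in> T" "y \<in> T" "y' \<in> T" "z \<in> T"
  shows "br x (y - y') z = br x y z - br x y' z"
proof -
  have "br x (y - y') z + br x y' z = br x y z"
    using add2[of x "y - y'" y' z] subspace_diff[OF subspace_T assms(2,3)] assms by simp
  then show ?thesis by (simp add: eq_diff_eq)
qed

lemma derivation_comp_add:
  assumes "D \<in> derivations" "E \<in> derivations" "E' \<in> derivations"
  shows "D (E z + E' z) = D (E z) + D (E' z)"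
  using assms derivationsD(1-3)[OF assms(1)] derivationsD(1,2)[OF assms(2)] derivationsD(1,2)[OF assms(3)]
  by (cases "z \<in> T") (simp_all add: derivation_zero)

lemma derivation_comp_scale:
  assumes "D \<in> derivations" "E \<in> derivations"
  shows "D (c *s E z) = c *s D (E z)"
  using assms derivationsD(4)[OF assms(1)] derivationsD(1,2)[OF assms(2)]
  by (cases "z \<in> T") (simp_all add: derivation_zero)

lemma stdemb_jacobi_aux:
  assumes D: "D \<in> derivations" "E \<in> derivations" "F \<in> derivations"
    and T: "a \<in> T" "b \<in> T" "c \<in> T" "w \<in> T"
  defines "G \<equiv> ((E \<circ> F) - (F \<circ> E)) + lmult T br b c"
  shows "((D \<circ> G) - (G \<circ> D) + lmult T br a (E c - F b)) w =
    D (E (F w)) - D (F (E w)) - E (F (D w)) + F (E (D w)) + br (D b) c w + br b (D c) w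
    + br a (E c) w - br a (F b) w"
proof -
  note m = derivationsD(1)[OF D(1)] derivationsD(1)[OF D(2)] derivationsD(1)[OF D(3)]
  have "D (G w) = D (E (F w)) - D (F (E w)) + D (br b c w)"
    using T m subspace_diff[OF subspace_T]
    by (simp add: G_def lmult_def derivationsD(3)[OF D(1)] derivation_diff[OF D(1)] closed)
  moreover have "G (D w) = E (F (D w)) - F (E (D w)) + br b c (D w)"
    using T m by (simp add: G_def lmult_def)
  moreover have "lmult T br a (E c - F b) w = br a (E c) w - br a (F b) w"
    using T m by (simp add: lmult_def diff2)
  ultimately show ?thesis
    using derivationsD(5)[OF D(1) T(2,3,4)] by simp
qed

lemma stdemb_closed:
  assumes "p \<in> stdemb scale T br" "q \<in> stdemb scale T br"
  shows "stdemb_bracket T br p q \<in> stdemb scale T br"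
proof -
  have p: "fst p \<in> lmult_span scale T br T T" "snd p \<in> T" and q: "fst q \<in> lmult_span scale T br T T" "snd q \<in> T"
    using assms by (auto simp: stdemb_def)
  have "fst p \<in> derivations" "fst q \<in> derivations" using p q lmult_span_derivations by auto
  then have "fst p (snd q) - fst q (snd p) \<in> T"
    using p q derivationsD(1) subspace_diff[OF subspace_T] by blast
  moreover have "(fst p \<circ> fst q) - (fst q \<circ> fst p) + lmult T br (snd p) (snd q) \<in> lmult_span scale T br T T"
    using op.subspace_add[OF subspace_lmult_span] commutator_mem[OF ideal_T p(1) q(1)]
      lmult_mem[OF p(2) q(2)] by blast
  ultimately show ?thesis by (simp add: stdemb_def stdemb_bracket_def)
qed

lemma stdemb_jacobi:
  assumes x: "x \<in> stdemb scale T br" and y: "y \<in> stdemb scale T br" and z: "z \<in> stdemb scale T br"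
  defines "b \<equiv> stdemb_bracket T br"
  shows "b x (b y z) + b y (b z x) + b z (b x y) = 0"
proof -
  have LD: "fst p \<in> derivations" "snd p \<in> T" if "p \<in> stdemb scale T br" for p
    using that lmult_span_derivations by (auto simp: stdemb_def)
  note X = LD[OF x] and Y = LD[OF y] and Z = LD[OF z]
  note m = derivationsD(1)[OF X(1)] derivationsD(1)[OF Y(1)] derivationsD(1)[OF Z(1)]
  have cyc: "br (snd y) (snd z) (snd x) = - br (snd x) (snd y) (snd z) - br (snd z) (snd x) (snd y)"
    using cyclic[OF X(2) Y(2) Z(2)] by (simp add: eq_diff_eq eq_neg_iff_add_eq_0 add_ac)
  have "snd (b x (b y z) + b y (b z x) + b z (b x y)) = 0"
    using cyc X(2) Y(2) Z(2) m
    by (simp add: b_def stdemb_bracket_def lmult_def derivation_diff[OF X(1)] derivation_diff[OF Y(1)]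
        derivation_diff[OF Z(1)])
  moreover have "fst (b x (b y z) + b y (b z x) + b z (b x y)) w = 0" for w
  proof (cases "w \<in> T")
    case False
    have "b x (b y z) \<in> stdemb scale T br" "b y (b z x) \<in> stdemb scale T br" "b z (b x y) \<in> stdemb scale T br"
      using x y z stdemb_closed unfolding b_def by auto
    then show ?thesis using derivationsD(2)[OF LD(1) False] by simp
  next
    case w: True
    note anti = antisymm[OF m(1)[OF Y(2)] Z(2) w] antisymm[OF m(1)[OF Z(2)] Y(2) w]
      antisymm[OF m(2)[OF Z(2)] X(2) w] antisymm[OF m(2)[OF X(2)] Z(2) w]
      antisymm[OF m(3)[OF X(2)] Y(2) w] antisymm[OF m(3)[OF Y(2)] X(2) w]
    note J1 = stdemb_jacobi_aux[OF X(1) Y(1) Z(1) X(2) Y(2) Z(2) w]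
    note J2 = stdemb_jacobi_aux[OF Y(1) Z(1) X(1) Y(2) Z(2) X(2) w]
    note J3 = stdemb_jacobi_aux[OF Z(1) X(1) Y(1) Z(2) X(2) Y(2) w]
    show ?thesis
      unfolding b_def stdemb_bracket_def fst_add fst_conv snd_conv
      by (subst plus_fun_apply, subst plus_fun_apply, unfold J1 J2 J3 anti) simp
  qed
  ultimately show ?thesis by (intro prod_eqI ext) simp_all
qed

theorem lie_algebra_stdemb: "lie_algebra (stdemb_scale scale) (stdemb scale T br) (stdemb_bracket T br)"
proof
  let ?L = "stdemb scale T br" and ?b = "stdemb_bracket T br"
  show "st.subspace ?L"
    unfolding stdemb_def by (intro subspace_Times subspace_lmult_span subspace_T)
  have LD: "fst p \<in> derivations" "snd p \<in> T" "fst p \<in> lmult_span scale T br T T" if "p \<in> ?L" for p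
    using that lmult_span_derivations by (auto simp: stdemb_def)
  fix x y assume x: "x \<in> ?L" and y: "y \<in> ?L"
  note X = LD[OF x] and Y = LD[OF y]
  show "?b x y \<in> ?L" using stdemb_closed[OF x y] .
  show "?b (stdemb_scale scale c x) y = stdemb_scale scale c (?b x y)" for c
    by (simp add: stdemb_bracket_def stdemb_scale_def lmult_scale1 X Y derivationsD[OF Y(1)]
        scale_right_diff_distrib) (simp add: fun_eq_iff op_scale_def derivation_comp_scale[OF Y(1) X(1)]
        scale_right_diff_distrib scale_right_distrib)
  show "?b x (stdemb_scale scale c y) = stdemb_scale scale c (?b x y)" for c
    by (simp add: stdemb_bracket_def stdemb_scale_def lmult_scale2 X Y derivationsD[OF X(1)]
        scale_right_diff_distrib) (simp add: fun_eq_iff op_scale_def derivation_comp_scale[OF X(1) Y(1)]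
        scale_right_diff_distrib scale_right_distrib)
  show "?b x x = 0"
    by (simp add: stdemb_bracket_def lmult_self X zero_prod_def)
  fix z assume z: "z \<in> ?L"
  note Z = LD[OF z]
  show "?b (x + z) y = ?b x y + ?b z y"
    by (simp add: stdemb_bracket_def lmult_add1 X Y Z derivationsD[OF Y(1)])
      (simp add: fun_eq_iff derivation_comp_add[OF Y(1) X(1) Z(1)])
  show "?b x (y + z) = ?b x y + ?b x z"
    by (simp add: stdemb_bracket_def lmult_add2 X Y Z derivationsD[OF X(1)])
      (simp add: fun_eq_iff derivation_comp_add[OF X(1) Y(1) Z(1)])
  show "?b x (?b y z) + ?b y (?b z x) + ?b z (?b x y) = 0" using stdemb_jacobi[OF x y z] .
qed

lemma st_bracket_subset_iff:
  "st.subspace I \<Longrightarrow> lie_bracket (stdemb_scale scale) b A B \<subseteq> I \<longleftrightarrow> (\<forall>x\<in>A. \<forall>y\<in>B. b x y \<in> I)"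
  unfolding lie_bracket_def by (subst st.span_subset_iff, assumption) blast

lemma lie_ideal_stdemb_ideal:
  assumes I: "lts_ideal scale T br I"
  shows "lie_ideal (stdemb_scale scale) (stdemb scale T br) (stdemb_bracket T br) (stdemb_ideal scale T br I)"
proof -
  let ?O = "lmult_span scale T br I T"
  have sI: "subspace I" and IT: "I \<subseteq> T" using I by (auto simp: lts_ideal_iff)
  have sub: "st.subspace (stdemb_ideal scale T br I)"
    unfolding stdemb_ideal_def by (intro subspace_Times subspace_lmult_span sI)
  have OT: "?O \<subseteq> lmult_span scale T br T T" using lmult_span_mono[OF IT] .
  have "stdemb_bracket T br p q \<in> stdemb_ideal scale T br I"
    if pq: "p \<in> stdemb_ideal scale T br I" "q \<in> stdemb scale T br" for p q
  proof -
    have p: "fst p \<in> ?O" "snd p \<in> I" and q: "fst q \<in> lmult_span scale T br T T" "snd q \<in> T"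
      using pq by (auto simp: stdemb_def stdemb_ideal_def)
    have "- ((fst q \<circ> fst p) - (fst p \<circ> fst q)) \<in> ?O"
      using commutator_mem[OF I q(1) p(1)] op.subspace_neg[OF subspace_lmult_span] by blast
    then have "(fst p \<circ> fst q) - (fst q \<circ> fst p) \<in> ?O" by simp
    then have "(fst p \<circ> fst q) - (fst q \<circ> fst p) + lmult T br (snd p) (snd q) \<in> ?O"
      using op.subspace_add[OF subspace_lmult_span] lmult_mem[OF p(2) q(2)] by blast
    moreover have "fst p (snd q) - fst q (snd p) \<in> I"
      using lmult_span_ideal_image[OF I p(1) q(2)] lmult_span_image_ideal[OF I q(1) p(2)]
        subspace_diff[OF sI] by blast
    ultimately show ?thesis by (simp add: stdemb_ideal_def stdemb_bracket_def)
  qed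
  then show ?thesis
    unfolding lie_ideal_def st_bracket_subset_iff[OF sub]
    using sub OT IT by (auto simp: stdemb_ideal_def stdemb_def)
qed

lemma lie_centralizer_stdemb_ideal:
  assumes I: "lts_ideal scale T br I" and C: "lts_centralizer scale T br I = {0}"
  shows "lie_centralizer (stdemb scale T br) (stdemb_bracket T br) (stdemb_ideal scale T br I) = {0}"
proof
  have sI: "subspace I" and IT: "I \<subseteq> T" using I by (auto simp: lts_ideal_iff)
  have O0: "0 \<in> lmult_span scale T br A B" for A B
    using op.subspace_0[OF subspace_lmult_span] .
  show "{0} \<subseteq> lie_centralizer (stdemb scale T br) (stdemb_bracket T br) (stdemb_ideal scale T br I)"
  proof -
    have "stdemb_bracket T br 0 q = 0" if "q \<in> stdemb_ideal scale T br I" for q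
    proof -
      have "fst q \<in> lmult_span scale T br I T" "snd q \<in> I"
        using that by (auto simp: stdemb_ideal_def)
      then have q: "fst q \<in> derivations" "snd q \<in> T"
        using subsetD[OF lmult_span_mono[OF IT]] lmult_span_derivations IT by blast+
      have "(0 \<circ> fst q) - (fst q \<circ> 0) + lmult T br 0 (snd q) = 0"
        using q derivation_zero[OF q(1)] by (intro ext) (simp add: lmult_def zero1)
      then show ?thesis
        using derivation_zero[OF q(1)] by (simp add: stdemb_bracket_def zero_prod_def)
    qed
    moreover have "0 \<in> stdemb scale T br" by (simp add: stdemb_def zero_prod_def O0 zero_T)
    ultimately show ?thesis by (simp add: lie_centralizer_def)
  qed
  show "lie_centralizer (stdemb scale T br) (stdemb_bracket T br) (stdemb_ideal scale T br I) \<subseteq> {0}"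
  proof
    fix p assume p: "p \<in> lie_centralizer (stdemb scale T br) (stdemb_bracket T br) (stdemb_ideal scale T br I)"
    define D z where "D = fst p" and "z = snd p"
    have Dz: "D \<in> lmult_span scale T br T T" "z \<in> T"
      using p by (auto simp: lie_centralizer_def stdemb_def D_def z_def)
    then have Dd: "D \<in> derivations" using lmult_span_derivations by blast
    have cen: "stdemb_bracket T br (D, z) q = 0" if "q \<in> stdemb_ideal scale T br I" for q
      using p that by (simp add: lie_centralizer_def D_def z_def)
    have c1: "D i = 0" "lmult T br z i = 0" if i: "i \<in> I" for i
    proof -
      have "stdemb_bracket T br (D, z) (0, i) = 0"
        using cen[of "(0, i)"] O0 i by (simp add: stdemb_ideal_def)
      then have e: "(D \<circ> 0) - (0 \<circ> D) + lmult T br z i = 0" "D i = 0"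
        by (simp_all add: stdemb_bracket_def zero_prod_def)
      have "(D \<circ> 0) - (0 \<circ> D) = 0" using derivation_zero[OF Dd] by (intro ext) simp
      then show "D i = 0" "lmult T br z i = 0" using e by simp_all
    qed
    have c2: "br i t z = 0" "lmult T br i (D t) = 0" if it: "i \<in> I" "t \<in> T" for i t
    proof -
      have iT: "i \<in> T" using it IT by blast
      have "stdemb_bracket T br (D, z) (lmult T br i t, 0) = 0"
        using cen[of "(lmult T br i t, 0)"] lmult_mem[OF it] sI
        by (simp add: stdemb_ideal_def subspace_0)
      then have e: "(D \<circ> lmult T br i t) - (lmult T br i t \<circ> D) + lmult T br z 0 = 0"
          "lmult T br i t z = 0"
        using derivation_zero[OF Dd] by (simp_all add: stdemb_bracket_def zero_prod_def)
      show "br i t z = 0" using e(2) Dz by (simp add: lmult_def)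
      have "lmult T br z 0 = 0" using Dz by (intro ext) (simp add: lmult_def zero2)
      moreover have "lmult T br 0 t = 0" using it by (intro ext) (simp add: lmult_def zero1)
      ultimately show "lmult T br i (D t) = 0"
        using e(1) commutator_lmult[OF Dd iT it(2)] c1(1)[OF it(1)] by simp
    qed
    have br0: "br x y w = 0" if "lmult T br x y = 0" "w \<in> T" for x y w
      using fun_cong[OF that(1), of w] that(2) by (simp add: lmult_def)
    have "br t i z = 0" if it: "i \<in> I" "t \<in> T" for i t
    proof -
      have "i \<in> T" using it IT by blast
      then show ?thesis using antisymm[of i t z] c2(1)[OF it] it Dz by simp
    qed
    then have "z \<in> lts_centralizer scale T br I"
      using Dz br0[OF c1(2)] by (simp add: centralizer_iff)
    then have z0: "z = 0" using C by blast
    have "D t = 0" if t: "t \<in> T" for t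
    proof -
      have Dt: "D t \<in> T" using derivationsD(1)[OF Dd t] .
      have 1: "br (D t) i s = 0" if i: "i \<in> I" "s \<in> T" for i s
      proof -
        have "i \<in> T" using i IT by blast
        then show ?thesis
          using antisymm[of i "D t" s] br0[OF c2(2)[OF i(1) t] i(2)] i Dt by simp
      qed
      have "br s i (D t) = 0" if i: "i \<in> I" "s \<in> T" for i s
      proof -
        have iT: "i \<in> T" using i IT by blast
        have Ds: "D s \<in> T" using derivationsD(1)[OF Dd i(2)] .
        have "br (D s) i t = 0"
          using antisymm[OF iT Ds t] br0[OF c2(2)[OF i] t] by simp
        moreover have "D (br s i t) = 0" using c1(1) ideal_closed(3)[OF I i(1) i(2) t] by blast
        moreover have "br s (D i) t = 0" using c1(1)[OF i(1)] i t by (simp add: zero2)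
        ultimately show ?thesis using derivationsD(5)[OF Dd i(2) iT t] by simp
      qed
      then have "D t \<in> lts_centralizer scale T br I" using Dt 1 by (simp add: centralizer_iff)
      then show ?thesis using C by blast
    qed
    then have "D = 0" using derivationsD(2)[OF Dd] by (intro ext) (metis zero_fun_apply)
    then show "p \<in> {0}" using z0 by (simp add: D_def z_def prod_eq_iff)
  qed
qed

lemma stdemb_ideal_power:
  assumes I: "lts_ideal scale T br I"
  shows "stdemb_ideal scale T br (lts_bracket scale br I T I) \<subseteq>
    lie_bracket (stdemb_scale scale) (stdemb_bracket T br) (stdemb_ideal scale T br I) (stdemb_ideal scale T br I)"
    (is "_ \<subseteq> ?B")
proof -
  let ?K = "lts_bracket scale br I T I"
  have sI: "subspace I" and IT: "I \<subseteq> T" using I by (auto simp: lts_ideal_iff)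
  have sB: "st.subspace ?B" by (simp add: lie_bracket_def)
  have gen: "stdemb_bracket T br p q \<in> ?B"
    if "p \<in> stdemb_ideal scale T br I" "q \<in> stdemb_ideal scale T br I" for p q
    unfolding lie_bracket_def by (rule st.span_base) (use that in blast)
  have O0: "0 \<in> lmult_span scale T br I T"
    using op.subspace_0[OF subspace_lmult_span] .
  have l0: "lmult T br 0 x = 0" if "x \<in> T" for x
    using that by (intro ext) (simp add: lmult_def zero1)
  have II: "(lmult T br i j, 0) \<in> ?B" if "i \<in> I" "j \<in> I" for i j
  proof -
    have "stdemb_bracket T br (0, i) (0, j) \<in> ?B"
      by (rule gen) (use that O0 in \<open>simp_all add: stdemb_ideal_def\<close>)
    moreover have "((0 :: 'a \<Rightarrow> 'a) \<circ> (0 :: 'a \<Rightarrow> 'a)) - (0 \<circ> 0) = 0" by (intro ext) simp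
    ultimately show ?thesis by (simp add: stdemb_bracket_def)
  qed
  have K1: "(0, br i t j) \<in> ?B" if "i \<in> I" "t \<in> T" "j \<in> I" for i t j
  proof -
    have T: "i \<in> T" "j \<in> T" using that IT by auto
    have "stdemb_bracket T br (lmult T br i t, 0) (0, j) \<in> ?B"
      by (rule gen) (use that O0 lmult_mem[OF that(1,2)] sI in \<open>simp_all add: stdemb_ideal_def subspace_0\<close>)
    moreover have "(lmult T br i t \<circ> 0) - (0 \<circ> lmult T br i t) + lmult T br 0 j = 0"
      using l0[OF T(2)] T that by (intro ext) (simp add: lmult_def zero_T zero3)
    ultimately show ?thesis using T by (simp add: stdemb_bracket_def lmult_def)
  qed
  have K2: "(lmult T br (br i t j) s, 0) \<in> ?B" if h: "i \<in> I" "t \<in> T" "j \<in> I" "s \<in> T" for i t j s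
  proof -
    have T: "i \<in> T" "j \<in> T" using h IT by auto
    have "stdemb_bracket T br (lmult T br j s, 0) (lmult T br i t, 0) \<in> ?B"
      by (rule gen) (use h lmult_mem[OF h(1,2)] lmult_mem[OF h(3,4)] sI in \<open>simp_all add: stdemb_ideal_def subspace_0\<close>)
    then have "(lmult T br (br i t s) j - lmult T br (br i t j) s, 0) \<in> ?B"
      using stdemb_bracket_lmult[of j s 0 i t 0] T h l0[OF zero_T] by (simp add: zero_T zero3)
    moreover have "(lmult T br (br i t s) j, 0) \<in> ?B"
      using II[OF ideal_closed(2)[OF I h(1,2,4)] h(3)] .
    ultimately have "(lmult T br (br i t s) j, 0) - (lmult T br (br i t s) j - lmult T br (br i t j) s, 0) \<in> ?B"
      using st.subspace_diff[OF sB] by blast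
    then show ?thesis by simp
  qed
  have "subspace {k. (0, k) \<in> ?B}"
  proof (rule subspaceI)
    show "0 \<in> {k. (0, k) \<in> ?B}" using st.subspace_0[OF sB] by (simp add: zero_prod_def)
    show "x + y \<in> {k. (0, k) \<in> ?B}" if "x \<in> {k. (0, k) \<in> ?B}" "y \<in> {k. (0, k) \<in> ?B}" for x y
      using st.subspace_add[OF sB, of "(0, x)" "(0, y)"] that by simp
    show "c *s x \<in> {k. (0, k) \<in> ?B}" if "x \<in> {k. (0, k) \<in> ?B}" for c x
      using st.subspace_scale[OF sB, of "(0, x)" c] that op.scale_zero_right[of c] by (simp add: stdemb_scale_def)
  qed
  then have 1: "?K \<subseteq> {k. (0, k) \<in> ?B}" using K1 by (simp add: lts_bracket_subset_iff)
  have "subspace {k \<in> T. \<forall>s\<in>T. (lmult T br k s, 0) \<in> ?B}"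
  proof (rule subspaceI)
    show "0 \<in> {k \<in> T. \<forall>s\<in>T. (lmult T br k s, 0) \<in> ?B}"
      using st.subspace_0[OF sB] by (simp add: zero_prod_def zero_T l0)
    show "x + y \<in> {k \<in> T. \<forall>s\<in>T. (lmult T br k s, 0) \<in> ?B}"
      if "x \<in> {k \<in> T. \<forall>s\<in>T. (lmult T br k s, 0) \<in> ?B}" "y \<in> {k \<in> T. \<forall>s\<in>T. (lmult T br k s, 0) \<in> ?B}" for x y
      using st.subspace_add[OF sB, of "(lmult T br x _, 0)" "(lmult T br y _, 0)"] that
      by (auto simp: add_T lmult_add1)
    show "c *s x \<in> {k \<in> T. \<forall>s\<in>T. (lmult T br k s, 0) \<in> ?B}"
      if "x \<in> {k \<in> T. \<forall>s\<in>T. (lmult T br k s, 0) \<in> ?B}" for c x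
      using st.subspace_scale[OF sB, of "(lmult T br x _, 0)" c] that
      by (auto simp: scale_T lmult_scale1 stdemb_scale_def)
  qed
  moreover have "br i t j \<in> T" if "i \<in> I" "t \<in> T" "j \<in> I" for i t j
    using that IT closed by blast
  ultimately have 2: "?K \<subseteq> {k \<in> T. \<forall>s\<in>T. (lmult T br k s, 0) \<in> ?B}"
    using K2 by (simp add: lts_bracket_subset_iff)
  have "op.subspace {D. (D, 0) \<in> ?B}"
  proof (rule op.subspaceI)
    show "0 \<in> {D. (D, 0) \<in> ?B}" using st.subspace_0[OF sB] by (simp add: zero_prod_def)
    show "x + y \<in> {D. (D, 0) \<in> ?B}" if "x \<in> {D. (D, 0) \<in> ?B}" "y \<in> {D. (D, 0) \<in> ?B}" for x y
      using st.subspace_add[OF sB, of "(x, 0)" "(y, 0)"] that by simp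
    show "op_scale scale c x \<in> {D. (D, 0) \<in> ?B}" if "x \<in> {D. (D, 0) \<in> ?B}" for c x
      using st.subspace_scale[OF sB, of "(x, 0)" c] that by (simp add: stdemb_scale_def)
  qed
  then have 3: "lmult_span scale T br ?K T \<subseteq> {D. (D, 0) \<in> ?B}"
    using 2 by (subst lmult_span_subset_iff) auto
  show ?thesis
  proof
    fix p assume "p \<in> stdemb_ideal scale T br ?K"
    then have "(fst p, 0) \<in> ?B" "(0, snd p) \<in> ?B" using 1 3 by (auto simp: stdemb_ideal_def)
    then have "(fst p, 0) + (0, snd p) \<in> ?B" using st.subspace_add[OF sB] by blast
    then show "p \<in> ?B" by simp
  qed
qed

theorem lie_power_filter_stdemb_ideals:
  assumes nd: "lts_nondegenerate scale T br" and nz: "T \<noteq> {0}"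
  defines "G \<equiv> stdemb_ideal scale T br ` zero_centralizer_ideals scale T br"
  shows "lie_power_filter (stdemb_scale scale) (stdemb scale T br) (stdemb_bracket T br) G"
    and "I \<in> G \<Longrightarrow> lie_centralizer (stdemb scale T br) (stdemb_bracket T br) I = {0}"
proof -
  let ?F = "zero_centralizer_ideals scale T br"
  have F: "?F \<noteq> {}" "\<And>I. I \<in> ?F \<Longrightarrow> lts_ideal scale T br I \<and> I \<noteq> {0}"
    "\<And>I J. I \<in> ?F \<Longrightarrow> J \<in> ?F \<Longrightarrow> \<exists>K\<in>?F. K \<subseteq> I \<inter> J"
    "\<And>I. I \<in> ?F \<Longrightarrow> \<exists>K\<in>?F. K \<subseteq> lts_bracket scale br I T I"
    using power_filter_zero_centralizer_ideals[OF nd nz] unfolding lts_power_filter_def by simp_all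
  have mono: "stdemb_ideal scale T br I \<subseteq> stdemb_ideal scale T br J" if "I \<subseteq> J" for I J
    using lmult_span_mono[OF that] that unfolding stdemb_ideal_def by blast
  have "G \<noteq> {}" using F(1) by (simp add: G_def)
  moreover have "lie_ideal (stdemb_scale scale) (stdemb scale T br) (stdemb_bracket T br) I \<and> I \<noteq> {0}"
    if h: "I \<in> G" for I
  proof -
    obtain J where J: "J \<in> ?F" "I = stdemb_ideal scale T br J" using h by (auto simp: G_def)
    then have id: "lts_ideal scale T br J" "J \<noteq> {0}" using F(2) by blast+
    then have "0 \<in> J" using subspace_0 unfolding lts_ideal_iff by blast
    then obtain x where "x \<in> J" "x \<noteq> 0" using id(2) by blast
    then have "(0, x) \<in> I" "(0, x) \<noteq> 0"
      using op.subspace_0[OF subspace_lmult_span] J(2) by (auto simp: stdemb_ideal_def zero_prod_def)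
    then show ?thesis using lie_ideal_stdemb_ideal[OF id(1)] J(2) by blast
  qed
  moreover have "\<exists>K\<in>G. K \<subseteq> I \<inter> J" if h: "I \<in> G" "J \<in> G" for I J
  proof -
    obtain A B where AB: "A \<in> ?F" "B \<in> ?F" "I = stdemb_ideal scale T br A" "J = stdemb_ideal scale T br B"
      using h by (auto simp: G_def)
    then obtain C where "C \<in> ?F" "C \<subseteq> A" "C \<subseteq> B" using F(3)[of A B] by auto
    then show ?thesis using mono[of C A] mono[of C B] AB(3,4) unfolding G_def by blast
  qed
  moreover have "\<exists>K\<in>G. K \<subseteq> lie_bracket (stdemb_scale scale) (stdemb_bracket T br) I I" if h: "I \<in> G" for I
  proof -
    obtain J where J: "J \<in> ?F" "I = stdemb_ideal scale T br J" using h by (auto simp: G_def)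
    then obtain K where K: "K \<in> ?F" "K \<subseteq> lts_bracket scale br J T J" using F(4) by blast
    have "lts_ideal scale T br J" using F(2) J(1) by blast
    then show ?thesis
      using order_trans[OF mono[OF K(2)] stdemb_ideal_power] K(1) J(2) unfolding G_def by blast
  qed
  ultimately show "lie_power_filter (stdemb_scale scale) (stdemb scale T br) (stdemb_bracket T br) G"
    unfolding lie_power_filter_def by simp
  show "lie_centralizer (stdemb scale T br) (stdemb_bracket T br) I = {0}" if "I \<in> G"
    using that lie_centralizer_stdemb_ideal by (auto simp: G_def zero_centralizer_ideals_def)
qed

end

end

(* Write I~ for the ideal of L(T) with odd part I and even part L(I,T), I an ideal of T.

   Q_1 is a system of quotients: if [q', I~] lies in L(T), the set of p with [p, I~] inside L(T) is
   stable under ad L(T), so I lies in (T:q'). Were [[q,I],T] = [[q,T],I] = 0 for some q in Q_1, then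
   [q,I] would kill T, hence L(T), hence vanish, and then [q, I~] = 0, which forces q = 0.

   Maximality: for a system of quotients S of T, a derivation of S that vanishes on T is zero, so
   L(T) embeds into L(S). Every (T:s) is an ideal of T with zero centralizer, and for
   K inside [(T:s),T,(T:s)] one has [s, K~] inside L(T). The elements p of L(S) with [p, K~] inside
   L(T) for some K form a Lie algebra of quotients P of L(T) that contains S. A monomorphism
   from P to Q over L(T) sends s into Q_1, because the even component of its image annihilates
   some K~. *)
theory Submission
  imports Defs
begin

text \<open>The definition of an algebra of quotients gives a nonzero q one ideal I of the filter
  with 0 /= [q, I] inside L, but the proof needs that no member of the filter annihilates q. Zero
  centralizers bridge the gap: if K annihilates q, it annihilates each [q, i] with i in I, and these
  elements lie in L, so they vanish. Hence an element may be tested for zero on any member of the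
  filter.

  Maximality of Q is stated for algebras on one fixed function type, whereas P consists of pairs of
  an operator on S and an element of S. It therefore has to be copied, by means of a basis, before
  maximality applies.

  Elements of L(T) are operators on T, those of L(S) operators on S. Sending the former to the
  latter is well defined only if a combination of operators [x,y,_] with x, y in T that vanishes on
  T also vanishes on S; this is what the statement about derivations is for.

  The monomorphism supplied by maximality is not known to respect the gradings, so parity has to be
  recovered from brackets with an absorbed ideal.\<close>

section \<open>Lie algebras\<close>

context lie_algebra
begin

lemma zero_L: "0 \<in> L"
  using subspace_L subspace_0 by blast

lemma add_L: "x \<in> L \<Longrightarrow> y \<in> L \<Longrightarrow> x + y \<in> L"
  using subspace_L subspace_add by blast

lemma scale_L: "x \<in> L \<Longrightarrow> c *s x \<in> L"
  using subspace_L subspace_scale by blast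

lemma neg_L: "x \<in> L \<Longrightarrow> - x \<in> L"
  using subspace_L subspace_neg by blast

lemma diff_L: "x \<in> L \<Longrightarrow> y \<in> L \<Longrightarrow> x - y \<in> L"
  using subspace_L subspace_diff by blast

lemma zero1: "y \<in> L \<Longrightarrow> br 0 y = 0"
  using add1[of 0 0 y] zero_L by simp

lemma zero2: "x \<in> L \<Longrightarrow> br x 0 = 0"
  using add2[of x 0 0] zero_L by simp

lemma antisymm: "x \<in> L \<Longrightarrow> y \<in> L \<Longrightarrow> br y x = - br x y"
  using alt[of "x + y"] alt[of x] alt[of y]
  by (simp add: add1 add2 add_L eq_neg_iff_add_eq_0 add.commute)

lemma neg1: "x \<in> L \<Longrightarrow> y \<in> L \<Longrightarrow> br (- x) y = - br x y"
  using add1[of x "- x" y] zero1[of y] neg_L[of x] by (simp add: eq_neg_iff_add_eq_0 add.commute)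

lemma neg2: "x \<in> L \<Longrightarrow> y \<in> L \<Longrightarrow> br x (- y) = - br x y"
  using add2[of x y "- y"] zero2[of x] neg_L[of y] by (simp add: eq_neg_iff_add_eq_0 add.commute)

lemma diff1: "x \<in> L \<Longrightarrow> x' \<in> L \<Longrightarrow> y \<in> L \<Longrightarrow> br (x - x') y = br x y - br x' y"
  using add1[of x "- x'" y] neg_L[of x'] neg1[of x' y] by simp

lemma leibniz:
  assumes "x \<in> L" "y \<in> L" "z \<in> L"
  shows "br x (br y z) = br (br x y) z + br y (br x z)"
proof -
  have "br y (br z x) = - br y (br x z)"
    using antisymm[OF assms(1,3)] neg2[OF assms(2), of "br x z"] closed assms by simp
  moreover have "br z (br x y) = - br (br x y) z"
    using antisymm[of "br x y" z] closed assms by simp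
  ultimately show ?thesis
    using jacobi[OF assms] by (simp add: add_eq_0_iff2 diff_eq_eq add.commute)
qed

lemma leibniz':
  assumes "x \<in> L" "y \<in> L" "z \<in> L"
  shows "br (br x y) z = br (br x z) y + br x (br y z)"
  using leibniz[OF assms] antisymm[of "br x z" y] closed assms by simp

lemma lie_bracket_subset_iff:
  "subspace V \<Longrightarrow> lie_bracket scale b A B \<subseteq> V \<longleftrightarrow> (\<forall>x\<in>A. \<forall>y\<in>B. b x y \<in> V)"
  unfolding lie_bracket_def by (subst span_subset_iff, assumption) blast

lemma lie_bracket_zero_iff:
  "lie_bracket scale b A B = {0} \<longleftrightarrow> (\<forall>x\<in>A. \<forall>y\<in>B. b x y = 0)"
proof -
  have "lie_bracket scale b A B = {0} \<longleftrightarrow> lie_bracket scale b A B \<subseteq> {0}"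
    unfolding lie_bracket_def using span_zero by blast
  then show ?thesis by (simp add: lie_bracket_subset_iff)
qed

lemma lie_ideal_iff:
  "lie_ideal scale L br I \<longleftrightarrow> subspace I \<and> I \<subseteq> L \<and> (\<forall>x\<in>I. \<forall>y\<in>L. br x y \<in> I)"
  unfolding lie_ideal_def using lie_bracket_subset_iff by metis

lemma ideal_closed:
  assumes "lie_ideal scale L br I" "x \<in> I" "y \<in> L"
  shows "x \<in> L" "br x y \<in> I" "br y x \<in> I"
proof -
  show "x \<in> L" "br x y \<in> I" using assms by (auto simp: lie_ideal_iff)
  then show "br y x \<in> I"
    using antisymm[of x y] assms subspace_neg[of I] by (simp add: lie_ideal_iff)
qed

text \<open>The cyclic identity is the Jacobi identity, and the derivation law holds because ad
  [u,w] is a derivation of the Lie algebra. Closure is asked for triple brackets alone, since the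
  odd part of a grading is not closed under the Lie bracket.\<close>

lemma lie_triple_system_subspace:
  assumes V: "subspace V" "V \<subseteq> L"
    and cl: "\<And>x y z. x \<in> V \<Longrightarrow> y \<in> V \<Longrightarrow> z \<in> V \<Longrightarrow> br (br x y) z \<in> V"
  shows "lie_triple_system scale V (\<lambda>x y z. br (br x y) z)"
proof unfold_locales
  show "subspace V" by fact
  fix x y z assume xyz: "x \<in> V" "y \<in> V" "z \<in> V"
  then have L: "x \<in> L" "y \<in> L" "z \<in> L" using V by auto
  show "br (br x y) z \<in> V" using cl xyz by blast
  show "br (br (c *s x) y) z = c *s br (br x y) z" "br (br x (c *s y)) z = c *s br (br x y) z"
    "br (br x y) (c *s z) = c *s br (br x y) z" for c
    using L by (simp_all add: scale1 scale2 closed)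
  show "br (br x x) z = 0" using L by (simp add: alt zero1)
  have "br z (br x y) + br x (br y z) + br y (br z x) = 0"
    using jacobi[OF L] by (simp add: add_ac)
  then have "- (br (br x y) z + br (br y z) x + br (br z x) y) = 0"
    using antisymm[of "br x y" z] antisymm[of "br y z" x] antisymm[of "br z x" y] L closed
    by simp
  then show "br (br x y) z + br (br y z) x + br (br z x) y = 0"
    by (simp only: neg_equal_0_iff_equal)
  fix w assume w: "w \<in> V"
  then have wL: "w \<in> L" using V by auto
  show "br (br (x + w) y) z = br (br x y) z + br (br w y) z"
    "br (br x (y + w)) z = br (br x y) z + br (br x w) z"
    "br (br x y) (z + w) = br (br x y) z + br (br x y) w"
    using L wL by (simp_all add: add1 add2 closed)
  fix u assume "u \<in> V"
  then have uL: "u \<in> L" using V by auto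
  have d: "br u w \<in> L" using uL wL closed by blast
  show "br (br u w) (br (br x y) z) =
    br (br (br (br u w) x) y) z + br (br x (br (br u w) y)) z + br (br x y) (br (br u w) z)"
    using leibniz[OF d closed[OF L(1,2)] L(3)] leibniz[OF d L(1,2)] L d
    by (simp add: add1 closed)
qed

end

section \<open>Extensions of a Lie algebra with a filter of ideals\<close>

text \<open>In contrast to \<open>lie_power_filter\<close> the zero ideal is allowed, so that the
  trivial algebra needs no separate treatment.\<close>

locale lie_filter = lie_algebra scale L br
  for scale :: "'f::field \<Rightarrow> 'l::ab_group_add \<Rightarrow> 'l" and L br +
  fixes G :: "'l set set"
  assumes G_ne: "G \<noteq> {}"
    and G_ideal: "I \<in> G \<Longrightarrow> lie_ideal scale L br I"
    and G_Int: "I \<in> G \<Longrightarrow> J \<in> G \<Longrightarrow> \<exists>K\<in>G. K \<subseteq> I \<inter> J"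
    and G_pow: "I \<in> G \<Longrightarrow> \<exists>K\<in>G. K \<subseteq> lie_bracket scale br I I"
    and G_cent: "I \<in> G \<Longrightarrow> lie_centralizer L br I = {0}"

text \<open>No quotient condition is imposed, so the locale covers L(S) before anything is known
  about which ideals its elements absorb.\<close>

locale lie_extension = lie_filter sL L brL G + M: lie_algebra sM M brM
  for sL :: "'f::field \<Rightarrow> 'l::ab_group_add \<Rightarrow> 'l" and L brL G
    and sM :: "'f \<Rightarrow> 'm::ab_group_add \<Rightarrow> 'm" and M brM +
  fixes e :: "'l \<Rightarrow> 'm"
  assumes e_mono: "lie_mono sL L brL sM M brM e"
begin

definition absorbs :: "'m \<Rightarrow> 'l set \<Rightarrow> bool"
  where "absorbs p I \<longleftrightarrow> (\<forall>i\<in>I. brM p (e i) \<in> e ` L)"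

definition annihilates :: "'m \<Rightarrow> 'l set \<Rightarrow> bool"
  where "annihilates p I \<longleftrightarrow> (\<forall>i\<in>I. brM p (e i) = 0)"

lemma e_mem: "x \<in> L \<Longrightarrow> e x \<in> M"
  and e_add: "x \<in> L \<Longrightarrow> y \<in> L \<Longrightarrow> e (x + y) = e x + e y"
  and e_scale: "x \<in> L \<Longrightarrow> e (sL c x) = sM c (e x)"
  and e_br: "x \<in> L \<Longrightarrow> y \<in> L \<Longrightarrow> e (brL x y) = brM (e x) (e y)"
  and e_inj: "inj_on e L"
  using e_mono by (auto simp: lie_mono_def linear_map_on_def)

lemma e_zero: "e 0 = 0"
  using e_add[of 0 0] zero_L by simp

lemma e_eq0: "x \<in> L \<Longrightarrow> e x = 0 \<longleftrightarrow> x = 0"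
  using inj_onD[OF e_inj, of x 0] e_zero zero_L by auto

lemma subspace_e:
  assumes "subspace V" "V \<subseteq> L"
  shows "M.subspace (e ` V)"
proof (rule M.subspaceI)
  show "0 \<in> e ` V" using subspace_0[OF assms(1)] e_zero by force
  show "x + y \<in> e ` V" if "x \<in> e ` V" "y \<in> e ` V" for x y
    using that assms subspace_add[OF assms(1)] by (auto simp: e_add[symmetric] subset_iff)
  show "sM c x \<in> e ` V" if "x \<in> e ` V" for c x
    using that assms subspace_scale[OF assms(1)] by (auto simp: e_scale[symmetric] subset_iff)
qed

text \<open>In [[p,x],i] = [[p,i],x] + [p,[x,i]] both terms vanish, because [x,i] is again in the
  ideal I. The same identity drives \<open>absorbs_br\<close>, where both terms lie in the image of
  L.\<close>

lemma annihilates_br: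
  assumes "p \<in> M" "I \<in> G" "annihilates p I" "x \<in> L"
  shows "annihilates (brM p (e x)) I"
  unfolding annihilates_def
proof
  fix i assume i: "i \<in> I"
  note id = ideal_closed[OF G_ideal[OF assms(2)] i]
  have "brM p (e (brL x i)) = 0" "brM p (e i) = 0"
    using assms id(3)[OF assms(4)] i by (auto simp: annihilates_def)
  then show "brM (brM p (e x)) (e i) = 0"
    using M.leibniz'[OF assms(1) e_mem[OF assms(4)] e_mem[OF id(1)[OF assms(4)]]]
      e_br[OF assms(4) id(1)[OF assms(4)]] M.zero1 e_mem assms(4) by simp
qed

lemma absorbs_br:
  assumes "p \<in> M" "I \<in> G" "absorbs p I" "x \<in> L"
  shows "absorbs (brM p (e x)) I"
  unfolding absorbs_def
proof
  fix i assume i: "i \<in> I"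
  note id = ideal_closed[OF G_ideal[OF assms(2)] i]
  have 1: "brM p (e (brL x i)) \<in> e ` L" "brM p (e i) \<in> e ` L"
    using assms id(3)[OF assms(4)] i by (auto simp: absorbs_def)
  then have "brM (brM p (e i)) (e x) \<in> e ` L"
    using assms(4) closed by (auto simp: e_br[symmetric])
  then show "brM (brM p (e x)) (e i) \<in> e ` L"
    using M.leibniz'[OF assms(1) e_mem[OF assms(4)] e_mem[OF id(1)[OF assms(4)]]]
      e_br[OF assms(4) id(1)[OF assms(4)]] 1(1) M.subspace_add[OF subspace_e[OF subspace_L]]
    by simp
qed

lemma annihilates_image:
  assumes "x \<in> L" "I \<in> G" "annihilates (e x) I"
  shows "x = 0"
proof -
  have "x \<in> lie_centralizer L brL I"
    using assms ideal_closed(1)[OF G_ideal[OF assms(2)] _ assms(1)] closed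
    by (simp add: lie_centralizer_def annihilates_def e_br[symmetric] e_eq0)
  then show ?thesis using G_cent[OF assms(2)] by auto
qed

text \<open>For i in I the bracket [p,i] lies in L and is still annihilated by K, so the zero
  centralizer of K kills it.\<close>

lemma annihilates_absorbed:
  assumes "p \<in> M" "I \<in> G" "absorbs p I" "K \<in> G" "annihilates p K"
  shows "annihilates p I"
  unfolding annihilates_def
proof
  fix i assume i: "i \<in> I"
  then have iL: "i \<in> L" using G_ideal[OF assms(2)] by (auto simp: lie_ideal_iff)
  obtain x where x: "x \<in> L" "brM p (e i) = e x" using assms(3) i by (auto simp: absorbs_def)
  show "brM p (e i) = 0"
    using annihilates_image[OF x(1) assms(4)] annihilates_br[OF assms(1,4,5) iL] x(2) e_zero by simp
qed

lemma G_subset: "I \<in> G \<Longrightarrow> I \<subseteq> L"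
  using G_ideal by (simp add: lie_ideal_iff)

lemma absorbs_zero:
  assumes "I \<in> G"
  shows "absorbs 0 I"
  unfolding absorbs_def
proof
  fix i assume "i \<in> I"
  then have "brM 0 (e i) = e 0" using G_subset[OF assms] M.zero1 e_mem e_zero by (metis subsetD)
  then show "brM 0 (e i) \<in> e ` L" using zero_L by blast
qed

lemma absorbs_add:
  assumes "p \<in> M" "q \<in> M" "absorbs p I" "absorbs q I" "I \<in> G"
  shows "absorbs (p + q) I"
  using assms G_subset[OF assms(5)] M.subspace_add[OF subspace_e[OF subspace_L]]
  by (auto simp: absorbs_def M.add1 e_mem subset_iff)

lemma absorbs_scale:
  assumes "p \<in> M" "absorbs p I" "I \<in> G"
  shows "absorbs (sM c p) I"
  using assms G_subset[OF assms(3)] M.subspace_scale[OF subspace_e[OF subspace_L]]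
  by (auto simp: absorbs_def M.scale1 e_mem subset_iff)

lemma absorbs_mono: "absorbs p I \<Longrightarrow> K \<subseteq> I \<Longrightarrow> absorbs p K"
  by (auto simp: absorbs_def)

text \<open>In [p,[a,b]] = [[p,a],b] + [a,[p,b]] the elements [p,a] and [p,b] lie in L, so the ideal
  property puts both terms in I. Passing from I to [I,I] thus improves the target from L to I, which
  leaves room for a second element to act.\<close>

lemma absorbs_lie_bracket:
  assumes "p \<in> M" "I \<in> G" "absorbs p I" "x \<in> lie_bracket sL brL I I"
  shows "x \<in> L \<and> brM p (e x) \<in> e ` I"
proof -
  note id = ideal_closed[OF G_ideal[OF assms(2)]]
  have IL: "I \<subseteq> L" and sI: "subspace I" using G_ideal[OF assms(2)] by (auto simp: lie_ideal_iff)
  note sE = subspace_e[OF sI IL]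
  have "subspace {x \<in> L. brM p (e x) \<in> e ` I}"
    by (rule subspaceI)
      (use zero_L e_zero M.zero2[OF assms(1)] subspace_0[OF sI] M.subspace_0[OF sE]
          M.subspace_add[OF sE] M.subspace_scale[OF sE] assms(1)
        in \<open>simp_all add: add_L scale_L e_add e_scale M.add2 M.scale2 e_mem\<close>)
  moreover have "brL a b \<in> L \<and> brM p (e (brL a b)) \<in> e ` I" if ab: "a \<in> I" "b \<in> I" for a b
  proof -
    have L: "a \<in> L" "b \<in> L" using ab IL by auto
    have "brM p (e a) \<in> e ` L" "brM p (e b) \<in> e ` L" using assms(3) ab by (simp_all add: absorbs_def)
    then obtain x y where x: "x \<in> L" "brM p (e a) = e x" and y: "y \<in> L" "brM p (e b) = e y"
      by blast
    have "brM p (e (brL a b)) = e (brL x b) + e (brL a y)"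
      using M.leibniz[OF assms(1) e_mem[OF L(1)] e_mem[OF L(2)]] L x y by (simp add: e_br)
    moreover have "e (brL x b) \<in> e ` I" "e (brL a y) \<in> e ` I"
      using id(3)[OF ab(2) x(1)] id(2)[OF ab(1) y(1)] by blast+
    ultimately show ?thesis
      using M.subspace_add[OF sE] closed[OF L] by metis
  qed
  ultimately have "lie_bracket sL brL I I \<subseteq> {x \<in> L. brM p (e x) \<in> e ` I}"
    by (simp add: lie_bracket_subset_iff)
  then show ?thesis using assms(4) by blast
qed

text \<open>For k in [I,I] both [p,k] and [q,k] are in I, where q and p act with values in L. This
  is the purpose of the power condition on the filter.\<close>

lemma absorbs_bracket:
  assumes pq: "p \<in> M" "q \<in> M" and I: "I \<in> G" "absorbs p I" "absorbs q I"
    and K: "K \<subseteq> lie_bracket sL brL I I"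
  shows "absorbs (brM p q) K"
  unfolding absorbs_def
proof
  fix k assume "k \<in> K"
  then have k: "k \<in> lie_bracket sL brL I I" using K by blast
  have kL: "k \<in> L" using absorbs_lie_bracket[OF pq(1) I(1,2) k] by blast
  obtain x y where x: "x \<in> I" "brM p (e k) = e x" and y: "y \<in> I" "brM q (e k) = e y"
    using absorbs_lie_bracket[OF pq(1) I(1,2) k] absorbs_lie_bracket[OF pq(2) I(1,3) k] by blast
  have "x \<in> L" "y \<in> L" using x y G_subset[OF I(1)] by auto
  then have "brM (brM p q) (e k) = brM p (e y) - brM q (e x)"
    using M.leibniz[OF pq e_mem[OF kL]] x y M.closed pq e_mem by (simp add: eq_diff_eq)
  then show "brM (brM p q) (e k) \<in> e ` L"
    using I x y M.subspace_diff[OF subspace_e[OF subspace_L]] by (simp add: absorbs_def)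
qed

text \<open>Intersections in the filter give closure under sums, its power condition gives closure
  under brackets, and \<open>faithful\<close> supplies the nonvanishing half of the quotient
  condition.\<close>

lemma algebra_of_quotients_absorbed:
  assumes faithful: "\<And>p I. p \<in> M \<Longrightarrow> I \<in> G \<Longrightarrow> annihilates p I \<Longrightarrow> p = 0"
  shows "lie_algebra_of_quotients sL L brL G sM {p \<in> M. \<exists>I\<in>G. absorbs p I} brM e"
    (is "lie_algebra_of_quotients _ _ _ _ _ ?P _ _")
proof -
  have common: "\<exists>I\<in>G. absorbs p I \<and> absorbs q I" if pq: "p \<in> ?P" "q \<in> ?P" for p q
  proof -
    obtain I where I: "I \<in> G" "absorbs p I" using pq(1) by blast
    obtain J where J: "J \<in> G" "absorbs q J" using pq(2) by blast
    obtain K where "K \<in> G" "K \<subseteq> I \<inter> J" using G_Int[OF I(1) J(1)] by blast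
    then show ?thesis using I J absorbs_mono[of p I K] absorbs_mono[of q J K] by blast
  qed
  have eL: "e ` L \<subseteq> ?P"
  proof -
    obtain I where I: "I \<in> G" using G_ne by blast
    have "absorbs (e x) I" if "x \<in> L" for x
      using that G_subset[OF I] closed by (auto simp: absorbs_def e_br[symmetric] subset_iff)
    then show ?thesis using I e_mem by blast
  qed
  have sub: "M.subspace ?P"
  proof (rule M.subspaceI)
    show "0 \<in> ?P" using eL e_zero zero_L by force
    show "x + y \<in> ?P" if pq: "x \<in> ?P" "y \<in> ?P" for x y
    proof -
      obtain I where "I \<in> G" "absorbs x I" "absorbs y I" using common[OF pq] by blast
      then show ?thesis using absorbs_add[of x y I] M.add_L pq by auto
    qed
    show "sM c x \<in> ?P" if "x \<in> ?P" for c x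
      using that absorbs_scale[of x] M.scale_L[of x] by auto
  qed
  have cl: "brM p q \<in> ?P" if pq: "p \<in> ?P" "q \<in> ?P" for p q
  proof -
    obtain I where I: "I \<in> G" "absorbs p I" "absorbs q I" using common[OF pq] by blast
    obtain K where K: "K \<in> G" "K \<subseteq> lie_bracket sL brL I I" using G_pow[OF I(1)] by blast
    show ?thesis using absorbs_bracket[OF _ _ I K(2)] K(1) M.closed pq by auto
  qed
  have "lie_algebra sM ?P brM"
    by unfold_locales (use sub cl in \<open>simp_all add: M.add1 M.add2 M.scale1 M.scale2 M.alt M.jacobi\<close>)
  moreover have "lie_mono sL L brL sM ?P brM e"
    using e_mono eL unfolding lie_mono_def linear_map_on_def by blast
  moreover have "\<exists>I\<in>G. lie_bracket sM brM {q} (e ` I) \<noteq> {0} \<and> lie_bracket sM brM {q} (e ` I) \<subseteq> e ` L"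
    if q: "q \<in> ?P" "q \<noteq> 0" for q
  proof -
    obtain I where I: "I \<in> G" "absorbs q I" using q by blast
    then have "\<not> annihilates q I" using faithful q by blast
    then show ?thesis
      using I unfolding M.lie_bracket_zero_iff M.lie_bracket_subset_iff[OF subspace_e[OF subspace_L order_refl]]
      by (auto simp: absorbs_def annihilates_def)
  qed
  ultimately show ?thesis unfolding lie_algebra_of_quotients_def by blast
qed

end

section \<open>Testing elements of algebras of quotients on ideals of the filter\<close>

locale lie_quotients = lie_filter sL L brL G
  for sL :: "'f::field \<Rightarrow> 'l::ab_group_add \<Rightarrow> 'l" and L brL G +
  fixes sM :: "'f \<Rightarrow> 'm::ab_group_add \<Rightarrow> 'm" and M brM e
  assumes quotients: "lie_algebra_of_quotients sL L brL G sM M brM e"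

sublocale lie_quotients \<subseteq> lie_extension
  using quotients by unfold_locales
    (auto simp: lie_algebra_of_quotients_def lie_algebra_def lie_algebra_axioms_def vector_space_def)

context lie_quotients
begin

lemma absorbs_ex:
  assumes "q \<in> M"
  shows "\<exists>I\<in>G. absorbs q I"
proof (cases "q = 0")
  case True
  obtain I where I: "I \<in> G" using G_ne by blast
  then show ?thesis using True absorbs_zero by blast
next
  case False
  then obtain I where "I \<in> G" "lie_bracket sM brM {q} (e ` I) \<subseteq> e ` L"
    using quotients assms unfolding lie_algebra_of_quotients_def by blast
  then show ?thesis
    unfolding M.lie_bracket_subset_iff[OF subspace_e[OF subspace_L order_refl]] absorbs_def by auto
qed

text \<open>A nonzero q would absorb some I without being annihilated by it, and
  \<open>annihilates_absorbed\<close> carries vanishing from K to this I.\<close>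

lemma annihilates_zero:
  assumes q: "q \<in> M" and K: "K \<in> G" "annihilates q K"
  shows "q = 0"
proof (rule ccontr)
  assume "q \<noteq> 0"
  then obtain I where I: "I \<in> G" "lie_bracket sM brM {q} (e ` I) \<noteq> {0}"
      "lie_bracket sM brM {q} (e ` I) \<subseteq> e ` L"
    using quotients q unfolding lie_algebra_of_quotients_def by blast
  then have "absorbs q I" "\<not> annihilates q I"
    unfolding M.lie_bracket_subset_iff[OF subspace_e[OF subspace_L order_refl]]
      M.lie_bracket_zero_iff absorbs_def annihilates_def by auto
  then show False using annihilates_absorbed[OF q I(1) _ K] by blast
qed

end

section \<open>Maximality for algebras of quotients on arbitrary types\<close>

lemma vector_space_fun: "vector_space (\<lambda>c (v :: 'i \<Rightarrow> 'f::field) i. c * v i)"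
  by unfold_locales (simp_all add: fun_eq_iff algebra_simps)

text \<open>The coordinates with respect to a basis \<open>B\<close> of \<open>U\<close> are stored
  at the positions \<open>\<beta> b\<close> with b in \<open>B\<close>; the injection
  \<open>\<beta>\<close> guarantees that the index type has room for them.\<close>

lemma (in vector_space) ex_coordinates:
  fixes \<beta> :: "'b \<Rightarrow> 'i"
  assumes U: "subspace U" and \<beta>: "inj_on \<beta> U"
  shows "\<exists>V :: 'b \<Rightarrow> 'i \<Rightarrow> 'a. linear_map_on scale U (\<lambda>c v i. c * v i) (V ` U) V \<and> inj_on V U"
proof -
  obtain B where B: "B \<subseteq> U" "independent B" "U \<subseteq> span B"
    using maximal_independent_subset by blast
  have \<beta>B: "inj_on \<beta> B" using inj_on_subset[OF \<beta> B(1)] .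
  define V where "V p i = (if i \<in> \<beta> ` B then representation B p (inv_into B \<beta> i) else 0)" for p i
  have "linear_map_on scale U (\<lambda>c v i. c * v i) (V ` U) V"
    using B(2,3) by (auto simp: linear_map_on_def V_def fun_eq_iff representation_add
        representation_scale subset_iff)
  moreover have "inj_on V U"
  proof (rule inj_onI)
    fix x y assume xy: "x \<in> U" "y \<in> U" "V x = V y"
    have "representation B x b = representation B y b" for b
    proof (cases "b \<in> B")
      case True
      then show ?thesis
        using fun_cong[OF xy(3), of "\<beta> b"] \<beta>B by (simp add: V_def)
    next
      case False
      then show ?thesis using representation_ne_zero by metis
    qed
    then have "representation B x = representation B y" by blast
    then show "x = y"
      using sum_nonzero_representation_eq[OF B(2), of x] sum_nonzero_representation_eq[OF B(2), of y]
        xy B(3) by (metis subsetD)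
  qed
  ultimately show ?thesis by blast
qed

context lie_quotients
begin

text \<open>Transport of structure along \<open>V\<close>. The quotient condition survives because
  \<open>V\<close> is injective and carries [p, e x] to the transported bracket.\<close>

lemma quotients_image:
  fixes V :: "'m \<Rightarrow> 'n::ab_group_add"
  assumes s: "vector_space sN" and V: "linear_map_on sM M sN (V ` M) V" "inj_on V M"
  shows "\<exists>b. lie_algebra_of_quotients sL L brL G sN (V ` M) b (V \<circ> e) \<and> lie_mono sM M brM sN (V ` M) b V"
proof -
  interpret N: vector_space sN by fact
  define b where "b u v = V (brM (inv_into M V u) (inv_into M V v))" for u v
  have b: "b (V x) (V y) = V (brM x y)" if "x \<in> M" "y \<in> M" for x y
    using that V(2) by (simp add: b_def)
  have add: "V (x + y) = V x + V y" if "x \<in> M" "y \<in> M" for x y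
    using V(1) that unfolding linear_map_on_def by blast
  have scale: "V (sM c x) = sN c (V x)" if "x \<in> M" for x c
    using V(1) that unfolding linear_map_on_def by blast
  have V0: "V 0 = 0" using add[of 0 0] M.zero_L by simp
  have N: "lie_algebra sN (V ` M) b"
  proof unfold_locales
    show "N.subspace (V ` M)"
    proof (rule N.subspaceI)
      show "0 \<in> V ` M" using V0 M.zero_L by (metis imageI)
    qed (auto simp: add[symmetric] scale[symmetric] M.add_L M.scale_L)
  qed (auto simp: add[symmetric] scale[symmetric] b M.add_L M.scale_L M.closed M.add1 M.add2
      M.scale1 M.scale2 M.alt M.jacobi V0)
  interpret N: lie_algebra sN "V ` M" b by (rule N)
  have mono: "lie_mono sM M brM sN (V ` M) b V"
    using V b by (simp add: lie_mono_def)
  have Ve: "lie_mono sL L brL sN (V ` M) b (V \<circ> e)"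
    unfolding lie_mono_def linear_map_on_def
    using e_mem comp_inj_on[OF e_inj inj_on_subset[OF V(2)]]
    by (auto simp: e_add e_scale e_br add scale b)
  interpret E: lie_extension sL L brL G sN "V ` M" b "V \<circ> e"
    by unfold_locales (rule Ve)
  have "\<exists>I\<in>G. lie_bracket sN b {q} ((V \<circ> e) ` I) \<noteq> {0} \<and> lie_bracket sN b {q} ((V \<circ> e) ` I) \<subseteq> (V \<circ> e) ` L"
    if q: "q \<in> V ` M" "q \<noteq> 0" for q
  proof -
    obtain p where p: "p \<in> M" "q = V p" using q by blast
    then have p0: "p \<noteq> 0" using q V0 by blast
    obtain I where I: "I \<in> G" "absorbs p I" using absorbs_ex[OF p(1)] by blast
    have "\<not> annihilates p I" using annihilates_zero[OF p(1) I(1)] p0 by blast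
    then obtain i where i: "i \<in> I" "brM p (e i) \<noteq> 0" by (auto simp: annihilates_def)
    have IM: "e x \<in> M" if "x \<in> I" for x using that G_subset[OF I(1)] e_mem by blast
    have bq: "b q ((V \<circ> e) x) = V (brM p (e x))" if "x \<in> I" for x
      using b p IM that by simp
    have "V (brM p (e i)) \<noteq> V 0"
      using inj_onD[OF V(2), of "brM p (e i)" 0] M.closed p IM i M.zero_L by blast
    then have "b q ((V \<circ> e) i) \<noteq> 0" using bq i V0 by simp
    moreover have "b q ((V \<circ> e) x) \<in> (V \<circ> e) ` L" if "x \<in> I" for x
      using bq[OF that] I(2) that by (auto simp: absorbs_def)
    ultimately show ?thesis
      using I(1) i(1) unfolding N.lie_bracket_zero_iff
        N.lie_bracket_subset_iff[OF E.subspace_e[OF subspace_L order_refl]]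
      by blast
  qed
  then have "lie_algebra_of_quotients sL L brL G sN (V ` M) b (V \<circ> e)"
    using N Ve unfolding lie_algebra_of_quotients_def by blast
  then show ?thesis using mono by blast
qed

text \<open>An element of an algebra of quotients is determined by an absorbed ideal together with its
  action on it, so a basis embeds into the index type used in the definition of maximality.\<close>

lemma maximal_universal:
  assumes max: "maximal_lie_algebra_of_quotients sL L brL G sQ Q brQ e'"
  shows "\<exists>\<psi>. lie_mono sM M brM sQ Q brQ \<psi> \<and> (\<forall>x\<in>L. \<psi> (e x) = e' x)"
proof -
  define J where "J p = (SOME I. I \<in> G \<and> absorbs p I)" for p
  have J: "J p \<in> G" "absorbs p (J p)" if "p \<in> M" for p
    using absorbs_ex[OF that] unfolding J_def by (metis (mono_tags, lifting) someI_ex)+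
  define \<beta> where "\<beta> p = (J p, \<lambda>x. if x \<in> J p then inv_into L e (brM p (e x)) else 0)" for p
  have "inj_on \<beta> M"
  proof (rule inj_onI)
    fix p q assume pq: "p \<in> M" "q \<in> M" "\<beta> p = \<beta> q"
    then have Jq: "J q = J p" by (simp add: \<beta>_def)
    have "brM p (e x) = brM q (e x)" if x: "x \<in> J p" for x
    proof -
      have "inv_into L e (brM p (e x)) = inv_into L e (brM q (e x))"
        using fun_cong[OF arg_cong[OF pq(3), of snd], of x] x Jq by (simp add: \<beta>_def)
      moreover have "brM p (e x) \<in> e ` L" "brM q (e x) \<in> e ` L"
        using J[OF pq(1)] J[OF pq(2)] x Jq by (auto simp: absorbs_def)
      ultimately show ?thesis by (metis f_inv_into_f)
    qed
    then have "annihilates (p - q) (J p)"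
      using G_subset[OF J(1)[OF pq(1)]] pq(1,2) e_mem
      by (auto simp: annihilates_def M.diff1 subset_iff)
    then show "p = q"
      using annihilates_zero[OF M.diff_L[OF pq(1,2)] J(1)[OF pq(1)]] by simp
  qed
  then obtain V :: "'m \<Rightarrow> 'l set \<times> ('l \<Rightarrow> 'l) \<Rightarrow> 'f"
    where V: "linear_map_on sM M (\<lambda>c v i. c * v i) (V ` M) V" "inj_on V M"
    using M.ex_coordinates[OF M.subspace_L] by blast
  obtain b where b: "lie_algebra_of_quotients sL L brL G (\<lambda>c v i. c * v i) (V ` M) b (V \<circ> e)"
      "lie_mono sM M brM (\<lambda>c v i. c * v i) (V ` M) b V"
    using quotients_image[OF vector_space_fun V] by blast
  obtain \<psi> where \<psi>: "lie_mono (\<lambda>c v i. c * v i) (V ` M) b sQ Q brQ \<psi>" "\<forall>x\<in>L. \<psi> ((V \<circ> e) x) = e' x"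
    using max b(1) unfolding maximal_lie_algebra_of_quotients_def by blast
  have "lie_mono sM M brM sQ Q brQ (\<psi> \<circ> V)"
    using \<psi>(1) b(2) comp_inj_on[of V M \<psi>] unfolding lie_mono_def linear_map_on_def
    by (auto simp: image_subset_iff)
  then show ?thesis using \<psi>(2) by (intro exI[of _ "\<psi> \<circ> V"]) simp
qed

end

section \<open>Systems of quotients\<close>

context lie_triple_system
begin

text \<open>The power filter theorem assumes T nonzero, since its filters exclude the zero ideal.
  When T is zero, the ideals concerned are all zero and the claim is immediate;
  \<open>zero_centralizer_ideals_power\<close> is split in the same way.\<close>

lemma zero_centralizer_ideals_Int:
  assumes nd: "lts_nondegenerate scale T br"
    and IJ: "I \<in> zero_centralizer_ideals scale T br" "J \<in> zero_centralizer_ideals scale T br"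
  shows "\<exists>K\<in>zero_centralizer_ideals scale T br. K \<subseteq> I \<inter> J"
proof (cases "T = {0}")
  case True
  have "I \<subseteq> {0}" "0 \<in> J"
    using IJ True subspace_0[of J] unfolding zero_centralizer_ideals_def lts_ideal_iff by blast+
  then show ?thesis using IJ by blast
next
  case False
  then show ?thesis
    using power_filter_zero_centralizer_ideals[OF nd] IJ by (simp add: lts_power_filter_def)
qed

lemma zero_centralizer_ideals_power:
  assumes nd: "lts_nondegenerate scale T br" and I: "I \<in> zero_centralizer_ideals scale T br"
  shows "\<exists>K\<in>zero_centralizer_ideals scale T br. K \<subseteq> lts_bracket scale br I T I"
proof (cases "T = {0}")
  case True
  have "I \<subseteq> {0}" using I True unfolding zero_centralizer_ideals_def lts_ideal_iff by blast
  then have "I \<subseteq> lts_bracket scale br I T I" unfolding lts_bracket_def using span_zero by blast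
  then show ?thesis using I by blast
next
  case False
  then show ?thesis
    using power_filter_zero_centralizer_ideals[OF nd] I by (simp add: lts_power_filter_def)
qed

lemma T_zero_centralizer:
  assumes nd: "lts_nondegenerate scale T br"
  shows "T \<in> zero_centralizer_ideals scale T br"
proof -
  have "x = 0" if "x \<in> lts_centralizer scale T br T" for x
    using nondegD[OF nd, of x] that by (auto simp: centralizer_iff)
  moreover have "0 \<in> lts_centralizer scale T br T"
    by (simp add: centralizer_iff zero_T zero1 zero3)
  ultimately show ?thesis using ideal_T by (auto simp: zero_centralizer_ideals_def)
qed

lemma lie_filter_stdemb_ideals:
  assumes nd: "lts_nondegenerate scale T br"
  shows "lie_filter (stdemb_scale scale) (stdemb scale T br) (stdemb_bracket T br)
    (stdemb_ideal scale T br ` zero_centralizer_ideals scale T br)"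
proof -
  interpret L: lie_algebra "stdemb_scale scale" "stdemb scale T br" "stdemb_bracket T br"
    by (rule lie_algebra_stdemb)
  let ?F = "zero_centralizer_ideals scale T br"
  have mono: "stdemb_ideal scale T br I \<subseteq> stdemb_ideal scale T br J" if "I \<subseteq> J" for I J
    using lmult_span_mono[OF that] that unfolding stdemb_ideal_def by blast
  have id: "lts_ideal scale T br I" "lts_centralizer scale T br I = {0}" if "I \<in> ?F" for I
    using that by (auto simp: zero_centralizer_ideals_def)
  show ?thesis
  proof
    show "stdemb_ideal scale T br ` ?F \<noteq> {}" using T_zero_centralizer[OF nd] by blast
    fix I assume "I \<in> stdemb_ideal scale T br ` ?F"
    then obtain A where A: "A \<in> ?F" "I = stdemb_ideal scale T br A" by blast
    show "lie_ideal (stdemb_scale scale) (stdemb scale T br) (stdemb_bracket T br) I"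
      using lie_ideal_stdemb_ideal id A by blast
    show "lie_centralizer (stdemb scale T br) (stdemb_bracket T br) I = {0}"
      using lie_centralizer_stdemb_ideal id A by blast
    obtain K where "K \<in> ?F" "K \<subseteq> lts_bracket scale br A T A"
      using zero_centralizer_ideals_power[OF nd A(1)] by blast
    then show "\<exists>K\<in>stdemb_ideal scale T br ` ?F.
        K \<subseteq> lie_bracket (stdemb_scale scale) (stdemb_bracket T br) I I"
      using order_trans[OF mono stdemb_ideal_power[OF id(1)[OF A(1)]]] A(2) by blast
    fix J assume "J \<in> stdemb_ideal scale T br ` ?F"
    then obtain B where B: "B \<in> ?F" "J = stdemb_ideal scale T br B" by blast
    obtain C where "C \<in> ?F" "C \<subseteq> A \<inter> B" using zero_centralizer_ideals_Int[OF nd A(1) B(1)] by blast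
    then show "\<exists>K\<in>stdemb_ideal scale T br ` ?F. K \<subseteq> I \<inter> J"
      using mono[of C A] mono[of C B] A B by blast
  qed
qed

lemma subsystem_iff:
  "lts_subsystem scale T br U \<longleftrightarrow> subspace U \<and> U \<subseteq> T \<and> (\<forall>x\<in>U. \<forall>y\<in>U. \<forall>z\<in>U. br x y z \<in> U)"
  unfolding lts_subsystem_def using lts_bracket_subset_iff by metis

text \<open>This moves the third argument into the first slot, the slot on which the operators
  R(x,y) act.\<close>

lemma bracket_third:
  assumes "x \<in> T" "y \<in> T" "z \<in> T"
  shows "br x y z = br z y x - br z x y"
  using cyclic[OF assms] antisymm[OF assms(3,2,1)]
  by (simp add: add_eq_0_iff2 diff_eq_eq eq_diff_eq algebra_simps)

end

locale lts_quotients = lie_triple_system scale S br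
  for scale :: "'f::field \<Rightarrow> 'a::ab_group_add \<Rightarrow> 'a" and S br +
  fixes U :: "'a set"
  assumes soq: "system_of_quotients scale S br U"
begin

lemma U: "subspace U" "U \<subseteq> S" "\<And>x y z. x \<in> U \<Longrightarrow> y \<in> U \<Longrightarrow> z \<in> U \<Longrightarrow> br x y z \<in> U"
  using soq by (auto simp: system_of_quotients_def subsystem_iff)

lemma US: "x \<in> U \<Longrightarrow> x \<in> S"
  using U by blast

lemma soqD:
  assumes "s \<in> S" "s' \<in> S" "s \<noteq> 0"
  obtains x y where "x \<in> U" "y \<in> U" "br s x y \<noteq> 0"
    "x \<in> transporter scale br U s' \<or> y \<in> transporter scale br U s'"
  using soq assms unfolding system_of_quotients_def by blast

lemma lie_triple_system_U: "lie_triple_system scale U br"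
proof unfold_locales
  show "br u v (br x y z) = br (br u v x) y z + br x (br u v y) z + br x y (br u v z)"
    if "u \<in> U" "v \<in> U" "x \<in> U" "y \<in> U" "z \<in> U" for u v x y z
    using that US derivation by blast
qed (use U US in \<open>simp_all add: add1 add2 add3 scale1 scale2 scale3 alt cyclic\<close>)

section \<open>The span generated by an element, and transporters\<close>

lemma subspace_R_span: "subspace (R_span scale br U s)"
  by (simp add: R_span_def)

lemma R_span_self: "s \<in> R_span scale br U s"
proof -
  have "foldr (\<lambda>(x, y) z. br z x y) [] s \<in> R_span scale br U s"
    unfolding R_span_def by (intro span_base CollectI exI[of _ "[]"]) simp
  then show ?thesis by simp
qed

lemma R_span_S:
  assumes "s \<in> S"
  shows "R_span scale br U s \<subseteq> S"
proof -
  have "foldr (\<lambda>(x, y) z. br z x y) ps s \<in> S" if "set ps \<subseteq> U \<times> U" for ps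
    using that
  proof (induction ps)
    case (Cons p ps)
    obtain x y where p: "p = (x, y)" by fastforce
    then have S: "x \<in> S" "y \<in> S" using Cons.prems US by auto
    have "foldr (\<lambda>(x, y) z. br z x y) ps s \<in> S" using Cons by simp
    then show ?case using closed[OF _ S] by (simp add: p)
  qed (use assms in simp)
  then show ?thesis unfolding R_span_def by (intro span_minimal[OF _ subspace_T]) auto
qed

text \<open>Closure in the first slot comes from prepending one more pair to the list of operators.
  Antisymmetry and \<open>bracket_third\<close> transfer it to the other two slots.\<close>

lemma R_span_closed:
  assumes s: "s \<in> S" and m: "m \<in> R_span scale br U s" and xy: "x \<in> U" "y \<in> U"
  shows "br m x y \<in> R_span scale br U s" "br x m y \<in> R_span scale br U s"
    "br x y m \<in> R_span scale br U s"
proof -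
  let ?M = "R_span scale br U s" and ?A = "{foldr (\<lambda>(x, y) z. br z x y) ps s | ps. set ps \<subseteq> U \<times> U}"
  have 1: "br m x y \<in> ?M" if xy: "x \<in> U" "y \<in> U" for x y
  proof -
    have "subspace {m \<in> S. br m x y \<in> ?M}"
      by (rule subspaceI)
        (use subspace_0[OF subspace_R_span] subspace_add[OF subspace_R_span]
            subspace_scale[OF subspace_R_span] xy US
          in \<open>simp_all add: zero_T add_T scale_T zero1 add1 scale1\<close>)
    moreover have "z \<in> S \<and> br z x y \<in> ?M" if z: "z \<in> ?A" for z
    proof -
      obtain ps where ps: "z = foldr (\<lambda>(x, y) z. br z x y) ps s" "set ps \<subseteq> U \<times> U" using z by blast
      have "br z x y = foldr (\<lambda>(x, y) z. br z x y) ((x, y) # ps) s" using ps by simp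
      moreover have "set ((x, y) # ps) \<subseteq> U \<times> U" using ps(2) xy by simp
      ultimately have "br z x y \<in> ?A" by blast
      then show ?thesis
        using span_base[of _ ?A] z R_span_S[OF s] unfolding R_span_def by blast
    qed
    ultimately have "?M \<subseteq> {m \<in> S. br m x y \<in> ?M}"
      unfolding R_span_def[of scale br U s] by (intro span_minimal) auto
    then show ?thesis using m by blast
  qed
  have mS: "m \<in> S" using m R_span_S[OF s] by blast
  show "br m x y \<in> ?M" using 1 xy by blast
  show "br x m y \<in> ?M"
    using 1[OF xy] antisymm[OF mS] xy US subspace_neg[OF subspace_R_span] by simp
  show "br x y m \<in> ?M"
    using bracket_third[of x y m] 1[OF xy] 1[OF xy(2,1)] xy US mS subspace_diff[OF subspace_R_span] by simp
qed

lemma transporter_iff: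
  "x \<in> transporter scale br U s \<longleftrightarrow>
    x \<in> U \<and> (\<forall>t\<in>U. \<forall>m\<in>R_span scale br U s. br x t m \<in> U \<and> br x m t \<in> U)"
  unfolding transporter_def using lts_bracket_subset_iff[OF U(1)] by auto

lemma transporter_closed:
  assumes s: "s \<in> S" and x: "x \<in> transporter scale br U s" and t: "t \<in> U"
    and m: "m \<in> R_span scale br U s"
  shows "br x t m \<in> U" "br x m t \<in> U" "br t x m \<in> U" "br m x t \<in> U" "br m t x \<in> U" "br t m x \<in> U"
proof -
  have S: "x \<in> S" "t \<in> S" "m \<in> S" using assms R_span_S[OF s] US by (auto simp: transporter_iff)
  show 1: "br x t m \<in> U" "br x m t \<in> U" using assms by (auto simp: transporter_iff)
  show "br t x m \<in> U" "br m x t \<in> U"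
    using 1 antisymm[of x t m] antisymm[of x m t] S subspace_neg[OF U(1)] by simp_all
  show "br t m x \<in> U"
    using 1 bracket_third[of t m x] S subspace_diff[OF U(1)] by simp
  then show "br m t x \<in> U" using antisymm[of t m x] S subspace_neg[OF U(1)] by simp
qed

text \<open>Membership of [x,a,b] in the transporter concerns brackets with [x,a,b] in the first
  slot. The third slot is treated before it, because there the derivation law applies
  directly.\<close>

lemma ideal_transporter:
  assumes s: "s \<in> S"
  shows "lts_ideal scale U br (transporter scale br U s)"
proof -
  let ?J = "transporter scale br U s" and ?M = "R_span scale br U s"
  interpret U: lie_triple_system scale U br by (rule lie_triple_system_U)
  note MS = subsetD[OF R_span_S[OF s]]
  note add = subspace_add[OF U(1)] and diff = subspace_diff[OF U(1)] and neg = subspace_neg[OF U(1)]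
  have sub: "subspace ?J"
    by (rule subspaceI)
      (use MS US subspace_0[OF U(1)] add subspace_scale[OF U(1)]
        in \<open>simp_all add: transporter_iff zero1 add1 scale1\<close>)
  have "br x a b \<in> ?J" if x: "x \<in> ?J" and ab: "a \<in> U" "b \<in> U" for x a b
  proof -
    have xU: "x \<in> U" using x by (simp add: transporter_iff)
    note tr = transporter_closed[OF s x] and cl = R_span_closed[OF s]
    \<comment> \<open>The operator [t,m,_] acts as a derivation on [x,a,b]. It sends x into
      \<open>U\<close> and sends a and b into \<open>?M\<close>, and x then carries these back into
      \<open>U\<close>.\<close>
    have third: "br t m (br x a b) \<in> U" if t: "t \<in> U" and m: "m \<in> ?M" and ab: "a \<in> U" "b \<in> U" for t m a b
    proof -
      have "br (br t m x) a b \<in> U" "br x (br t m a) b \<in> U" "br x a (br t m b) \<in> U"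
        using tr(6)[OF t m] tr(1,2) cl(2) U(3) t m ab by auto
      then show ?thesis
        using derivation[of t m x a b] add t m ab xU US MS by simp
    qed
    \<comment> \<open>The derivation law for [x,a,[b,m,t]] is solved for the wanted term. The
      remainder [b,m,[x,a,t]] is an instance of \<open>third\<close>, which is why that fact
      quantifies over its own a and b.\<close>
    have second: "br (br x a b) m t \<in> U" if t: "t \<in> U" and m: "m \<in> ?M" for t m
    proof -
      have "br x a (br b m t) \<in> U" using tr(1)[OF ab(1) cl(2)[OF m ab(2) t]] .
      moreover have "br b (br x a m) t \<in> U" using U(3)[OF ab(2) tr(1)[OF ab(1) m] t] .
      moreover have "br b m (br x a t) \<in> U" using third[OF ab(2) m ab(1) t] .
      moreover have "br (br x a b) m t = br x a (br b m t) - br b (br x a m) t - br b m (br x a t)"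
        using derivation[of x a b m t] xU ab t MS[OF m] US by (simp add: algebra_simps)
      ultimately show ?thesis using diff by simp
    qed
    have "br (br x a b) t m \<in> U" if t: "t \<in> U" and m: "m \<in> ?M" for t m
    proof -
      have X: "br x a b \<in> S" "t \<in> S" "m \<in> S" using xU ab t m US MS closed by auto
      have "br (br x a b) t m = br m t (br x a b) + br (br x a b) m t"
        using bracket_third[OF X(3,2,1)] by simp
      moreover have "br m t (br x a b) \<in> U"
        using third[OF t m ab] antisymm[OF X(2,3,1)] neg by simp
      ultimately show ?thesis using second[OF t m] add by simp
    qed
    then show ?thesis using second U(3)[OF xU ab] by (simp add: transporter_iff)
  qed
  then show ?thesis using sub by (auto simp: U.lts_ideal_iff transporter_iff)
qed

text \<open>If x /= 0 centralized the transporter of s, the quotient condition for the pair x, s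
  would give [x,a,b] /= 0 with a or b in that transporter, although all such brackets
  vanish.\<close>

lemma transporter_zero_centralizer:
  assumes s: "s \<in> S"
  shows "transporter scale br U s \<in> zero_centralizer_ideals scale U br"
proof -
  interpret U: lie_triple_system scale U br by (rule lie_triple_system_U)
  let ?J = "transporter scale br U s"
  have JU: "?J \<subseteq> U" by (auto simp: transporter_iff)
  have "x = 0" if x: "x \<in> lts_centralizer scale U br ?J" for x
  proof (rule ccontr)
    assume "x \<noteq> 0"
    moreover have "x \<in> S" using x US by (auto simp: U.centralizer_iff)
    ultimately obtain a b where ab: "a \<in> U" "b \<in> U" "br x a b \<noteq> 0" "a \<in> ?J \<or> b \<in> ?J"
      using soqD[OF _ s] by blast
    then show False using U.centralizer_zero(1,5)[OF JU x] by blast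
  qed
  moreover have "0 \<in> lts_centralizer scale U br ?J"
    using JU by (auto simp: U.centralizer_iff U.zero_T U.zero1 U.zero3 subset_iff)
  ultimately have "lts_centralizer scale U br ?J = {0}" by blast
  then show ?thesis using ideal_transporter[OF s] by (simp add: zero_centralizer_ideals_def)
qed

lemma transporter_bracket:
  assumes s: "s \<in> S" and x: "x \<in> transporter scale br U s" and t: "t \<in> U"
  shows "br x t s \<in> U" "br x s t \<in> U" "br t x s \<in> U" "br s x t \<in> U" "br s t x \<in> U" "br t s x \<in> U"
  using transporter_closed[OF s x t R_span_self] by blast+

text \<open>The quotient condition is applied to the pair D s, s: if D s /= 0, there are x, y in
  \<open>U\<close> with [D s,x,y] /= 0 and [s,x,y] in \<open>U\<close>. As D kills x, y and [s,x,y],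
  the derivation law forces [D s,x,y] = 0.\<close>

lemma derivation_eq_zero:
  assumes D: "D \<in> derivations" and z: "\<And>t. t \<in> U \<Longrightarrow> D t = 0"
  shows "D = 0"
proof
  fix s
  have "D s = 0" if s: "s \<in> S"
  proof (rule ccontr)
    assume "D s \<noteq> 0"
    then obtain x y where xy: "x \<in> U" "y \<in> U" "br (D s) x y \<noteq> 0"
        "x \<in> transporter scale br U s \<or> y \<in> transporter scale br U s"
      using soqD[OF derivationsD(1)[OF D s] s] by blast
    then have "br s x y \<in> U" using transporter_bracket(4,5)[OF s] by blast
    then have "D (br s x y) = 0" by (rule z)
    moreover have "br s (D x) y = 0" "br s x (D y) = 0" using z xy US s by (simp_all add: zero2 zero3)
    ultimately show False using derivationsD(5)[OF D s US[OF xy(1)] US[OF xy(2)]] xy(3) by simp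
  qed
  then show "D s = 0 s" using derivationsD(2)[OF D] by (cases "s \<in> S") auto
qed

interpretation op: vector_space "op_scale scale" by (rule vector_space_op)

text \<open>For \<open>c\<close> in the transporter of \<open>s\<close>, the operator \<open>[s,c,_]\<close> maps \<open>U\<close> into itself but need
  not be a combination of operators \<open>[u,v,_]\<close> with \<open>u, v\<close> in \<open>U\<close>; brackets of such \<open>c\<close> repair this.\<close>

lemma lmult_transporter:
  assumes s: "s \<in> S" and a: "a \<in> transporter scale br U s" and b: "b \<in> U"
    and c: "c \<in> transporter scale br U s"
  shows "lmult S br s (br a b c) \<in> lmult_span scale S br U U"
proof -
  let ?O = "lmult_span scale S br U U"
  have acU: "a \<in> U" "c \<in> U" using a c by (auto simp: transporter_iff)
  have S: "a \<in> S" "b \<in> S" "c \<in> S" using acU b US by auto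
  let ?D = "lmult S br a b" and ?E = "lmult S br s c"
  \<comment> \<open>The commutator of the two operators is expanded twice, letting each act as a
    derivation on the entries of the other. Comparing the results expresses [s,[a,b,c],_] through
    operators with both entries in \<open>U\<close>.\<close>
  have "(?D \<circ> ?E) - (?E \<circ> ?D) = lmult S br (br a b s) c + lmult S br s (br a b c)"
    using commutator_lmult[OF lmult_derivation[OF S(1,2)] s S(3)] s S by (simp add: lmult_def)
  moreover have "(?E \<circ> ?D) - (?D \<circ> ?E) = lmult S br (br s c a) b + lmult S br a (br s c b)"
    using commutator_lmult[OF lmult_derivation[OF s S(3)] S(1,2)] s S by (simp add: lmult_def)
  ultimately have "lmult S br s (br a b c) =
      - (lmult S br (br s c a) b + lmult S br a (br s c b)) - lmult S br (br a b s) c"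
    using minus_diff_eq[of "?E \<circ> ?D" "?D \<circ> ?E"] by (simp add: algebra_simps)
  moreover have "lmult S br (br s c a) b \<in> ?O" "lmult S br a (br s c b) \<in> ?O" "lmult S br (br a b s) c \<in> ?O"
    using transporter_bracket(4)[OF s c acU(1)] transporter_bracket(4)[OF s c b]
      transporter_bracket(1)[OF s a b] acU b by (simp_all add: lmult_mem)
  ultimately show ?thesis
    using op.subspace_add[OF subspace_lmult_span] op.subspace_diff[OF subspace_lmult_span]
      op.subspace_neg[OF subspace_lmult_span] by simp
qed

end

section \<open>The standard embedding of a system of quotients\<close>

context lie_triple_system
begin

lemma stdemb_bracket_odd:
  assumes "E \<in> derivations"
  shows "stdemb_bracket T br (0, s) (E, k) = (lmult T br s k, - E s)"
proof -
  have "(0 \<circ> E) - (E \<circ> 0) = 0" using derivation_zero[OF assms] by (intro ext) simp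
  then show ?thesis by (simp add: stdemb_bracket_def)
qed

lemma stdemb_bracket_even:
  assumes "E \<in> derivations" "k \<in> T"
  shows "stdemb_bracket T br (D, 0) (E, k) = ((D \<circ> E) - (E \<circ> D), D k)"
proof -
  have "lmult T br 0 k = 0" using assms by (intro ext) (simp add: lmult_def zero1)
  then show ?thesis using derivation_zero[OF assms(1)] by (simp add: stdemb_bracket_def)
qed

lemma derivations_0: "0 \<in> derivations"
  by (simp add: derivations_def zero_T zero1 zero2 zero3)

lemma stdemb_bracket_odd_odd: "stdemb_bracket T br (0, s) (0, k) = (lmult T br s k, 0)"
  using stdemb_bracket_odd[OF derivations_0] by simp

lemma stdemb_bracket_triple:
  assumes "x \<in> T" "y \<in> T" "z \<in> T"
  shows "stdemb_bracket T br (stdemb_bracket T br (0, x) (0, y)) (0, z) = (0, br x y z)"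
proof -
  have "(lmult T br x y \<circ> 0) - (0 \<circ> lmult T br x y) = 0"
    using assms by (intro ext) (simp add: lmult_def zero_T zero3)
  then show ?thesis
    unfolding stdemb_bracket_odd_odd
    using assms stdemb_bracket_even[OF derivations_0] by (simp add: lmult_def)
qed

lemma zero_lmult_span: "0 \<in> lmult_span scale T br A B"
proof -
  interpret op: vector_space "op_scale scale" by (rule vector_space_op)
  show ?thesis using op.subspace_0[OF subspace_lmult_span] .
qed

lemma odd_mem: "t \<in> T \<Longrightarrow> (0, t) \<in> stdemb scale T br"
  by (simp add: stdemb_def zero_lmult_span)

end

section \<open>Extending operators from T to S\<close>

locale lts_quotient_embedding = T: lie_triple_system sT T brT + lts_quotients sS S brS "j ` T"
  for sT :: "'f::field \<Rightarrow> 'a::ab_group_add \<Rightarrow> 'a" and T brT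
    and sS :: "'f \<Rightarrow> 's::ab_group_add \<Rightarrow> 's" and S brS and j +
  assumes j_mono: "lts_mono sT T brT sS S brS j"
    and nondeg: "lts_nondegenerate sT T brT"
begin

interpretation opT: vector_space "op_scale sT" by (rule T.vector_space_op)
interpretation opS: vector_space "op_scale sS" by (rule vector_space_op)

abbreviation OT where "OT \<equiv> lmult_span sT T brT T T"
abbreviation OS where "OS \<equiv> lmult_span sS S brS (j ` T) (j ` T)"

lemma j_mem: "x \<in> T \<Longrightarrow> j x \<in> S"
  and j_add: "x \<in> T \<Longrightarrow> y \<in> T \<Longrightarrow> j (x + y) = j x + j y"
  and j_scale: "x \<in> T \<Longrightarrow> j (sT c x) = sS c (j x)"
  and j_br: "x \<in> T \<Longrightarrow> y \<in> T \<Longrightarrow> z \<in> T \<Longrightarrow> j (brT x y z) = brS (j x) (j y) (j z)"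
  and j_inj: "inj_on j T"
  using j_mono by (auto simp: lts_mono_def linear_map_on_def)

lemma j_zero: "j 0 = 0"
  using j_add[of 0 0] T.zero_T by simp

lemma j_neg: "x \<in> T \<Longrightarrow> j (- x) = - j x"
  using j_add[of x "- x"] T.uminus_T[of x] j_zero by (simp add: eq_neg_iff_add_eq_0 add.commute)

lemma j_diff: "x \<in> T \<Longrightarrow> y \<in> T \<Longrightarrow> j (x - y) = j x - j y"
  using j_add[of x "- y"] T.uminus_T[of y] j_neg by simp

lemma j_eq0: "x \<in> T \<Longrightarrow> j x = 0 \<longleftrightarrow> x = 0"
  using inj_onD[OF j_inj, of x 0] j_zero T.zero_T by auto

lemma OT_derivations: "D \<in> OT \<Longrightarrow> D \<in> T.derivations"
  using T.lmult_span_derivations by blast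

lemma lmult_span_S: "A \<subseteq> S \<Longrightarrow> B \<subseteq> S \<Longrightarrow> lmult_span sS S brS A B \<subseteq> lmult_span sS S brS S S"
  unfolding lmult_span_def by (intro opS.span_mono) blast

lemma OS_derivations: "E \<in> OS \<Longrightarrow> E \<in> derivations"
  using lmult_span_S[OF U(2) U(2)] lmult_span_derivations by blast

text \<open>A relation rather than a map, so that sums, multiples and commutators can be treated
  before uniqueness of the extension is available.\<close>

definition extends :: "('a \<Rightarrow> 'a) \<Rightarrow> ('s \<Rightarrow> 's) \<Rightarrow> bool"
  where "extends D E \<longleftrightarrow> (\<forall>t\<in>T. E (j t) = j (D t))"

lemma extends_zero: "extends 0 0"
  by (simp add: extends_def j_zero)

lemma extends_add:
  assumes "D \<in> T.derivations" "D' \<in> T.derivations" "extends D E" "extends D' E'"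
  shows "extends (D + D') (E + E')"
  using assms T.derivationsD(1)[OF assms(1)] T.derivationsD(1)[OF assms(2)]
  by (simp add: extends_def j_add)

lemma extends_scale:
  assumes "D \<in> T.derivations" "extends D E"
  shows "extends (op_scale sT c D) (op_scale sS c E)"
  using assms T.derivationsD(1)[OF assms(1)] by (simp add: extends_def j_scale op_scale_def)

lemma extends_lmult:
  assumes "x \<in> T" "y \<in> T"
  shows "extends (lmult T brT x y) (lmult S brS (j x) (j y))"
  using assms by (simp add: extends_def lmult_def j_br j_mem)

lemma extends_commutator:
  assumes "D \<in> T.derivations" "D' \<in> T.derivations" "extends D E" "extends D' E'"
  shows "extends ((D \<circ> D') - (D' \<circ> D)) ((E \<circ> E') - (E' \<circ> E))"
  using assms T.derivationsD(1)[OF assms(1)] T.derivationsD(1)[OF assms(2)]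
  by (simp add: extends_def j_diff)

text \<open>The difference of two extensions is a derivation of S vanishing on the image of T, so
  \<open>derivation_eq_zero\<close> applies.\<close>

lemma extends_unique:
  assumes "E \<in> derivations" "E' \<in> derivations" "extends D E" "extends D E'"
  shows "E = E'"
proof -
  have "E - E' = 0"
    using assms by (intro derivation_eq_zero opS.subspace_diff[OF subspace_derivations])
      (auto simp: extends_def)
  then show ?thesis by simp
qed

lemma extends_ex:
  assumes A: "A \<subseteq> T" and D: "D \<in> lmult_span sT T brT A T"
  shows "\<exists>E\<in>lmult_span sS S brS (j ` A) (j ` T). extends D E"
proof -
  let ?O = "lmult_span sS S brS (j ` A) (j ` T)"
  \<comment> \<open>Requiring derivations keeps the values D t in T, where j is known to be
    linear.\<close>
  let ?V = "{D \<in> T.derivations. \<exists>E\<in>?O. extends D E}"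
  have "opT.subspace ?V"
  proof (rule opT.subspaceI)
    show "0 \<in> ?V"
      using extends_zero T.derivations_0 zero_lmult_span
      by blast
    show "D + D' \<in> ?V" if "D \<in> ?V" "D' \<in> ?V" for D D'
      using that extends_add opT.subspace_add[OF T.subspace_derivations]
        opS.subspace_add[OF subspace_lmult_span] by blast
    show "op_scale sT c D \<in> ?V" if "D \<in> ?V" for c D
      using that extends_scale opT.subspace_scale[OF T.subspace_derivations]
        opS.subspace_scale[OF subspace_lmult_span] by blast
  qed
  moreover have "lmult T brT a t \<in> ?V" if "a \<in> A" "t \<in> T" for a t
    using extends_lmult[of a t] lmult_mem[of "j a" "j ` A" "j t" "j ` T"] T.lmult_derivation[of a t] that A
    by blast
  ultimately have "lmult_span sT T brT A T \<subseteq> ?V" by (simp add: T.lmult_span_subset_iff)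
  then show ?thesis using D by blast
qed

lemma extends_ex_restriction:
  assumes "E \<in> OS"
  shows "\<exists>D\<in>OT. extends D E"
proof -
  let ?V = "{E. \<exists>D\<in>OT. extends D E}"
  have "opS.subspace ?V"
  proof (rule opS.subspaceI)
    show "0 \<in> ?V" using extends_zero T.zero_lmult_span by blast
    show "E + E' \<in> ?V" if "E \<in> ?V" "E' \<in> ?V" for E E'
      using that extends_add OT_derivations opT.subspace_add[OF T.subspace_lmult_span] by blast
    show "op_scale sS c E \<in> ?V" if "E \<in> ?V" for c E
      using that extends_scale OT_derivations opT.subspace_scale[OF T.subspace_lmult_span] by blast
  qed
  moreover have "lmult S brS a b \<in> ?V" if "a \<in> j ` T" "b \<in> j ` T" for a b
    using that extends_lmult T.lmult_mem by blast
  ultimately have "OS \<subseteq> ?V" by (simp add: lmult_span_subset_iff)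
  then show ?thesis using assms by blast
qed

text \<open>On \<open>OT\<close> the choice is unambiguous: elements of \<open>OS\<close> are
  derivations of S, so \<open>extends_unique\<close> leaves one candidate.\<close>

definition extend :: "('a \<Rightarrow> 'a) \<Rightarrow> 's \<Rightarrow> 's"
  where "extend D = (SOME E. E \<in> OS \<and> extends D E)"

lemma extend:
  assumes "D \<in> OT"
  shows "extend D \<in> OS" "extends D (extend D)"
proof -
  have "\<exists>E. E \<in> OS \<and> extends D E" using extends_ex[OF order_refl assms] by blast
  then show "extend D \<in> OS" "extends D (extend D)"
    unfolding extend_def by (metis (mono_tags, lifting) someI_ex)+
qed

lemma extend_eqI:
  assumes "D \<in> OT" "E \<in> derivations" "extends D E"
  shows "extend D = E"
  using extends_unique[OF OS_derivations[OF extend(1)]] extend(2) assms by blast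

lemma extend_ideal:
  assumes "A \<subseteq> T" "D \<in> lmult_span sT T brT A T"
  shows "extend D \<in> lmult_span sS S brS (j ` A) (j ` T)"
proof -
  obtain E where E: "E \<in> lmult_span sS S brS (j ` A) (j ` T)" "extends D E"
    using extends_ex[OF assms] by blast
  have "D \<in> OT" using T.lmult_span_mono[OF assms(1)] assms(2) by blast
  moreover have "E \<in> derivations"
    using E(1) lmult_span_mono[of "j ` A" "j ` T"] assms(1) OS_derivations by blast
  ultimately show ?thesis using extend_eqI E by simp
qed

lemma extend_zero: "extend 0 = 0"
  using extend_eqI[OF T.zero_lmult_span derivations_0]
    extends_zero by blast

definition incl :: "('a \<Rightarrow> 'a) \<times> 'a \<Rightarrow> ('s \<Rightarrow> 's) \<times> 's"
  where "incl p = (extend (fst p), j (snd p))"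

lemma incl_image: "incl ` stdemb sT T brT = OS \<times> j ` T"
proof
  show "incl ` stdemb sT T brT \<subseteq> OS \<times> j ` T"
    using extend(1) by (auto simp: incl_def stdemb_def)
  show "OS \<times> j ` T \<subseteq> incl ` stdemb sT T brT"
  proof
    fix p assume "p \<in> OS \<times> j ` T"
    then obtain E t where p: "p = (E, j t)" "E \<in> OS" "t \<in> T" by blast
    then obtain D where "D \<in> OT" "extends D E" using extends_ex_restriction by blast
    then have "p = incl (D, t)" "(D, t) \<in> stdemb sT T brT"
      using p extend_eqI OS_derivations by (auto simp: incl_def stdemb_def)
    then show "p \<in> incl ` stdemb sT T brT" by blast
  qed
qed

text \<open>Compatibility of the operator component with each operation reduces, by
  \<open>extend_eqI\<close>, to the fact that the operation applied to the extensions yields a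
  derivation of S extending the corresponding operator on T.\<close>

lemma lie_mono_incl:
  "lie_mono (stdemb_scale sT) (stdemb sT T brT) (stdemb_bracket T brT)
    (stdemb_scale sS) (stdemb sS S brS) (stdemb_bracket S brS) incl"
  unfolding lie_mono_def linear_map_on_def
proof (intro conjI ballI allI)
  have "OS \<subseteq> lmult_span sS S brS S S" using lmult_span_S[OF U(2) U(2)] .
  then show "incl ` stdemb sT T brT \<subseteq> stdemb sS S brS"
    unfolding incl_image by (simp add: stdemb_def Sigma_mono U(2))
  fix p q assume pq: "p \<in> stdemb sT T brT" "q \<in> stdemb sT T brT"
  then have O: "fst p \<in> OT" "fst q \<in> OT" and T: "snd p \<in> T" "snd q \<in> T" by (auto simp: stdemb_def)
  note d = OT_derivations[OF O(1)] OT_derivations[OF O(2)]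
  note E = extend[OF O(1)] extend[OF O(2)]
  note dE = OS_derivations[OF E(1)] OS_derivations[OF E(3)]
  have "extend (fst p + fst q) = extend (fst p) + extend (fst q)"
    by (intro extend_eqI opT.subspace_add[OF T.subspace_lmult_span] O
        opS.subspace_add[OF subspace_derivations] dE extends_add d E)
  then show "incl (p + q) = incl p + incl q" using T by (simp add: incl_def j_add)
  show "incl (stdemb_scale sT c p) = stdemb_scale sS c (incl p)" for c
  proof -
    have "extend (op_scale sT c (fst p)) = op_scale sS c (extend (fst p))"
      by (intro extend_eqI opT.subspace_scale[OF T.subspace_lmult_span] O
          opS.subspace_scale[OF subspace_derivations] dE extends_scale d E)
    then show ?thesis using T by (simp add: incl_def j_scale stdemb_scale_def)
  qed
  let ?C = "(fst p \<circ> fst q) - (fst q \<circ> fst p)"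
    and ?CE = "(extend (fst p) \<circ> extend (fst q)) - (extend (fst q) \<circ> extend (fst p))"
  have C: "?C \<in> OT" using T.commutator_mem[OF T.ideal_T O] .
  have "extend (fst p) \<in> lmult_span sS S brS S S" "extend (fst q) \<in> lmult_span sS S brS S S"
    using E lmult_span_S[OF U(2) U(2)] by blast+
  then have CE: "?CE \<in> derivations"
    using commutator_mem[OF ideal_T] lmult_span_derivations by blast
  have "extend (?C + lmult T brT (snd p) (snd q)) = ?CE + lmult S brS (j (snd p)) (j (snd q))"
    by (intro extend_eqI opT.subspace_add[OF T.subspace_lmult_span] C T.lmult_mem T
        opS.subspace_add[OF subspace_derivations] CE lmult_derivation j_mem
        extends_add OT_derivations extends_commutator d E extends_lmult)
  moreover have "j (fst p (snd q) - fst q (snd p)) = extend (fst p) (j (snd q)) - extend (fst q) (j (snd p))"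
    using E(2,4) T T.derivationsD(1)[OF d(1)] T.derivationsD(1)[OF d(2)] by (simp add: extends_def j_diff)
  ultimately show "incl (stdemb_bracket T brT p q) = stdemb_bracket S brS (incl p) (incl q)"
    by (simp add: incl_def stdemb_bracket_def)
next
  show "inj_on incl (stdemb sT T brT)"
  proof (rule inj_onI)
    fix p q assume pq: "p \<in> stdemb sT T brT" "q \<in> stdemb sT T brT" "incl p = incl q"
    then have O: "fst p \<in> OT" "fst q \<in> OT" and T: "snd p \<in> T" "snd q \<in> T" by (auto simp: stdemb_def)
    note d = OT_derivations[OF O(1)] OT_derivations[OF O(2)]
    have "fst p t = fst q t" for t
    proof (cases "t \<in> T")
      case True
      then have "j (fst p t) = j (fst q t)"
        using pq(3) extend(2)[OF O(1)] extend(2)[OF O(2)] by (simp add: incl_def extends_def)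
      then show ?thesis
        using inj_onD[OF j_inj] T.derivationsD(1)[OF d(1) True] T.derivationsD(1)[OF d(2) True] by blast
    next
      case False
      then show ?thesis using T.derivationsD(2)[OF d(1)] T.derivationsD(2)[OF d(2)] by simp
    qed
    moreover have "snd p = snd q" using pq(3) inj_onD[OF j_inj] T by (simp add: incl_def)
    ultimately show "p = q" by (simp add: prod_eq_iff fun_eq_iff)
  qed
qed

section \<open>Annihilated and absorbed ideals for L(S) over L(T)\<close>

sublocale ext: lie_extension "stdemb_scale sT" "stdemb sT T brT" "stdemb_bracket T brT"
  "stdemb_ideal sT T brT ` zero_centralizer_ideals sT T brT"
  "stdemb_scale sS" "stdemb sS S brS" "stdemb_bracket S brS" incl
  by (intro lie_extension.intro lie_extension_axioms.intro T.lie_filter_stdemb_ideals nondeg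
      lie_algebra_stdemb lie_mono_incl)

lemma incl_odd: "incl (0, t) = (0, j t)"
  by (simp add: incl_def extend_zero)

text \<open>For s /= 0 the quotient condition for the pair s, s gives a nonzero [s,x,y] in the image
  of T. By \<open>annihilates_br\<close>, used twice, it is still annihilated by I, which
  contradicts the zero centralizer.\<close>

lemma annihilates_odd_zero:
  assumes s: "s \<in> S" and I: "I \<in> stdemb_ideal sT T brT ` zero_centralizer_ideals sT T brT"
    and ann: "ext.annihilates (0, s) I"
  shows "s = 0"
proof (rule ccontr)
  assume "s \<noteq> 0"
  then obtain x y where xy: "x \<in> T" "y \<in> T" "brS s (j x) (j y) \<noteq> 0"
      "j x \<in> transporter sS brS (j ` T) s \<or> j y \<in> transporter sS brS (j ` T) s"
    using soqD[OF s s] by blast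
  then have "brS s (j x) (j y) \<in> j ` T" using transporter_bracket(4,5)[OF s] by blast
  then obtain t where t: "t \<in> T" "brS s (j x) (j y) = j t" by blast
  have "ext.annihilates (stdemb_bracket S brS (stdemb_bracket S brS (0, s) (incl (0, x))) (incl (0, y))) I"
    using xy by (intro ext.annihilates_br ext.M.closed ext.e_mem I ann odd_mem s T.odd_mem) (simp_all add: incl_odd)
  then have "ext.annihilates (incl (0, t)) I"
    using stdemb_bracket_triple[OF s j_mem j_mem] xy t by (simp add: incl_odd)
  then have "t = 0"
    using ext.annihilates_image[OF T.odd_mem[OF t(1)] I] by (simp add: zero_prod_def)
  then show False using t xy j_zero by simp
qed

lemma stdemb_ideal_cases:
  assumes "I \<in> stdemb_ideal sT T brT ` zero_centralizer_ideals sT T brT"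
  obtains K where "K \<subseteq> T" "T.subspace K" "I = lmult_span sT T brT K T \<times> K" "lmult_span sT T brT K T \<subseteq> OT"
proof -
  obtain K where K: "I = lmult_span sT T brT K T \<times> K" "lts_ideal sT T brT K"
    using assms by (auto simp: stdemb_ideal_def zero_centralizer_ideals_def)
  then show ?thesis using that[of K] T.lmult_span_mono[of K T T] by (auto simp: T.lts_ideal_iff)
qed

text \<open>Write p = (D,s). The ideal I is the product of its even and odd parts, so it annihilates
  (0,s) separately and s = 0. Then the brackets of p with odd elements of L(T) are the elements (0,
  D t), which I annihilates too; so D vanishes on T and hence on S.\<close>

lemma annihilates_zero:
  assumes p: "p \<in> stdemb sS S brS" and I: "I \<in> stdemb_ideal sT T brT ` zero_centralizer_ideals sT T brT"
    and ann: "ext.annihilates p I"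
  shows "p = 0"
proof -
  obtain D s where Ds: "p = (D, s)" "D \<in> lmult_span sS S brS S S" "s \<in> S"
    using p by (auto simp: stdemb_def)
  have Dd: "D \<in> derivations" using Ds(2) lmult_span_derivations by blast
  obtain K where K: "K \<subseteq> T" "T.subspace K" "I = lmult_span sT T brT K T \<times> K" "lmult_span sT T brT K T \<subseteq> OT"
    using stdemb_ideal_cases[OF I] by blast
  have 1: "lmult S brS s (j k) = 0" "D (j k) = 0" if "k \<in> K" for k
  proof -
    have "(0, k) \<in> I" using that K(3) T.zero_lmult_span by simp
    then have e: "stdemb_bracket S brS (D, s) (0, j k) = 0"
      using ann incl_odd[of k] Ds(1) unfolding ext.annihilates_def by metis
    moreover have "(D \<circ> 0) - (0 \<circ> D) = 0" using derivation_zero[OF Dd] by (intro HOL.ext) simp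
    ultimately show "lmult S brS s (j k) = 0" "D (j k) = 0"
      by (simp_all add: stdemb_bracket_def zero_prod_def)
  qed
  have 2: "(D \<circ> extend E) - (extend E \<circ> D) = 0" "extend E s = 0" if E: "E \<in> lmult_span sT T brT K T" for E
  proof -
    have "(E, 0) \<in> I" using E K(2,3) T.subspace_0 by simp
    then have "stdemb_bracket S brS (D, s) (extend E, 0) = 0"
      using ann Ds(1) j_zero unfolding ext.annihilates_def by (metis fst_conv snd_conv incl_def)
    moreover have "lmult S brS s 0 = 0" using Ds(3) by (intro HOL.ext) (simp add: lmult_def zero2)
    ultimately show "(D \<circ> extend E) - (extend E \<circ> D) = 0" "extend E s = 0"
      using derivation_zero[OF Dd] by (simp_all add: stdemb_bracket_def zero_prod_def)
  qed
  have Ed: "extend E \<in> derivations" if "E \<in> lmult_span sT T brT K T" for E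
    using extend(1) OS_derivations that K(4) by blast
  have "stdemb_bracket S brS (0, s) (incl x) = 0" if "x \<in> I" for x
    using that K(3) 1 2 stdemb_bracket_odd[OF Ed] by (auto simp: incl_def zero_prod_def)
  then have s0: "s = 0"
    using annihilates_odd_zero[OF Ds(3) I] by (simp add: ext.annihilates_def)
  have "D (j t) = 0" if t: "t \<in> T" for t
  proof -
    have "ext.annihilates (stdemb_bracket S brS p (incl (0, t))) I"
      using ext.annihilates_br[OF p I ann T.odd_mem[OF t]] .
    moreover have "(D \<circ> 0) - (0 \<circ> D) = 0" using derivation_zero[OF Dd] by (intro HOL.ext) simp
    ultimately have "ext.annihilates (0, D (j t)) I"
      using stdemb_bracket_even[OF derivations_0 j_mem[OF t], of D]
      by (simp add: Ds(1) s0 incl_odd)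
    then show ?thesis
      using annihilates_odd_zero[OF derivationsD(1)[OF Dd j_mem[OF t]] I] by blast
  qed
  then have "D = 0" using derivation_eq_zero[OF Dd] by blast
  then show ?thesis using Ds(1) s0 by (simp add: zero_prod_def)
qed

lemma transporter_preimage:
  assumes s: "s \<in> S"
  shows "{t \<in> T. j t \<in> transporter sS brS (j ` T) s} \<in> zero_centralizer_ideals sT T brT"
    (is "?J \<in> _")
proof -
  interpret U: lie_triple_system sS "j ` T" brS by (rule lie_triple_system_U)
  let ?tr = "transporter sS brS (j ` T) s"
  have tr: "lts_ideal sS (j ` T) brS ?tr" "lts_centralizer sS (j ` T) brS ?tr = {0}"
    using transporter_zero_centralizer[OF s] by (auto simp: zero_centralizer_ideals_def)
  then have str: "subspace ?tr" "?tr \<subseteq> j ` T" by (auto simp: U.lts_ideal_iff)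
  have "T.subspace ?J"
    by (rule T.subspaceI)
      (use subspace_0[OF str(1)] subspace_add[OF str(1)] subspace_scale[OF str(1)]
        in \<open>simp_all add: T.zero_T T.add_T T.scale_T j_zero j_add j_scale\<close>)
  moreover have "brT x y z \<in> ?J" if "x \<in> ?J" "y \<in> T" "z \<in> T" for x y z
    using that U.ideal_closed(2)[OF tr(1), of "j x" "j y" "j z"] by (simp add: j_br T.closed)
  ultimately have J: "lts_ideal sT T brT ?J" by (auto simp: T.lts_ideal_iff)
  have "x = 0" if x: "x \<in> lts_centralizer sT T brT ?J" for x
  proof -
    have xT: "x \<in> T" using x by (simp add: T.centralizer_iff)
    have "brS (j x) i t = 0 \<and> brS t i (j x) = 0" if it: "i \<in> ?tr" "t \<in> j ` T" for i t
    proof -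
      obtain i' t' where i': "i' \<in> T" "i = j i'" and t': "t' \<in> T" "t = j t'"
        using it str(2) by blast
      then have "brT x i' t' = 0" "brT t' i' x = 0"
        using x it by (auto simp: T.centralizer_iff)
      then show ?thesis using j_br i' t' xT j_zero by metis
    qed
    then have "j x \<in> lts_centralizer sS (j ` T) brS ?tr" using xT by (simp add: U.centralizer_iff)
    then show ?thesis using tr(2) j_eq0[OF xT] by blast
  qed
  moreover have "0 \<in> lts_centralizer sT T brT ?J"
    by (auto simp: T.centralizer_iff T.zero_T T.zero1 T.zero3)
  ultimately show ?thesis using J by (auto simp: zero_centralizer_ideals_def)
qed

text \<open>The bracket of (0,s) with (E, j k) has components [s, j k, _] and - E s. The first is in
  \<open>OS\<close> by \<open>lmult_transporter\<close>, as K lies in [J,T,J] for the preimage J of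
  the transporter of s; the second is in the image of T because K lies in J. The two components are
  also recorded separately, since \<open>embedding_into_Q1\<close> reads off parities from
  them.\<close>

lemma absorbs_odd:
  assumes s: "s \<in> S"
  shows "\<exists>K\<in>zero_centralizer_ideals sT T brT.
    (\<forall>k\<in>K. lmult S brS s (j k) \<in> OS) \<and>
    (\<forall>E\<in>lmult_span sT T brT K T. extend E s \<in> j ` T) \<and>
    ext.absorbs (0, s) (stdemb_ideal sT T brT K)"
proof -
  let ?tr = "transporter sS brS (j ` T) s"
  let ?J = "{t \<in> T. j t \<in> ?tr}"
  have J: "?J \<in> zero_centralizer_ideals sT T brT" using transporter_preimage[OF s] .
  then have Jid: "lts_ideal sT T brT ?J" by (simp add: zero_centralizer_ideals_def)
  then have sJ: "T.subspace ?J" by (simp add: T.lts_ideal_iff)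
  obtain K where K: "K \<in> zero_centralizer_ideals sT T brT" "K \<subseteq> lts_bracket sT brT ?J T ?J"
    using T.zero_centralizer_ideals_power[OF nondeg J] by blast
  have "lts_bracket sT brT ?J T ?J \<subseteq> ?J"
    using T.lts_bracket_subset_iff[OF sJ] T.ideal_closed(2)[OF Jid] by blast
  then have KJ: "K \<subseteq> ?J" using K(2) by blast
  have "T.subspace {k \<in> T. lmult S brS s (j k) \<in> OS}"
  proof (rule T.subspaceI)
    have "lmult S brS s 0 = 0" using s by (intro HOL.ext) (simp add: lmult_def zero2)
    then show "0 \<in> {k \<in> T. lmult S brS s (j k) \<in> OS}"
      using zero_lmult_span by (simp add: j_zero T.zero_T)
  qed (use s opS.subspace_add[OF subspace_lmult_span] opS.subspace_scale[OF subspace_lmult_span]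
      in \<open>simp_all add: T.add_T T.scale_T j_add j_scale j_mem lmult_add2 lmult_scale2\<close>)
  moreover have "brT a b c \<in> T \<and> lmult S brS s (j (brT a b c)) \<in> OS"
    if "a \<in> ?J" "b \<in> T" "c \<in> ?J" for a b c
    using that lmult_transporter[OF s, of "j a" "j b" "j c"] by (simp add: T.closed j_br)
  ultimately have "lts_bracket sT brT ?J T ?J \<subseteq> {k \<in> T. lmult S brS s (j k) \<in> OS}"
    by (simp add: T.lts_bracket_subset_iff)
  then have 1: "lmult S brS s (j k) \<in> OS" if "k \<in> K" for k using that K(2) by blast
  have 2: "extend E s \<in> j ` T" if E: "E \<in> lmult_span sT T brT K T" for E
  proof -
    have "opS.subspace {F. F s \<in> j ` T}"
      by (rule opS.subspaceI)
        (use U(1) in \<open>simp_all add: op_scale_def subspace_0 subspace_add subspace_scale\<close>)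
    moreover have "lmult S brS a b s \<in> j ` T" if ab: "a \<in> j ` K" "b \<in> j ` T" for a b
      using transporter_bracket(1)[OF s _ ab(2), of a] ab(1) KJ s by (auto simp: lmult_def)
    ultimately have "lmult_span sS S brS (j ` K) (j ` T) \<subseteq> {F. F s \<in> j ` T}"
      by (simp add: lmult_span_subset_iff)
    moreover have "K \<subseteq> T" using KJ by blast
    ultimately show ?thesis using extend_ideal[OF _ E] by blast
  qed
  have "stdemb_bracket S brS (0, s) (incl x) \<in> OS \<times> j ` T" if x: "x \<in> stdemb_ideal sT T brT K" for x
  proof -
    have x': "fst x \<in> lmult_span sT T brT K T" "snd x \<in> K" using x by (auto simp: stdemb_ideal_def)
    have "K \<subseteq> T" using KJ by blast
    then have "extend (fst x) \<in> derivations"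
      using extend(1) OS_derivations T.lmult_span_mono x'(1) by blast
    then show ?thesis
      using stdemb_bracket_odd[of "extend (fst x)"] 1 2 x' subspace_neg[OF U(1)] by (simp add: incl_def)
  qed
  then have "ext.absorbs (0, s) (stdemb_ideal sT T brT K)"
    unfolding ext.absorbs_def incl_image by blast
  then show ?thesis using K(1) 1 2 by blast
qed

end

section \<open>The odd part of an algebra of quotients\<close>

locale graded_quotients = T: lie_triple_system sT T brT +
  lie_quotients "stdemb_scale sT" "stdemb sT T brT" "stdemb_bracket T brT"
    "stdemb_ideal sT T brT ` zero_centralizer_ideals sT T brT" sQ Q brQ e
  for sT :: "'f::field \<Rightarrow> 'a::ab_group_add \<Rightarrow> 'a" and T brT
    and sQ :: "'f \<Rightarrow> 'q::ab_group_add \<Rightarrow> 'q" and Q brQ e +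
  fixes Q0 Q1 :: "'q set"
  assumes grading: "z2_grading sQ Q brQ Q0 Q1"
    and e_even: "e ` (lmult_span sT T brT T T \<times> {0}) \<subseteq> Q0"
    and e_odd: "e ` ({0} \<times> T) \<subseteq> Q1"
begin

interpretation opT: vector_space "op_scale sT" by (rule T.vector_space_op)

abbreviation OT where "OT \<equiv> lmult_span sT T brT T T"
abbreviation triple where "triple q q' q'' \<equiv> brQ (brQ q q') q''"

lemma subspace_Q0: "M.subspace Q0" and subspace_Q1: "M.subspace Q1"
  and Q_sum: "Q = {x + y | x y. x \<in> Q0 \<and> y \<in> Q1}" and Q0_Int_Q1: "Q0 \<inter> Q1 = {0}"
  using grading by (simp_all add: z2_grading_def)

lemma Q_br:
  shows "x \<in> Q0 \<Longrightarrow> y \<in> Q0 \<Longrightarrow> brQ x y \<in> Q0"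
    and "x \<in> Q0 \<Longrightarrow> y \<in> Q1 \<Longrightarrow> brQ x y \<in> Q1"
    and "x \<in> Q1 \<Longrightarrow> y \<in> Q0 \<Longrightarrow> brQ x y \<in> Q1"
    and "x \<in> Q1 \<Longrightarrow> y \<in> Q1 \<Longrightarrow> brQ x y \<in> Q0"
  using grading M.lie_bracket_subset_iff[OF subspace_Q0] M.lie_bracket_subset_iff[OF subspace_Q1]
  by (simp_all add: z2_grading_def)

lemma Q0_Q: "x \<in> Q0 \<Longrightarrow> x \<in> Q" and Q1_Q: "x \<in> Q1 \<Longrightarrow> x \<in> Q"
proof -
  have 0: "0 \<in> Q0" "0 \<in> Q1" using Q0_Int_Q1 by auto
  show "x \<in> Q0 \<Longrightarrow> x \<in> Q" unfolding Q_sum using 0(2) by (auto intro: exI[of _ x] exI[of _ 0])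
  show "x \<in> Q1 \<Longrightarrow> x \<in> Q" unfolding Q_sum using 0(1) by (auto intro: exI[of _ x] exI[of _ 0])
qed

lemma even_mem: "D \<in> OT \<Longrightarrow> (D, 0) \<in> stdemb sT T brT"
  by (simp add: stdemb_def T.zero_T)

lemma e_even_mem: "D \<in> OT \<Longrightarrow> e (D, 0) \<in> Q0" and e_odd_mem: "t \<in> T \<Longrightarrow> e (0, t) \<in> Q1"
  using e_even e_odd by auto

lemma e_split:
  assumes "D \<in> OT" "t \<in> T"
  shows "e (D, t) = e (D, 0) + e (0, t)"
  using e_add[OF even_mem[OF assms(1)] T.odd_mem[OF assms(2)]] by simp

text \<open>The even component of such an x lies in both \<open>Q0\<close> and \<open>Q1\<close>, so
  it is zero.\<close>

lemma e_odd_image: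
  assumes "x \<in> e ` stdemb sT T brT" "x \<in> Q1"
  shows "x \<in> e ` ({0} \<times> T)"
proof -
  obtain D t where Dt: "x = e (D, t)" "D \<in> OT" "t \<in> T" using assms(1) by (auto simp: stdemb_def)
  have "e (D, 0) = x - e (0, t)" using e_split Dt by simp
  then have "e (D, 0) \<in> Q1" using M.subspace_diff[OF subspace_Q1 assms(2) e_odd_mem[OF Dt(3)]] by simp
  then have "e (D, 0) = 0" using e_even_mem[OF Dt(2)] Q0_Int_Q1 by blast
  then have "x = e (0, t)" using e_split Dt by simp
  then show ?thesis using Dt(3) by blast
qed

lemma e_lmult:
  assumes "x \<in> T" "y \<in> T"
  shows "e (lmult T brT x y, 0) = brQ (e (0, x)) (e (0, y))"
  using e_br[OF T.odd_mem[OF assms(1)] T.odd_mem[OF assms(2)]]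
  by (simp add: T.stdemb_bracket_odd_odd)

lemma triple_e:
  assumes "x \<in> T" "y \<in> T" "z \<in> T"
  shows "triple (e (0, x)) (e (0, y)) (e (0, z)) = e (0, brT x y z)"
proof -
  have "e (stdemb_bracket T brT (stdemb_bracket T brT (0, x) (0, y)) (0, z)) =
      triple (e (0, x)) (e (0, y)) (e (0, z))"
    using e_br T.odd_mem assms closed by simp
  then show ?thesis using T.stdemb_bracket_triple[OF assms] by simp
qed

text \<open>Each element of the ideal is a linear combination of odd elements (0,a) and of operators
  [a,t,_], and the latter are the brackets of (0,a) with (0,t). It is enough to test q on
  these.\<close>

lemma bracket_stdemb_ideal_zero:
  assumes q: "q \<in> Q" and A: "A \<subseteq> T"
    and odd: "\<And>a. a \<in> A \<Longrightarrow> brQ q (e (0, a)) = 0"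
    and even: "\<And>a t. a \<in> A \<Longrightarrow> t \<in> T \<Longrightarrow> brQ q (brQ (e (0, a)) (e (0, t))) = 0"
    and p: "p \<in> stdemb_ideal sT T brT A"
  shows "brQ q (e p) = 0"
proof -
  obtain E a where Ea: "p = (E, a)" "E \<in> lmult_span sT T brT A T" "a \<in> A"
    using p by (auto simp: stdemb_ideal_def)
  let ?V = "{E \<in> OT. brQ q (e (E, 0)) = 0}"
  have "opT.subspace ?V"
  proof (rule opT.subspaceI)
    show "0 \<in> ?V" using T.zero_lmult_span e_zero M.zero2[OF q] by (simp add: zero_prod_def)
    show "D + E \<in> ?V" if "D \<in> ?V" "E \<in> ?V" for D E
      using that opT.subspace_add[OF T.subspace_lmult_span, of D T T E] q
        e_add[OF even_mem even_mem, of D E] e_mem[OF even_mem, of D] e_mem[OF even_mem, of E]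
      by (simp add: M.add2)
    show "op_scale sT c D \<in> ?V" if "D \<in> ?V" for c D
      using that opT.subspace_scale[OF T.subspace_lmult_span, of D T T c] q
        e_scale[OF even_mem, of D c] e_mem[OF even_mem, of D]
      by (simp add: M.scale2 stdemb_scale_def)
  qed
  moreover have "lmult T brT a t \<in> ?V" if "a \<in> A" "t \<in> T" for a t
    using even[OF that] e_lmult[of a t] A that T.lmult_mem[of a T t T] by auto
  ultimately have "lmult_span sT T brT A T \<subseteq> ?V" by (simp add: T.lmult_span_subset_iff)
  then have E: "E \<in> OT" "brQ q (e (E, 0)) = 0" using Ea(2) by auto
  have "a \<in> T" using Ea(3) A by blast
  then show ?thesis
    using e_split[OF E(1)] M.add2[OF q e_mem[OF even_mem[OF E(1)]] e_mem[OF T.odd_mem]] E(2)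
      odd[OF Ea(3)] Ea(1) by simp
qed

lemma stdemb_ideal_mem:
  "T.subspace K \<Longrightarrow> k \<in> K \<Longrightarrow> (0, k) \<in> stdemb_ideal sT T brT K"
  "T.subspace K \<Longrightarrow> k \<in> K \<Longrightarrow> t \<in> T \<Longrightarrow> (lmult T brT k t, 0) \<in> stdemb_ideal sT T brT K"
  by (simp_all add: stdemb_ideal_def T.zero_lmult_span T.lmult_mem T.subspace_0)

text \<open>The odd part T generates L(T), so d kills the whole image of L(T), in particular a
  member of the filter.\<close>

lemma eq_zero_of_odd:
  assumes d: "d \<in> Q" and z: "\<And>t. t \<in> T \<Longrightarrow> brQ d (e (0, t)) = 0"
  shows "d = 0"
proof -
  have "brQ d (brQ (e (0, a)) (e (0, t))) = 0" if "a \<in> T" "t \<in> T" for a t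
    using M.leibniz[OF d e_mem[OF T.odd_mem] e_mem[OF T.odd_mem], OF that] z that
      M.zero1 M.zero2 e_mem T.odd_mem by simp
  then have 0: "brQ d (e p) = 0" if "p \<in> stdemb_ideal sT T brT T" for p
    using bracket_stdemb_ideal_zero[OF d order_refl z _ that] by blast
  obtain K where K: "K \<in> zero_centralizer_ideals sT T brT" using G_ne by blast
  then have "stdemb_ideal sT T brT K \<subseteq> stdemb_ideal sT T brT T"
    using G_subset[of "stdemb_ideal sT T brT K"] by (auto simp: stdemb_def stdemb_ideal_def)
  then have "annihilates d (stdemb_ideal sT T brT K)" using 0 by (auto simp: annihilates_def)
  then show ?thesis using annihilates_zero[OF d] K by blast
qed

section \<open>\<open>Q1\<close> as a system of quotients, and its maximality\<close>

theorem system_of_quotients_Q1: "system_of_quotients sQ Q1 triple (e ` ({0} \<times> T))"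
proof -
  let ?U = "e ` ({0} \<times> T)"
  have Q1sub: "Q1 \<subseteq> Q" using Q1_Q by blast
  have lts: "lie_triple_system sQ Q1 triple"
    using Q_br by (intro M.lie_triple_system_subspace subspace_Q1 Q1sub) blast
  interpret Q1: lie_triple_system sQ Q1 triple by (rule lts)
  have "{0} \<times> T \<subseteq> stdemb sT T brT" using T.odd_mem by blast
  then have "?U = e ` stdemb sT T brT \<inter> Q1"
    using e_odd_image e_odd by blast
  then have sU: "M.subspace ?U"
    using M.subspace_inter[OF subspace_e[OF subspace_L order_refl] subspace_Q1] by simp
  have eU: "brQ x (e y) \<in> e ` stdemb sT T brT" if xy: "x \<in> e ` stdemb sT T brT" "y \<in> stdemb sT T brT" for x y
  proof -
    obtain z where "z \<in> stdemb sT T brT" "x = e z" using xy(1) by blast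
    then show ?thesis using e_br[of z y] closed[of z y] xy(2) by (metis imageI)
  qed
  have "lts_subsystem sQ Q1 triple ?U"
    unfolding Q1.subsystem_iff using sU e_odd triple_e T.closed by auto
  moreover have "\<exists>x\<in>?U. \<exists>y\<in>?U. triple q x y \<noteq> 0 \<and>
      (x \<in> transporter sQ triple ?U q' \<or> y \<in> transporter sQ triple ?U q')"
    if q: "q \<in> Q1" "q \<noteq> 0" and q': "q' \<in> Q1" for q q'
  proof (rule ccontr)
    assume neg: "\<not> ?thesis"
    obtain I where I: "I \<in> stdemb_ideal sT T brT ` zero_centralizer_ideals sT T brT" "absorbs q' I"
      using absorbs_ex[OF Q1_Q[OF q']] by blast
    then obtain K where K: "K \<in> zero_centralizer_ideals sT T brT" "I = stdemb_ideal sT T brT K" by blast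
    then have sK: "T.subspace K" and KT: "K \<subseteq> T"
      by (auto simp: zero_centralizer_ideals_def T.lts_ideal_iff)
    \<comment> \<open>One ideal I serves the whole span of q', because bracketing with elements of T
      does not shrink an absorbed ideal.\<close>
    have R: "r \<in> Q1 \<and> absorbs r I" if r: "r \<in> R_span sQ triple ?U q'" for r
    proof -
      have "foldr (\<lambda>(x, y) z. triple z x y) ps q' \<in> {r \<in> Q1. absorbs r I}" if "set ps \<subseteq> ?U \<times> ?U" for ps
        using that
      proof (induction ps)
        case (Cons p ps)
        have "p \<in> set (p # ps)" by simp
        then have "p \<in> ?U \<times> ?U" using Cons.prems by blast
        then obtain x y where p: "p = (e (0, x), e (0, y))" "x \<in> T" "y \<in> T" by blast
        define r where "r = foldr (\<lambda>(x, y) z. triple z x y) ps q'"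
        have r: "r \<in> Q1" "absorbs r I" using Cons by (simp_all add: r_def)
        have "absorbs (brQ r (e (0, x))) I" using absorbs_br[OF Q1_Q I(1)] r T.odd_mem p by blast
        moreover have "brQ r (e (0, x)) \<in> Q0" using Q_br(4) r e_odd_mem p by blast
        ultimately have "absorbs (triple r (e (0, x)) (e (0, y))) I"
            "triple r (e (0, x)) (e (0, y)) \<in> Q1"
          using absorbs_br[OF Q0_Q I(1)] T.odd_mem p Q_br(2) e_odd_mem by blast+
        then show ?case by (simp add: p r_def)
      qed (use q' I in simp)
      moreover have "M.subspace {r \<in> Q1. absorbs r I}"
      proof (rule M.subspaceI)
        show "0 \<in> {r \<in> Q1. absorbs r I}" using absorbs_zero[OF I(1)] Q1.zero_T by blast
        show "x + y \<in> {r \<in> Q1. absorbs r I}" if "x \<in> {r \<in> Q1. absorbs r I}" "y \<in> {r \<in> Q1. absorbs r I}" for x y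
          using that absorbs_add[OF Q1_Q Q1_Q, of x y I] I(1) Q1.add_T by simp
        show "sQ c x \<in> {r \<in> Q1. absorbs r I}" if "x \<in> {r \<in> Q1. absorbs r I}" for c x
          using that absorbs_scale[OF Q1_Q, of x I] I(1) Q1.scale_T by simp
      qed
      ultimately have "R_span sQ triple ?U q' \<subseteq> {r \<in> Q1. absorbs r I}"
        unfolding R_span_def by (intro M.span_minimal) auto
      then show ?thesis using r by blast
    qed
    \<comment> \<open>Up to sign the two triple brackets are [r,[x,t]] and [[r,x],t], and both x and
      [x,t] belong to I.\<close>
    have tr: "e (0, x) \<in> transporter sQ triple ?U q'" if x: "x \<in> K" for x
    proof -
      have xT: "x \<in> T" using x KT by blast
      have "triple (e (0, x)) (e (0, t)) r \<in> ?U \<and> triple (e (0, x)) r (e (0, t)) \<in> ?U"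
        if t: "t \<in> T" and r: "r \<in> R_span sQ triple ?U q'" for t r
      proof -
        have r': "r \<in> Q1" "absorbs r I" using R[OF r] by auto
        have eT: "e (0, x) \<in> Q1" "e (0, t) \<in> Q1" using e_odd_mem xT t by auto
        have "brQ r (e (lmult T brT x t, 0)) \<in> e ` stdemb sT T brT" "brQ r (e (0, x)) \<in> e ` stdemb sT T brT"
          using r'(2) stdemb_ideal_mem[OF sK x] t K(2) by (auto simp: absorbs_def)
        then have "- brQ r (brQ (e (0, x)) (e (0, t))) \<in> e ` stdemb sT T brT"
            "brQ (- brQ r (e (0, x))) (e (0, t)) \<in> e ` stdemb sT T brT"
          using e_lmult[OF xT t] M.subspace_neg[OF subspace_e[OF subspace_L order_refl]] eU T.odd_mem[OF t]
          by simp_all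
        moreover have "triple (e (0, x)) (e (0, t)) r = - brQ r (brQ (e (0, x)) (e (0, t)))"
          "brQ (e (0, x)) r = - brQ r (e (0, x))"
          using M.antisymm Q1_Q eT r'(1) M.closed by blast+
        ultimately have "triple (e (0, x)) (e (0, t)) r \<in> e ` stdemb sT T brT"
            "triple (e (0, x)) r (e (0, t)) \<in> e ` stdemb sT T brT"
          by simp_all
        then show ?thesis
          using Q1.closed[OF eT r'(1)] Q1.closed[OF eT(1) r'(1) eT(2)] e_odd_image by blast
      qed
      then show ?thesis
        unfolding transporter_def using Q1.lts_bracket_subset_iff[OF sU] xT by auto
    qed
    \<comment> \<open>The disjunction in the quotient condition is what gives both equations: k may
      stand in either slot.\<close>
    have 1: "triple q (e (0, k)) (e (0, t)) = 0" "triple q (e (0, t)) (e (0, k)) = 0"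
      if kt: "k \<in> K" "t \<in> T" for k t
    proof -
      have "e (0, k) \<in> ?U" "e (0, t) \<in> ?U" using kt KT by auto
      then show "triple q (e (0, k)) (e (0, t)) = 0" "triple q (e (0, t)) (e (0, k)) = 0"
        using neg tr[OF kt(1)] by blast+
    qed
    have 2: "brQ q (e (0, k)) = 0" if k: "k \<in> K" for k
      using eq_zero_of_odd[OF M.closed[OF Q1_Q[OF q(1)] e_mem[OF T.odd_mem]]] 1(1)[OF k] k KT by blast
    \<comment> \<open>In [q,[k,t]] = [[q,k],t] + [k,[q,t]] the first term vanishes by
      \<open>2\<close>, the second by the other equation in \<open>1\<close>.\<close>
    have 3: "brQ q (brQ (e (0, k)) (e (0, t))) = 0" if kt: "k \<in> K" "t \<in> T" for k t
    proof -
      have Q: "q \<in> Q" "e (0, k) \<in> Q" "e (0, t) \<in> Q" using kt KT q(1) Q1_Q e_odd_mem by auto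
      have "brQ (e (0, k)) (brQ q (e (0, t))) = 0"
        using M.antisymm[OF M.closed[OF Q(1,3)] Q(2)] 1(2)[OF kt] by simp
      then show ?thesis using M.leibniz[OF Q] 2[OF kt(1)] M.zero1[OF Q(3)] by simp
    qed
    have "annihilates q I"
      using bracket_stdemb_ideal_zero[OF Q1_Q[OF q(1)] KT 2 3] K(2) by (simp add: annihilates_def)
    then show False using annihilates_zero[OF Q1_Q[OF q(1)] I(1)] q(2) by blast
  qed
  ultimately show ?thesis using lts unfolding system_of_quotients_def by blast
qed

theorem embedding_into_Q1:
  fixes sS :: "'f \<Rightarrow> 's::ab_group_add \<Rightarrow> 's"
  assumes nd: "lts_nondegenerate sT T brT"
    and max: "maximal_lie_algebra_of_quotients (stdemb_scale sT) (stdemb sT T brT) (stdemb_bracket T brT)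
      (stdemb_ideal sT T brT ` zero_centralizer_ideals sT T brT) sQ Q brQ e"
    and j: "lts_mono sT T brT sS S brS j" and soq: "system_of_quotients sS S brS (j ` T)"
  shows "\<exists>\<phi>. lts_mono sS S brS sQ Q1 triple \<phi> \<and> (\<forall>t\<in>T. \<phi> (j t) = e (0, t))"
proof -
  interpret S: lie_triple_system sS S brS using soq by (simp add: system_of_quotients_def)
  interpret S: lts_quotient_embedding sT T brT sS S brS j
    by unfold_locales (fact soq j nd)+
  interpret opS: vector_space "op_scale sS" by (rule S.vector_space_op)
  let ?F = "zero_centralizer_ideals sT T brT"
  let ?P = "{p \<in> stdemb sS S brS. \<exists>I\<in>stdemb_ideal sT T brT ` ?F. S.ext.absorbs p I}"
  let ?b = "stdemb_bracket S brS"
  interpret P: lie_quotients "stdemb_scale sT" "stdemb sT T brT" "stdemb_bracket T brT"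
    "stdemb_ideal sT T brT ` ?F" "stdemb_scale sS" ?P ?b S.incl
    \<comment> \<open>\<open>S.annihilates_zero\<close> is the faithfulness that turns the absorbed
      elements of L(S) into an algebra of quotients.\<close>
    by unfold_locales (rule S.ext.algebra_of_quotients_absorbed[OF S.annihilates_zero])
  obtain \<psi> where \<psi>: "lie_mono (stdemb_scale sS) ?P ?b sQ Q brQ \<psi>"
      "\<And>x. x \<in> stdemb sT T brT \<Longrightarrow> \<psi> (S.incl x) = e x"
    using P.maximal_universal[OF max] by blast
  have \<psi>_add: "\<psi> (p + q) = \<psi> p + \<psi> q" and \<psi>_br: "\<psi> (?b p q) = brQ (\<psi> p) (\<psi> q)"
    if "p \<in> ?P" "q \<in> ?P" for p q
    using \<psi>(1) that unfolding lie_mono_def linear_map_on_def by blast+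
  have \<psi>_scale: "\<psi> (stdemb_scale sS c p) = sQ c (\<psi> p)" and \<psi>_Q: "\<psi> p \<in> Q" if "p \<in> ?P" for c p
    using \<psi>(1) that unfolding lie_mono_def linear_map_on_def by blast+
  have \<psi>_inj: "inj_on \<psi> ?P" using \<psi>(1) by (simp add: lie_mono_def)
  have odd_P: "(0, s) \<in> ?P" if s: "s \<in> S" for s
  proof -
    obtain K where "K \<in> ?F" "S.ext.absorbs (0, s) (stdemb_ideal sT T brT K)"
      using S.absorbs_odd[OF s] by auto
    then show ?thesis using S.odd_mem[OF s] by blast
  qed
  define \<phi> where "\<phi> s = \<psi> (0, s)" for s
  have \<phi>_Q1: "\<phi> s \<in> Q1" if s: "s \<in> S" for s
  proof -
    obtain K where K: "K \<in> ?F"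
      and lm: "\<And>k. k \<in> K \<Longrightarrow> lmult S brS s (j k) \<in> S.OS"
      and ev: "\<And>E. E \<in> lmult_span sT T brT K T \<Longrightarrow> S.extend E s \<in> j ` T"
      using S.absorbs_odd[OF s] by blast
    then have sK: "T.subspace K" and KT: "K \<subseteq> T"
      by (auto simp: zero_centralizer_ideals_def T.lts_ideal_iff)
    \<comment> \<open>The aim is a = 0. Since Q is an algebra of quotients, it suffices that a
      annihilates the ideal belonging to K.\<close>
    obtain a b where ab: "\<phi> s = a + b" "a \<in> Q0" "b \<in> Q1"
      using \<psi>_Q[OF odd_P[OF s]] unfolding Q_sum \<phi>_def by blast
    have diff: "brQ a x = brQ (\<phi> s) x - brQ b x" if "x \<in> Q" for x
      using ab M.add1[OF Q0_Q[OF ab(2)] Q1_Q[OF ab(3)] that] by simp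
    have \<phi>_br: "brQ (\<phi> s) (e x) = \<psi> (?b (0, s) (S.incl x))" if "x \<in> stdemb sT T brT" for x
      using \<psi>_br[OF odd_P[OF s] P.e_mem[OF that]] \<psi>(2)[OF that] by (simp add: \<phi>_def)
    \<comment> \<open>Parity clash: the brackets of \<open>\<phi> s\<close> and of b with an odd
      element of K are even, so that of a is even as well; yet a is even and its bracket with an odd
      element is odd.\<close>
    have odd: "brQ a (e (0, k)) = 0" if k: "k \<in> K" for k
    proof -
      have kT: "k \<in> T" using k KT by blast
      obtain D where D: "D \<in> OT" "S.extend D = lmult S brS s (j k)"
        using S.extends_ex_restriction[OF lm[OF k]] S.extend_eqI S.OS_derivations[OF lm[OF k]] by blast
      have "?b (0, s) (S.incl (0, k)) = S.incl (D, 0)"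
        using D(2) by (simp add: S.stdemb_bracket_odd_odd S.incl_def S.extend_zero S.j_zero)
      then have "brQ (\<phi> s) (e (0, k)) = e (D, 0)"
        using \<phi>_br[OF T.odd_mem[OF kT]] \<psi>(2)[OF even_mem[OF D(1)]] by simp
      then have "brQ (\<phi> s) (e (0, k)) \<in> Q0" using e_even_mem[OF D(1)] by simp
      then have "brQ a (e (0, k)) \<in> Q0"
        using diff[OF e_mem[OF T.odd_mem[OF kT]]] Q_br(4)[OF ab(3) e_odd_mem[OF kT]]
          M.subspace_diff[OF subspace_Q0] by simp
      then show ?thesis using Q_br(2)[OF ab(2) e_odd_mem[OF kT]] Q0_Int_Q1 by blast
    qed
    \<comment> \<open>The same clash with parities exchanged: the brackets of
      \<open>\<phi> s\<close> and b with (E,0) are odd, that of a is even.\<close>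
    have even: "brQ a (e (E, 0)) = 0" if E: "E \<in> lmult_span sT T brT K T" for E
    proof -
      have EO: "E \<in> OT" using T.lmult_span_mono[OF KT] E by blast
      obtain t where t: "t \<in> T" "S.extend E s = j t" using ev[OF E] by blast
      have "lmult S brS s 0 = 0" using s by (intro HOL.ext) (simp add: lmult_def S.zero2)
      then have "?b (0, s) (S.incl (E, 0)) = S.incl (0, - t)"
        using S.stdemb_bracket_odd[OF S.OS_derivations[OF S.extend(1)[OF EO]]] t
        by (simp add: S.incl_def S.extend_zero S.j_zero S.j_neg)
      then have "brQ (\<phi> s) (e (E, 0)) = e (0, - t)"
        using \<phi>_br[OF even_mem[OF EO]] \<psi>(2)[OF T.odd_mem] T.uminus_T t(1) by simp
      then have "brQ (\<phi> s) (e (E, 0)) \<in> Q1" using e_odd_mem T.uminus_T t(1) by simp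
      then have "brQ a (e (E, 0)) \<in> Q1"
        using diff[OF e_mem[OF even_mem[OF EO]]] Q_br(3)[OF ab(3) e_even_mem[OF EO]]
          M.subspace_diff[OF subspace_Q1] by simp
      then show ?thesis using Q_br(1)[OF ab(2) e_even_mem[OF EO]] Q0_Int_Q1 by blast
    qed
    have "brQ a (brQ (e (0, k)) (e (0, t))) = 0" if "k \<in> K" "t \<in> T" for k t
      using even[OF T.lmult_mem[OF that]] e_lmult[of k t] that KT by auto
    then have "annihilates a (stdemb_ideal sT T brT K)"
      using bracket_stdemb_ideal_zero[OF Q0_Q[OF ab(2)] KT odd] by (simp add: annihilates_def)
    then have "a = 0" using annihilates_zero[OF Q0_Q[OF ab(2)]] K by blast
    then show ?thesis using ab by simp
  qed
  have "lts_mono sS S brS sQ Q1 triple \<phi>"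
    unfolding lts_mono_def linear_map_on_def
  proof (intro conjI ballI allI)
    show "\<phi> ` S \<subseteq> Q1" using \<phi>_Q1 by blast
    show "inj_on \<phi> S"
      unfolding \<phi>_def using inj_onD[OF \<psi>_inj _ odd_P odd_P] by (intro inj_onI) blast
    fix x y assume x: "x \<in> S"
    have "stdemb_scale sS c (0, x) = (0, sS c x)" for c
      using opS.scale_zero_right[of c] by (simp add: stdemb_scale_def)
    then show "\<phi> (sS c x) = sQ c (\<phi> x)" for c
      unfolding \<phi>_def using \<psi>_scale[OF odd_P[OF x], of c] by simp
    assume y: "y \<in> S"
    show "\<phi> (x + y) = \<phi> x + \<phi> y"
      unfolding \<phi>_def using \<psi>_add[OF odd_P[OF x] odd_P[OF y]] by simp
    fix z assume z: "z \<in> S"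
    show "\<phi> (brS x y z) = triple (\<phi> x) (\<phi> y) (\<phi> z)"
      unfolding \<phi>_def S.stdemb_bracket_triple[OF x y z, symmetric]
      using \<psi>_br odd_P x y z P.M.closed by simp
  qed
  moreover have "\<phi> (j t) = e (0, t)" if "t \<in> T" for t
    unfolding \<phi>_def using \<psi>(2)[OF T.odd_mem[OF that]] by (simp add: S.incl_odd)
  ultimately show ?thesis by blast
qed

end

theorem mainTheorem3:
  fixes sT :: "'f::field \<Rightarrow> 'a::ab_group_add \<Rightarrow> 'a" and T :: "'a set"
    and brT :: "'a \<Rightarrow> 'a \<Rightarrow> 'a \<Rightarrow> 'a"
    and sQ :: "'f \<Rightarrow> 'q::ab_group_add \<Rightarrow> 'q" and Q Q0 Q1 :: "'q set"
    and brQ :: "'q \<Rightarrow> 'q \<Rightarrow> 'q" and e :: "('a \<Rightarrow> 'a) \<times> 'a \<Rightarrow> 'q"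
  assumes "lie_triple_system sT T brT"
    and "lts_nondegenerate sT T brT"
    and "maximal_lie_algebra_of_quotients (stdemb_scale sT) (stdemb sT T brT) (stdemb_bracket T brT)
           (stdemb_ideal sT T brT ` zero_centralizer_ideals sT T brT) sQ Q brQ e"
    and "z2_grading sQ Q brQ Q0 Q1"
    and "e ` (lmult_span sT T brT T T \<times> {0}) \<subseteq> Q0"
    and "e ` ({0} \<times> T) \<subseteq> Q1"
  shows "system_of_quotients sQ Q1 (\<lambda>q q' q''. brQ (brQ q q') q'') (e ` ({0} \<times> T)) \<and>
    (\<forall>(sS :: 'f \<Rightarrow> 's::ab_group_add \<Rightarrow> 's) S brS j.
       lts_mono sT T brT sS S brS j \<and> system_of_quotients sS S brS (j ` T) \<longrightarrow>
       (\<exists>\<phi>. lts_mono sS S brS sQ Q1 (\<lambda>q q' q''. brQ (brQ q q') q'') \<phi> \<and>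
            (\<forall>t\<in>T. \<phi> (j t) = e (0, t))))"
proof -
  interpret T: lie_triple_system sT T brT by fact
  interpret lie_filter "stdemb_scale sT" "stdemb sT T brT" "stdemb_bracket T brT"
    "stdemb_ideal sT T brT ` zero_centralizer_ideals sT T brT"
    by (rule T.lie_filter_stdemb_ideals) fact
  interpret graded_quotients sT T brT sQ Q brQ e Q0 Q1
    by unfold_locales (use assms in \<open>simp_all add: maximal_lie_algebra_of_quotients_def\<close>)
  show ?thesis using system_of_quotients_Q1 embedding_into_Q1 assms(2,3) by blast
qed

end
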